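(* Let $\mathcal{L}$ be the generator of the Ornstein--Uhlenbeck semigroup $(P_t)$ in $C_0(\mathbb{R}^d)$, and let $$\mathcal{D}_0=\{f\in C_0^2(\mathbb{R}^d)\;:\;x\mapsto\langle Ax,Df(x)\rangle\in C_0(\mathbb{R}^d)\}.$$ The following statements hold: (i) $\mathcal{D}_0\subset D(\mathcal{L})$ and $\mathcal{L}f=\mathcal{L}_0f$ for any $f\in\mathcal{D}_0$; (ii) $\mathcal{D}_0$ is invariant for $(P_t)$, i.e., $P_t(\mathcal{D}_0)\subset\mathcal{D}_0$ for all $t\ge0$; (iii) $\mathcal{D}_0$ is a core for $\mathcal{L}$.
   Context: Let $d\ge1$, let $A$ be a real $d\times d$ matrix (with transpose $A^*$), $Q$ a real symmetric non-negative definite $d\times d$ matrix, $a\in\mathbb{R}^d$, and $\nu$ a $\sigma$-finite Borel measure on $\mathbb{R}^d$ with $\nu(\{0\})=0$ and $\int_{\mathbb{R}^d}(1\wedge|y|^2)\,\nu(dy)<\infty$ (no moment condition on $\nu$ at infinity is assumed). $C_b^2(\mathbb{R}^d)$ is the space of bounded continuous $f:\mathbb{R}^d\to\mathbb{R}$ that are twice differentiable with first and second derivatives bounded and continuous. $C_0(\mathbb{R}^d)$ is the Banach space (sup norm) of real continuous functions on $\mathbb{R}^d$ vanishing at infinity; $C_0^2(\mathbb{R}^d)$ is the set of $f\in C_b^2(\mathbb{R}^d)$ such that $f$, $Df$ and $D^2f$ vanish at infinity. For $f\in C_b^2(\mathbb{R}^d)$ and $x\in\mathbb{R}^d$, $$\mathcal{L}_0f(x)=\tfrac12\mathrm{Tr}(QD^2f(x))+\langle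 a,Df(x)\rangle+\langle Ax,Df(x)\rangle+\int_{\mathbb{R}^d}\big(f(x+y)-f(x)-\mathbf{1}_{\{|y|\le1\}}\langle y,Df(x)\rangle\big)\,\nu(dy).$$ Let $Z=(Z_t)_{t\ge0}$ be a $d$-dimensional Lévy process with $\mathbb{E}[e^{i\langle u,Z_t\rangle}]=e^{-t\psi(u)}$, where $$\psi(u)=\tfrac12\langle Qu,u\rangle-i\langle a,u\rangle-\int_{\mathbb{R}^d}\big(e^{i\langle u,y\rangle}-1-i\langle u,y\rangle\mathbf{1}_{\{|y|\le1\}}\big)\,\nu(dy),\quad u\in\mathbb{R}^d.$$ The Ornstein--Uhlenbeck process is $X^x_t=e^{tA}x+Y_t$ with $Y_t=\int_0^te^{(t-s)A}\,dZ_s$ (the solution of $dX_t=AX_t\,dt+dZ_t$, $X_0=x$). The law $\mu_t$ of $Y_t$ is the Borel probability measure with characteristic function $\hat\mu_t(h)=\exp\big(-\int_0^t\psi(e^{sA^*}h)\,ds\big)$, $h\in\mathbb{R}^d$. The Ornstein--Uhlenbeck semigroup is $$P_tf(x)=\mathbb{E}[f(X^x_t)]=\int_{\mathbb{R}^d}f(e^{tA}x+y)\,\mu_t(dy),\quad t\ge0,\ x\in\mathbb{R}^d;$$ it is a $C_0$-semigroup of contractions on $C_0(\mathbb{R}^d)$. Its generator is $\mathcal{L}f=\lim_{t\to0^+}\frac{P_tf-f}{t}$, with domain $D(\mathcal{L})$ the set of $f\in C_0(\mathbb{R}^d)$ for which the limit exists in $C_0(\mathbb{R}^d)$. A core for the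 generator $\mathcal{A}:D(\mathcal{A})\subset X\to X$ of a $C_0$-semigroup on a Banach space $X$ is a subspace $\mathcal{D}\subset D(\mathcal{A})$ such that for every $\psi\in D(\mathcal{A})$ there is a sequence $(\psi_n)\subset\mathcal{D}$ with $\psi_n\to\psi$ and $\mathcal{A}\psi_n\to\mathcal{A}\psi$ in $X$. *)

theory Defs
  imports "HOL-Probability.Probability"
begin

section \<open>Function spaces\<close>

text \<open>
  Elements of \<open>C\<^sub>0\<close> are plain functions.  Convergence in the sup norm of
  \<open>C\<^sub>0\<close> is expressed by the library's \<^const>\<open>uniform_limit\<close> on \<^const>\<open>UNIV\<close>.
\<close>

definition C0 :: "(real^'n \<Rightarrow> real) set" where
  "C0 = {f. continuous_on UNIV f \<and> (f \<longlongrightarrow> 0) at_infinity}"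

definition grad :: "(real^'n \<Rightarrow> real) \<Rightarrow> real^'n \<Rightarrow> real^'n" where
  "grad f x = (THE D. GDERIV f x :> D)"

definition hess :: "(real^'n \<Rightarrow> real) \<Rightarrow> real^'n \<Rightarrow> real^'n^'n" where
  "hess f x = jacobian (grad f) (at x)"

definition Cb2 :: "(real^'n \<Rightarrow> real) set" where
  "Cb2 = {f.
     (\<forall>x. f differentiable (at x)) \<and> (\<forall>x. grad f differentiable (at x)) \<and>
     continuous_on UNIV f \<and> bounded (range f) \<and>
     continuous_on UNIV (grad f) \<and> bounded (range (grad f)) \<and>
     continuous_on UNIV (hess f) \<and> bounded (range (hess f))}"

definition C02 :: "(real^'n \<Rightarrow> real) set" where
  "C02 = {f \<in> Cb2. (f \<longlongrightarrow> 0) at_infinity \<and>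
     (grad f \<longlongrightarrow> 0) at_infinity \<and> (hess f \<longlongrightarrow> 0) at_infinity}"

definition D0 :: "real^'n^'n \<Rightarrow> (real^'n \<Rightarrow> real) set" where
  "D0 A = {f \<in> C02. (\<lambda>x. (A *v x) \<bullet> grad f x) \<in> C0}"


section \<open>Generator and core of a family of operators on \<open>C\<^sub>0\<close>\<close>

definition generates_at ::
  "(real \<Rightarrow> (real^'n \<Rightarrow> real) \<Rightarrow> real^'n \<Rightarrow> real) \<Rightarrow>
   (real^'n \<Rightarrow> real) \<Rightarrow> (real^'n \<Rightarrow> real) \<Rightarrow> bool" where
  "generates_at P f g \<longleftrightarrow> f \<in> C0 \<and> g \<in> C0 \<and>
     uniform_limit UNIV (\<lambda>t x. (P t f x - f x) / t) g (at_right 0)"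

definition gen_domain ::
  "(real \<Rightarrow> (real^'n \<Rightarrow> real) \<Rightarrow> real^'n \<Rightarrow> real) \<Rightarrow> (real^'n \<Rightarrow> real) set" where
  "gen_domain P = {f. \<exists>g. generates_at P f g}"

definition generator ::
  "(real \<Rightarrow> (real^'n \<Rightarrow> real) \<Rightarrow> real^'n \<Rightarrow> real) \<Rightarrow>
   (real^'n \<Rightarrow> real) \<Rightarrow> real^'n \<Rightarrow> real" where
  "generator P f = (THE g. generates_at P f g)"

definition linear_subspace :: "(real^'n \<Rightarrow> real) set \<Rightarrow> bool" where
  "linear_subspace D \<longleftrightarrow> (\<lambda>x. 0) \<in> D \<and>
     (\<forall>f\<in>D. \<forall>g\<in>D. (\<lambda>x. f x + g x) \<in> D) \<and>
     (\<forall>c. \<forall>f\<in>D. (\<lambda>x. c * f x) \<in> D)"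

definition is_core ::
  "(real^'n \<Rightarrow> real) set \<Rightarrow>
   (real \<Rightarrow> (real^'n \<Rightarrow> real) \<Rightarrow> real^'n \<Rightarrow> real) \<Rightarrow> bool" where
  "is_core D P \<longleftrightarrow> linear_subspace D \<and> D \<subseteq> gen_domain P \<and>
     (\<forall>f\<in>gen_domain P. \<exists>fs :: nat \<Rightarrow> real^'n \<Rightarrow> real.
        (\<forall>n. fs n \<in> D) \<and>
        uniform_limit UNIV fs f sequentially \<and>
        uniform_limit UNIV (\<lambda>n. generator P (fs n)) (generator P f) sequentially)"


section \<open>The Ornstein--Uhlenbeck operator\<close>

definition levy_measure :: "(real^'n) measure \<Rightarrow> bool" where
  "levy_measure \<nu> \<longleftrightarrow> sets \<nu> = sets borel \<and> sigma_finite_measure \<nu> \<and> emeasure \<nu> {0} = 0 \<and>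
     (\<integral>\<^sup>+ y. ennreal (min 1 ((norm y)\<^sup>2)) \<partial>\<nu>) < \<infinity>"

definition OU_operator ::
  "real^'n^'n \<Rightarrow> real^'n^'n \<Rightarrow> real^'n \<Rightarrow> (real^'n) measure \<Rightarrow>
   (real^'n \<Rightarrow> real) \<Rightarrow> real^'n \<Rightarrow> real" where
  "OU_operator A Q a \<nu> f x =
     1/2 * trace (Q ** hess f x) + a \<bullet> grad f x + (A *v x) \<bullet> grad f x
     + (\<integral> y. (f (x + y) - f x - (if norm y \<le> 1 then y \<bullet> grad f x else 0)) \<partial>\<nu>)"


section \<open>Levy processes and the Ornstein--Uhlenbeck process\<close>

definition levy_exponent ::
  "real^'n^'n \<Rightarrow> real^'n \<Rightarrow> (real^'n) measure \<Rightarrow> real^'n \<Rightarrow> complex" where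
  "levy_exponent Q a \<nu> u =
     of_real (1/2 * ((Q *v u) \<bullet> u)) - \<i> * of_real (a \<bullet> u)
     - (\<integral> y. (exp (\<i> * of_real (u \<bullet> y)) - 1
                - \<i> * of_real (if norm y \<le> 1 then u \<bullet> y else 0)) \<partial>\<nu>)"

text \<open>
  Time runs through \<open>[0, \<infinity>)\<close>; the values of \<open>Z\<close> at negative times are irrelevant.
  No path regularity is required: every process as below has a cadlag modification, and
  the semigroup depends on the finite-dimensional distributions only.
\<close>

locale levy_process = prob_space M for M :: "'w measure" +
  fixes Z :: "real \<Rightarrow> 'w \<Rightarrow> real^'n"
  assumes levy_measurable: "\<And>t. t \<ge> 0 \<Longrightarrow> Z t \<in> borel_measurable M"
    and levy_zero: "AE \<omega> in M. Z 0 \<omega> = 0"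
    and levy_indep_increments:
      "\<And>n (\<tau> :: nat \<Rightarrow> real). \<tau> 0 \<ge> 0 \<Longrightarrow> (\<And>i. i < n \<Longrightarrow> \<tau> i \<le> \<tau> (Suc i)) \<Longrightarrow>
         indep_vars (\<lambda>_. borel) (\<lambda>i \<omega>. Z (\<tau> (Suc i)) \<omega> - Z (\<tau> i) \<omega>) {..<n}"
    and levy_stationary_increments:
      "\<And>s t. s \<ge> 0 \<Longrightarrow> t \<ge> 0 \<Longrightarrow>
         distr M borel (\<lambda>\<omega>. Z (s + t) \<omega> - Z s \<omega>) = distr M borel (Z t)"
    and levy_stoch_continuous:
      "\<And>s \<epsilon>. s \<ge> 0 \<Longrightarrow> \<epsilon> > 0 \<Longrightarrow>
         ((\<lambda>t. prob {\<omega> \<in> space M. norm (Z t \<omega> - Z s \<omega>) > \<epsilon>}) \<longlongrightarrow> 0) (at s within {0..})"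

text \<open>
  The type \<^typ>\<open>real^'n^'n\<close> carries no algebra structure with \<open>(**)\<close> as product, so
  the library's \<^const>\<open>exp\<close> does not apply to matrices.
\<close>

definition mexp :: "real^'n^'n \<Rightarrow> real^'n^'n" where
  "mexp B = (\<Sum>k. (((**) B ^^ k) (mat 1)) /\<^sub>R fact k)"

text \<open>
  \<open>has_stochastic_integral M Z G t Y\<close>: the random vector \<open>Y\<close> is (a version of) the
  integral over \<open>[0, t]\<close> of the deterministic matrix-valued function \<open>G\<close> with respect to
  \<open>Z\<close>, i.e. the limit in probability, as the mesh of the partition
  \<open>0 = \<tau> 0 \<le> \<dots> \<le> \<tau> n = t\<close> tends to zero, of the sums of
  \<open>G (\<tau> i) (Z (\<tau> (i+1)) - Z (\<tau> i))\<close>.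
\<close>

definition has_stochastic_integral ::
  "'w measure \<Rightarrow> (real \<Rightarrow> 'w \<Rightarrow> real^'n) \<Rightarrow> (real \<Rightarrow> real^'n^'n) \<Rightarrow> real \<Rightarrow>
   ('w \<Rightarrow> real^'n) \<Rightarrow> bool" where
  "has_stochastic_integral M Z G t Y \<longleftrightarrow> Y \<in> borel_measurable M \<and>
     (\<forall>\<epsilon>>0. \<exists>\<delta>>0. \<forall>n (\<tau> :: nat \<Rightarrow> real).
        \<tau> 0 = 0 \<longrightarrow> \<tau> n = t \<longrightarrow> (\<forall>i<n. \<tau> i \<le> \<tau> (Suc i) \<and> \<tau> (Suc i) - \<tau> i < \<delta>) \<longrightarrow>
        measure M {\<omega> \<in> space M.
          norm ((\<Sum>i<n. G (\<tau> i) *v (Z (\<tau> (Suc i)) \<omega> - Z (\<tau> i) \<omega>)) - Y \<omega>) > \<epsilon>} < \<epsilon>)"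

definition OU_process ::
  "real^'n^'n \<Rightarrow> (real \<Rightarrow> 'w \<Rightarrow> real^'n) \<Rightarrow> real^'n \<Rightarrow> real \<Rightarrow> 'w \<Rightarrow> real^'n" where
  "OU_process A Y x t \<omega> = mexp (t *\<^sub>R A) *v x + Y t \<omega>"

definition OU_semigroup ::
  "'w measure \<Rightarrow> real^'n^'n \<Rightarrow> (real \<Rightarrow> 'w \<Rightarrow> real^'n) \<Rightarrow> real \<Rightarrow>
   (real^'n \<Rightarrow> real) \<Rightarrow> real^'n \<Rightarrow> real" where
  "OU_semigroup M A Y t f x = (\<integral> \<omega>. f (OU_process A Y x t \<omega>) \<partial>M)"

end

theory Submission
  imports Defs
begin

text \<open>
  Write \<open>T\<^sub>t f(z) = E f(z + Y\<^sub>t)\<close>, so that \<open>P\<^sub>t f(x) = T\<^sub>t f(e\<^bsup>tA\<^esup> x)\<close>, and let \<open>L\<close> be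
  \<open>\<L>\<^sub>0\<close> without its drift \<open>\<langle>Ax, Df(x)\<rangle>\<close>.  The key fact is that
  \<open>(T\<^sub>t f - f)/t \<longrightarrow> L f\<close> uniformly for every \<open>f\<close> in \<open>C\<^sub>0\<^sup>2\<close>, whatever the tails of \<open>\<nu>\<close>.
  For mixtures of functions \<open>cos(\<langle>u, x\<rangle> + \<theta>)\<close> it is read off the characteristic function of
  \<open>Y\<^sub>t\<close>, which is the limit of those of the Riemann sums of the stochastic integral.  Such mixtures,
  obtained by cutting off and convolving with a Gaussian, are dense in \<open>C\<^sub>0\<^sup>2\<close> for the \<open>C\<^sup>2\<close> norm,
  and \<open>\<bar>T\<^sub>t f - f\<bar> \<le> C t \<parallel>f\<parallel>\<close> in that norm, because the truncated first and second moments of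
  \<open>Y\<^sub>t\<close> are of order \<open>t\<close>.

  This gives (i), the drift being the derivative of \<open>f\<close> along the flow \<open>e\<^bsup>tA\<^esup>\<close>.  For (ii), \<open>u = P\<^sub>t f\<close>
  is in \<open>C\<^sub>0\<^sup>2\<close> and in the domain, with image \<open>P\<^sub>t \<L> f\<close>; on the other hand \<open>(P\<^sub>s u - u)/s\<close> tends
  pointwise to \<open>L u(x) + \<langle>Ax, Du(x)\<rangle>\<close>, so \<open>\<langle>Ax, Du(x)\<rangle> = P\<^sub>t \<L> f - L u\<close> is in \<open>C\<^sub>0\<close>, although
  \<open>Y\<^sub>t\<close> need not have a first moment.  Finally, a dense invariant subspace of the domain is a core.
\<close>

section \<open>Functions vanishing at infinity and C^2 functions\<close>

text \<open>Large jumps may have no moments, so nothing can be estimated through E|Y_t|. In (ii) a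
  direct computation gives <Ax, Du(x)> as the mean of <A e^(tA) x, Df(e^(tA) x + Y_t)>; replacing
  e^(tA) x there by e^(tA) x + Y_t, to reach the C_0 function <Az, Df(z)>, leaves an uncontrolled
  term A Y_t. Obtaining the drift as a difference of two limits avoids this, but requires the Levy
  part of the limit on all of C_0^2.

  Cosines are the right test functions because both the shift by Y_t and L act on them as
  multipliers; a phase has modulus 1, so the error is bounded independently of x and uniformity in x
  costs nothing. Truncated moments also come from frequencies: the Gaussian average of 1 - cos(<k,
  y>) is 1 - exp(-|y|^2/2), which dominates min(1, |y|^2)/3, and sines of the coordinates replace
  the coordinates. The same density of mixtures shows that the characteristic function determines
  expectations of C_0 functions, and this yields the semigroup property.\<close>

definition vanishing :: "('a::euclidean_space \<Rightarrow> 'b::real_normed_vector) \<Rightarrow> bool" where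
  "vanishing f \<longleftrightarrow> continuous_on UNIV f \<and> (f \<longlongrightarrow> 0) at_infinity"

text \<open>The vector-valued predicate lets one set of lemmas serve a function, its gradient and
  its Hessian.\<close>

lemma C0_iff_vanishing: "f \<in> C0 \<longleftrightarrow> vanishing f"
  by (simp add: C0_def vanishing_def)

lemma vanishing_at_infinityD:
  assumes "vanishing f" "e > 0"
  obtains b where "b > 0" "\<And>x. norm x \<ge> b \<Longrightarrow> norm (f x) < e"
proof -
  obtain b where b: "\<And>x. norm x \<ge> b \<Longrightarrow> dist (f x) 0 < e"
    using assms unfolding vanishing_def Lim_at_infinity by metis
  show thesis
    by (rule that[of "max b 1"]) (use b in \<open>auto simp: dist_norm\<close>)
qed

lemma vanishingI:
  assumes "continuous_on UNIV f" "\<And>e. e > 0 \<Longrightarrow> \<exists>b. \<forall>x. norm x \<ge> b \<longrightarrow> norm (f x) \<le> e"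
  shows "vanishing f"
  unfolding vanishing_def Lim_at_infinity
proof (intro conjI allI impI)
  fix e :: real assume "e > 0"
  then obtain b where "\<forall>x. norm x \<ge> b \<longrightarrow> norm (f x) \<le> e / 2"
    using assms(2)[of "e/2"] by auto
  then show "\<exists>b. \<forall>x. norm x \<ge> b \<longrightarrow> dist (f x) 0 < e"
    using \<open>e > 0\<close> by (intro exI[of _ b]) force
qed (fact assms(1))

lemma vanishing_bounded:
  assumes "vanishing f"
  obtains B where "B > 0" "\<And>x. norm (f x) \<le> B"
proof -
  obtain b where b: "\<And>x. norm x \<ge> b \<Longrightarrow> norm (f x) < 1"
    using vanishing_at_infinityD[OF assms, of 1] by auto
  have "compact (f ` cball 0 b)"
    using assms by (intro compact_continuous_image) (auto simp: vanishing_def intro: continuous_on_subset)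
  then obtain B where B: "\<And>x. x \<in> cball 0 b \<Longrightarrow> norm (f x) \<le> B"
    using compact_imp_bounded bounded_iff by (metis imageI)
  show thesis
  proof (rule that[of "max B 1"])
    fix x show "norm (f x) \<le> max B 1"
      using b[of x] B[of x] by (cases "norm x \<ge> b") auto
  qed auto
qed

lemma vanishing_bounded_range: "vanishing f \<Longrightarrow> bounded (range f)"
  using vanishing_bounded[of f] by (metis (full_types) boundedI rangeE)

lemma vanishing_uniformly_continuous:
  assumes "vanishing f" "e > 0"
  obtains d where "d > 0" "\<And>x y. norm (x - y) < d \<Longrightarrow> norm (f x - f y) < e"
proof -
  obtain b where b: "\<And>x. norm x \<ge> b \<Longrightarrow> norm (f x) < e/2"
    using vanishing_at_infinityD[OF assms(1), of "e/2"] assms(2) by (metis half_gt_zero)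
  have "uniformly_continuous_on (cball 0 (b+1)) f"
    using assms by (intro compact_uniformly_continuous) (auto simp: vanishing_def intro: continuous_on_subset)
  then obtain d where d: "d > 0"
    "\<And>x y. x \<in> cball 0 (b+1) \<Longrightarrow> y \<in> cball 0 (b+1) \<Longrightarrow> dist x y < d \<Longrightarrow> dist (f x) (f y) < e"
    unfolding uniformly_continuous_on_def using assms(2) by metis
  show thesis
  \<comment> \<open>Capping at 1 leaves two cases for close points: both in the ball of radius
    \<open>b + 1\<close>, where Heine-Cantor applies, or both outside radius \<open>b\<close>, where
    both values are small.\<close>
  proof (rule that[of "min d 1"])
    fix x y :: 'a assume xy: "norm (x - y) < min d 1"
    have n: "norm x \<le> norm y + norm (x - y)" "norm y \<le> norm x + norm (x - y)"
      using norm_triangle_ineq[of y "x-y"] norm_triangle_ineq[of x "y-x"] by (auto simp: norm_minus_commute)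
    show "norm (f x - f y) < e"
    proof (cases "norm x \<le> b + 1 \<and> norm y \<le> b + 1")
      case True then show ?thesis using d(2)[of x y] xy by (auto simp: dist_norm)
    next
      case False
      then have "norm x \<ge> b" "norm y \<ge> b" using n xy by auto
      then have "norm (f x) < e/2" "norm (f y) < e/2" using b by auto
      then show ?thesis using norm_triangle_ineq4[of "f x" "f y"] by linarith
    qed
  qed (use d in auto)
qed

lemma vanishing_add: "vanishing f \<Longrightarrow> vanishing g \<Longrightarrow> vanishing (\<lambda>x. f x + g x)"
  unfolding vanishing_def using tendsto_add[of f 0 at_infinity g 0] by (auto intro: continuous_intros)

lemma vanishing_bounded_linear:
  "bounded_linear L \<Longrightarrow> vanishing f \<Longrightarrow> vanishing (\<lambda>x. L (f x))"
  unfolding vanishing_def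
  using bounded_linear.tendsto[of L f 0 at_infinity] bounded_linear.continuous_on[of L UNIV f]
  by (auto simp: linear_simps)

lemma vanishing_diff: "vanishing f \<Longrightarrow> vanishing g \<Longrightarrow> vanishing (\<lambda>x. f x - g x)"
  using vanishing_add[of f "\<lambda>x. - g x"] vanishing_bounded_linear[OF bounded_linear_minus[OF bounded_linear_ident], of g] by simp

lemma vanishing_cmult: "vanishing f \<Longrightarrow> vanishing (\<lambda>x. c * f x :: real)"
  using vanishing_bounded_linear[OF bounded_linear_mult_right] by blast

lemma vanishing_zero: "vanishing (\<lambda>x. 0)"
  by (simp add: vanishing_def)

lemma vanishing_compose:
  "vanishing f \<Longrightarrow> continuous_on UNIV p \<Longrightarrow> filterlim p at_infinity at_infinity \<Longrightarrow> vanishing (\<lambda>x. f (p x))"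
  unfolding vanishing_def
  by (auto intro: filterlim_compose continuous_on_compose2)

lemma vanishing_compact_support:
  assumes "continuous_on UNIV f" "\<And>x. norm x > R \<Longrightarrow> f x = 0"
  shows "vanishing f"
  by (rule vanishingI[OF assms(1)], rule exI[of _ "R+1"]) (use assms(2) in auto)

lemma vanishing_uniform_limit:
  fixes fs :: "'i \<Rightarrow> 'a::euclidean_space \<Rightarrow> 'b::real_normed_vector"
  assumes "uniform_limit UNIV fs f F" "F \<noteq> bot" "\<forall>\<^sub>F n in F. vanishing (fs n)"
  shows "vanishing f"
proof (rule vanishingI)
  show "continuous_on UNIV f"
    by (rule uniform_limit_theorem[OF _ assms(1) assms(2)])
      (use assms(3) in \<open>auto simp: vanishing_def elim: eventually_mono\<close>)
  fix e :: real assume e: "e > 0"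
  have "\<forall>\<^sub>F n in F. \<forall>x. dist (fs n x) (f x) < e/2"
    using uniform_limitD[OF assms(1), of "e/2"] e by simp
  with assms(3) have "\<forall>\<^sub>F n in F. vanishing (fs n) \<and> (\<forall>x. dist (fs n x) (f x) < e/2)"
    by eventually_elim auto
  then obtain n where n: "vanishing (fs n)" "\<And>x. dist (fs n x) (f x) < e/2"
    using assms(2) eventually_happens' by blast
  obtain b where "\<And>x. norm x \<ge> b \<Longrightarrow> norm (fs n x) < e/2"
    using vanishing_at_infinityD[OF n(1), of "e/2"] e by (metis half_gt_zero)
  then show "\<exists>b. \<forall>x. norm x \<ge> b \<longrightarrow> norm (f x) \<le> e"
  proof (intro exI[of _ b] allI impI)
    fix x :: 'a assume "norm x \<ge> b" "\<And>x. norm x \<ge> b \<Longrightarrow> norm (fs n x) < e/2"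
    then show "norm (f x) \<le> e"
      using n(2)[of x] norm_triangle_ineq2[of "f x" "fs n x"] by (force simp: dist_norm norm_minus_commute)
  qed
qed

section \<open>Expectations of randomly shifted functions\<close>

lemma norm_integral_le:
  fixes f :: "'a \<Rightarrow> 'b::{banach, second_countable_topology}"
  assumes "integrable M f" "integrable M g" "\<And>x. x \<in> space M \<Longrightarrow> norm (f x) \<le> g x"
  shows "norm (\<integral>x. f x \<partial>M) \<le> (\<integral>x. g x \<partial>M)"
proof -
  have "norm (\<integral>x. f x \<partial>M) \<le> (\<integral>x. norm (f x) \<partial>M)" by (rule integral_norm_bound)
  also have "\<dots> \<le> (\<integral>x. g x \<partial>M)" using assms by (intro integral_mono) auto
  finally show ?thesis .
qed

context prob_space begin

lemma integrable_vanishing: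
  fixes f :: "'c::euclidean_space \<Rightarrow> 'b::{banach, second_countable_topology}"
  assumes "vanishing f" "Y \<in> borel_measurable M"
  shows "integrable M (\<lambda>\<omega>. f (Y \<omega>))"
proof -
  obtain B where "\<And>x. norm (f x) \<le> B" using vanishing_bounded[OF assms(1)] by auto
  moreover have "f \<in> borel_measurable borel"
    using assms(1) by (auto simp: vanishing_def intro: borel_measurable_continuous_onI)
  ultimately show ?thesis
    using assms(2) by (intro integrable_const_bound[of _ B]) auto
qed

lemma integrable_vanishing_shift:
  fixes f :: "'c::euclidean_space \<Rightarrow> 'b::{banach, second_countable_topology}"
  assumes "vanishing f" "Y \<in> borel_measurable M"
  shows "integrable M (\<lambda>\<omega>. f (x + Y \<omega>))"
  using integrable_vanishing[OF assms(1), of "\<lambda>\<omega>. x + Y \<omega>"] assms(2) by simp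

lemma norm_integral_le_const:
  fixes f :: "'a \<Rightarrow> 'b::{banach, second_countable_topology}"
  assumes "\<And>\<omega>. norm (f \<omega>) \<le> B"
  shows "norm (\<integral>\<omega>. f \<omega> \<partial>M) \<le> B"
proof -
  have B: "0 \<le> B" using assms norm_ge_zero order_trans by blast
  have "norm (\<integral>\<omega>. f \<omega> \<partial>M) \<le> (\<integral>\<omega>. B \<partial>M)"
  proof (cases "integrable M f")
    case True
    show ?thesis by (rule norm_integral_le[OF True]) (use assms in auto)
  \<comment> \<open>A non-integrable function has Bochner integral 0, which still obeys the
    bound.\<close>
  qed (use B in \<open>simp add: not_integrable_integral_eq\<close>)
  then show ?thesis by (simp add: prob_space)
qed

text \<open>Continuity is inherited from uniform continuity of \<open>f\<close>. For the decay,
  along any sequence of points going to infinity the integrand tends to 0 for each outcome and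
  dominated convergence applies with a constant majorant; a failure of decay would supply a sequence
  contradicting this.\<close>

lemma vanishing_shift_mean:
  fixes f :: "'c::euclidean_space \<Rightarrow> 'b::{banach, second_countable_topology}"
  assumes f: "vanishing f" and Y[measurable]: "Y \<in> borel_measurable M"
  shows "vanishing (\<lambda>x. \<integral>\<omega>. f (x + Y \<omega>) \<partial>M)"
proof -
  note int = integrable_vanishing_shift[OF f Y]
  have [measurable]: "f \<in> borel_measurable borel"
    using f by (auto simp: vanishing_def intro: borel_measurable_continuous_onI)
  obtain B where B: "\<And>x. norm (f x) \<le> B" using vanishing_bounded[OF f] by auto
  show ?thesis
  proof (rule vanishingI)
    show "continuous_on UNIV (\<lambda>x. \<integral>\<omega>. f (x + Y \<omega>) \<partial>M)"
      unfolding continuous_on_iff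
    proof (intro ballI allI impI)
      fix x :: 'c and e :: real assume e: "e > 0"
      obtain d where d: "d > 0" "\<And>x y. norm (x - y) < d \<Longrightarrow> norm (f x - f y) < e/2"
        using vanishing_uniformly_continuous[OF f, of "e/2"] e by auto
      show "\<exists>d>0. \<forall>x'\<in>UNIV. dist x' x < d \<longrightarrow>
              dist (\<integral>\<omega>. f (x' + Y \<omega>) \<partial>M) (\<integral>\<omega>. f (x + Y \<omega>) \<partial>M) < e"
      proof (intro exI[of _ d] conjI ballI impI)
        fix x' assume "dist x' x < d"
        then have "norm (\<integral>\<omega>. f (x' + Y \<omega>) - f (x + Y \<omega>) \<partial>M) \<le> e/2"
          using d(2)[of "x' + _" "x + _"] by (intro norm_integral_le_const less_imp_le) (auto simp: dist_norm)
        then show "dist (\<integral>\<omega>. f (x' + Y \<omega>) \<partial>M) (\<integral>\<omega>. f (x + Y \<omega>) \<partial>M) < e"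
          using e by (simp add: dist_norm Bochner_Integration.integral_diff[OF int int])
      qed (use d in auto)
    qed
    fix e :: real assume e: "e > 0"
    show "\<exists>b. \<forall>x. norm x \<ge> b \<longrightarrow> norm (\<integral>\<omega>. f (x + Y \<omega>) \<partial>M) \<le> e"
    proof (rule ccontr)
      assume "\<not> ?thesis"
      then have "\<forall>n::nat. \<exists>x. norm x \<ge> real n \<and> norm (\<integral>\<omega>. f (x + Y \<omega>) \<partial>M) > e"
        by (meson not_le)
      then obtain X where X: "\<And>n::nat. norm (X n) \<ge> real n"
          "\<And>n. norm (\<integral>\<omega>. f (X n + Y \<omega>) \<partial>M) > e"
        by metis
      have "filterlim (\<lambda>n. norm (X n)) at_top sequentially"
        by (rule filterlim_at_top_mono[OF filterlim_real_sequentially]) (auto simp: X)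
      then have "filterlim X at_infinity sequentially"
        by (rule filterlim_norm_at_top_imp_at_infinity)
      then have "filterlim (\<lambda>n. X n + Y \<omega>) at_infinity sequentially" for \<omega>
        by (intro tendsto_add_filterlim_at_infinity') auto
      then have "(\<lambda>n. f (X n + Y \<omega>)) \<longlonglongrightarrow> 0" for \<omega>
        using f by (auto simp: vanishing_def intro: filterlim_compose)
      then have "(\<lambda>n. \<integral>\<omega>. f (X n + Y \<omega>) \<partial>M) \<longlonglongrightarrow> (\<integral>\<omega>. 0 \<partial>M)"
        using B by (intro integral_dominated_convergence[where w="\<lambda>_. B"]) auto
      then have "\<forall>\<^sub>F n in sequentially. norm (\<integral>\<omega>. f (X n + Y \<omega>) \<partial>M) < e"
        using e by (auto simp: tendsto_iff dist_norm)
      then show False using X(2) by (auto simp: eventually_sequentially not_less[symmetric] dest: less_imp_not_less)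
    qed
  qed
qed

end

section \<open>C^2 functions with gradient and Hessian given as data\<close>

definition C2 :: "(real^'n \<Rightarrow> real) \<Rightarrow> (real^'n \<Rightarrow> real^'n) \<Rightarrow> (real^'n \<Rightarrow> real^'n^'n) \<Rightarrow> bool" where
  "C2 f g h \<longleftrightarrow> (\<forall>x. (f has_derivative (\<lambda>v. g x \<bullet> v)) (at x)) \<and>
     (\<forall>x. (g has_derivative (\<lambda>v. h x *v v)) (at x)) \<and> continuous_on UNIV h"

text \<open>Carrying \<open>g\<close> and \<open>h\<close> explicitly replaces the definite
  description in \<open>grad\<close> and the choice in \<open>jacobian\<close> by plain derivative
  statements; uniqueness of derivatives recovers \<open>grad\<close> and \<open>hess\<close> when
  required.\<close>

definition C2_vanishing :: "(real^'n \<Rightarrow> real) \<Rightarrow> (real^'n \<Rightarrow> real^'n) \<Rightarrow> (real^'n \<Rightarrow> real^'n^'n) \<Rightarrow> bool" where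
  "C2_vanishing f g h \<longleftrightarrow> C2 f g h \<and> vanishing f \<and> vanishing g \<and> vanishing h"

lemma grad_eq:
  assumes "(f has_derivative (\<lambda>v. D \<bullet> v)) (at x)"
  shows "grad f x = D"
  unfolding grad_def
proof (rule the_equality)
  show "GDERIV f x :> D" using assms by (simp add: gderiv_def inner_commute)
  fix D' assume "GDERIV f x :> D'"
  then have "(\<lambda>v. D \<bullet> v) = (\<lambda>v. D' \<bullet> v)"
    using has_derivative_unique[OF assms, of "\<lambda>v. D' \<bullet> v"] by (simp add: gderiv_def inner_commute)
  then show "D' = D" by (metis inner_commute vector_eq_ldot)
qed

lemma C2_grad: "C2 f g h \<Longrightarrow> grad f = g"
  using grad_eq by (auto simp: C2_def fun_eq_iff)

lemma hess_eq:
  assumes "(grad f has_derivative (\<lambda>v. H *v v)) (at x)"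
  shows "hess f x = H"
  using frechet_derivative_at[OF assms]
  unfolding hess_def jacobian_def by (metis matrix_of_matrix_vector_mul)

lemma C2_hess: "C2 f g h \<Longrightarrow> hess f = h"
  using C2_grad[of f g h] hess_eq[of f "h x" x for x] by (auto simp: C2_def)

lemma has_derivative_grad:
  fixes f :: "real^'n \<Rightarrow> real"
  assumes "f differentiable (at x)"
  shows "(f has_derivative (\<lambda>v. grad f x \<bullet> v)) (at x)"
proof -
  obtain f' where f': "(f has_derivative f') (at x)" using assms by (auto simp: differentiable_def)
  then have "linear f'" by (rule has_derivative_linear)
  \<comment> \<open>\<open>adjoint f' 1\<close> is the Riesz vector of the linear functional
    \<open>f'\<close>.\<close>
  then have "f' = (\<lambda>v. adjoint f' 1 \<bullet> v)"
    using adjoint_works[of f' _ 1] by (auto simp: fun_eq_iff inner_commute)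
  with f' show ?thesis using grad_eq by metis
qed

text \<open>Continuity together with decay at infinity yields the boundedness clauses of
  \<open>Cb2\<close>.\<close>

lemma C02_iff: "f \<in> C02 \<longleftrightarrow> (\<exists>g h. C2_vanishing f g h)"
proof
  assume "f \<in> C02"
  then have f: "\<And>x. f differentiable (at x)" "\<And>x. grad f differentiable (at x)"
    "continuous_on UNIV (hess f)" "vanishing f" "vanishing (grad f)" "vanishing (hess f)"
    by (auto simp: C02_def Cb2_def vanishing_def)
  have "(grad f has_derivative (\<lambda>v. hess f x *v v)) (at x)" for x
    using f(2)[of x] unfolding hess_def by (simp add: jacobian_works)
  with f have "C2_vanishing f (grad f) (hess f)"
    by (auto simp: C2_vanishing_def C2_def has_derivative_grad)
  then show "\<exists>g h. C2_vanishing f g h" by blast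
next
  assume "\<exists>g h. C2_vanishing f g h"
  then obtain g h where C: "C2_vanishing f g h" by blast
  then have C2: "C2 f g h" and v: "vanishing f" "vanishing g" "vanishing h"
    by (auto simp: C2_vanishing_def)
  show "f \<in> C02"
    unfolding C02_def Cb2_def using C2 v v[THEN vanishing_bounded_range] C2_grad[OF C2] C2_hess[OF C2]
    by (auto simp: vanishing_def C2_def differentiable_def)
qed

lemma C2_vanishing_imp:
  "C2_vanishing f g h \<Longrightarrow> f \<in> C02" "C2_vanishing f g h \<Longrightarrow> grad f = g" "C2_vanishing f g h \<Longrightarrow> hess f = h"
  using C02_iff C2_grad C2_hess C2_vanishing_def by metis+

text \<open>The quantitative form of differentiability that survives integration over a parameter.\<close>

lemma has_derivative_integral_param:
  fixes f :: "'a::real_normed_vector \<Rightarrow> 'p \<Rightarrow> 'b::{banach, second_countable_topology}"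
  assumes int: "\<And>x. integrable N (f x)"
    and int': "\<And>v. integrable N (\<lambda>p. f' p v)"
    and lin: "bounded_linear (\<lambda>v. \<integral>p. f' p v \<partial>N)"
    and C: "integrable N C"
    and rem: "\<And>e. e > 0 \<Longrightarrow> \<exists>d>0. \<forall>v. norm v < d \<longrightarrow>
       (\<forall>p. norm (f (x + v) p - f x p - f' p v) \<le> e * norm v * C p)"
  shows "((\<lambda>x. \<integral>p. f x p \<partial>N) has_derivative (\<lambda>v. \<integral>p. f' p v \<partial>N)) (at x)"
  unfolding has_derivative_at_alt
proof (intro conjI allI impI lin)
  fix e :: real assume e: "e > 0"
  \<comment> \<open>The summand 1 keeps the divisor positive when \<open>C\<close> has integral
    0.\<close>
  define I where "I = \<bar>\<integral>p. C p \<partial>N\<bar> + 1"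
  have I: "I > 0" "(\<integral>p. C p \<partial>N) \<le> I" by (auto simp: I_def)
  then obtain d where d: "d > 0" "\<And>v p. norm v < d \<Longrightarrow> norm (f (x + v) p - f x p - f' p v) \<le> e / I * norm v * C p"
    using rem[of "e / I"] e by fastforce
  show "\<exists>d>0. \<forall>y. norm (y - x) < d \<longrightarrow>
      norm ((\<integral>p. f y p \<partial>N) - (\<integral>p. f x p \<partial>N) - (\<integral>p. f' p (y - x) \<partial>N)) \<le> e * norm (y - x)"
  proof (intro exI[of _ d] conjI allI impI)
    fix y assume y: "norm (y - x) < d"
    have "norm ((\<integral>p. f y p \<partial>N) - (\<integral>p. f x p \<partial>N) - (\<integral>p. f' p (y - x) \<partial>N))
        = norm (\<integral>p. f y p - f x p - f' p (y - x) \<partial>N)"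
      using int int' by simp
    also have "\<dots> \<le> (\<integral>p. e / I * norm (y - x) * C p \<partial>N)"
      using d(2)[OF y] int int' C by (intro norm_integral_le) auto
    also have "\<dots> = e / I * norm (y - x) * (\<integral>p. C p \<partial>N)" by simp
    also have "\<dots> \<le> e / I * norm (y - x) * I"
      using I e by (intro mult_left_mono) auto
    finally show "norm ((\<integral>p. f y p \<partial>N) - (\<integral>p. f x p \<partial>N) - (\<integral>p. f' p (y - x) \<partial>N)) \<le> e * norm (y - x)"
      using I by simp
  qed (use d in auto)
qed

lemma bounded_linear_matrix_vector_left: "bounded_linear (\<lambda>M::real^'n^'m. M *v v)"
  by (simp add: linear_conv_bounded_linear[symmetric] linear_iff matrix_vector_mult_add_rdistrib scaleR_matrix_vector_assoc)

lemma bounded_linear_matrix_vector_right: "bounded_linear (\<lambda>v. (M::real^'n^'m) *v v)"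
  by simp

text \<open>The norm on matrices is the Frobenius norm, so this is Cauchy-Schwarz row by
  row.\<close>

lemma norm_matrix_vector_le: "norm ((M::real^'n^'m) *v v) \<le> norm M * norm v"
proof -
  have "norm (M *v v) = L2_set (\<lambda>i. norm (M $ i \<bullet> v)) UNIV"
    by (simp add: norm_vec_def matrix_vector_mult_def inner_vec_def mult.commute)
  also have "\<dots> \<le> L2_set (\<lambda>i. norm (M $ i) * norm v) UNIV"
    by (intro L2_set_mono) (auto simp: Cauchy_Schwarz_ineq2)
  also have "\<dots> = norm M * norm v"
    by (simp add: L2_set_left_distrib norm_vec_def)
  finally show ?thesis .
qed

text \<open>A uniformly continuous derivative makes the first-order remainder uniform in the base
  point: the mean value inequality is applied to \<open>f\<close> minus the linear map
  \<open>D x\<close>, whose derivative is small on a ball around \<open>x\<close>.\<close>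

lemma has_derivative_uniform_remainder:
  fixes f :: "'a::euclidean_space \<Rightarrow> 'b::euclidean_space"
  assumes der: "\<And>x. (f has_derivative D x) (at x)"
    and unif: "\<And>e. e > 0 \<Longrightarrow> \<exists>d>0. \<forall>x y. norm (x - y) < d \<longrightarrow> (\<forall>v. norm (D x v - D y v) \<le> e * norm v)"
    and e: "e > 0"
  shows "\<exists>d>0. \<forall>x v. norm v < d \<longrightarrow> norm (f (x + v) - f x - D x v) \<le> e * norm v"
proof -
  obtain d where d: "d > 0" "\<And>x y v. norm (x - y) < d \<Longrightarrow> norm (D x v - D y v) \<le> e * norm v"
    using unif[OF e] by blast
  show ?thesis
  proof (intro exI[of _ d] conjI allI impI)
    fix x v :: 'a assume v: "norm v < d"
    have "norm ((f (x + v) - D x (x + v)) - (f x - D x x)) \<le> e * norm ((x + v) - x)"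
    proof (rule differentiable_bound[where S = "ball x d" and f' = "\<lambda>y v. D y v - D x v"])
      fix y assume y: "y \<in> ball x d"
      have "bounded_linear (D x)" using der has_derivative_bounded_linear by blast
      then show "((\<lambda>y. f y - D x y) has_derivative (\<lambda>v. D y v - D x v)) (at y within ball x d)"
        using has_derivative_diff[OF has_derivative_at_withinI[OF der] bounded_linear_imp_has_derivative] by blast
      show "onorm (\<lambda>v. D y v - D x v) \<le> e"
        using d(2)[of y x] y e by (intro onorm_bound) (auto simp: dist_norm norm_minus_commute)
    qed (use v d in \<open>auto simp: dist_norm\<close>)
    moreover have "linear (D x)" using der has_derivative_linear by blast
    ultimately show "norm (f (x + v) - f x - D x v) \<le> e * norm v"
      by (simp add: linear_add algebra_simps)
  qed (use d in auto)
qed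

text \<open>\<open>L\<close> is the inner product when \<open>f\<close> is a scalar function and the
  matrix-vector product when \<open>f\<close> is a gradient. Uniform continuity of the derivative
  comes from its decay at infinity.\<close>

lemma vanishing_remainder:
  fixes f :: "'a::euclidean_space \<Rightarrow> 'b::euclidean_space" and D :: "'a \<Rightarrow> 'c::real_normed_vector"
  assumes der: "\<And>x. (f has_derivative L (D x)) (at x)" and D: "vanishing D"
    and L: "\<And>a b v. norm (L a v - L b v) \<le> K * norm (a - b) * norm v" and K: "K > 0" and e: "e > 0"
  shows "\<exists>d>0. \<forall>x v. norm v < d \<longrightarrow> norm (f (x + v) - f x - L (D x) v) \<le> e * norm v"
proof (rule has_derivative_uniform_remainder[OF der _ e])
  fix e :: real assume e: "e > 0"
  obtain d where d: "d > 0" "\<And>x y. norm (x - y) < d \<Longrightarrow> norm (D x - D y) < e / K"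
    using vanishing_uniformly_continuous[OF D, of "e / K"] e K by auto
  show "\<exists>d>0. \<forall>x y. norm (x - y) < d \<longrightarrow> (\<forall>v. norm (L (D x) v - L (D y) v) \<le> e * norm v)"
  proof (intro exI[of _ d] conjI allI impI)
    fix x y v :: 'a assume "norm (x - y) < d"
    then have "K * norm (D x - D y) * norm v \<le> K * (e / K) * norm v"
      using d(2)[of x y] K by (intro mult_right_mono mult_left_mono) auto
    then show "norm (L (D x) v - L (D y) v) \<le> e * norm v"
      using L[of "D x" v "D y"] K by auto
  qed (use d in auto)
qed

context prob_space begin

text \<open>Differentiation under the expectation: the remainder is uniform in the base point, hence
  in the outcome, so the constant 1 serves as the dominating weight.\<close>

lemma C2_vanishing_shift_mean:
  assumes C: "C2_vanishing f g h" and Y[measurable]: "Y \<in> borel_measurable M"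
  shows "C2_vanishing (\<lambda>x. \<integral>\<omega>. f (x + Y \<omega>) \<partial>M) (\<lambda>x. \<integral>\<omega>. g (x + Y \<omega>) \<partial>M) (\<lambda>x. \<integral>\<omega>. h (x + Y \<omega>) \<partial>M)"
proof -
  have v: "vanishing f" "vanishing g" "vanishing h"
    and df: "\<And>x. (f has_derivative (\<lambda>v. g x \<bullet> v)) (at x)"
    and dg: "\<And>x. (g has_derivative (\<lambda>v. h x *v v)) (at x)"
    using C by (auto simp: C2_vanishing_def C2_def)
  note int = integrable_vanishing_shift[OF v(1) Y] integrable_vanishing_shift[OF v(2) Y] integrable_vanishing_shift[OF v(3) Y]
  have vm: "vanishing (\<lambda>x. \<integral>\<omega>. f (x + Y \<omega>) \<partial>M)" "vanishing (\<lambda>x. \<integral>\<omega>. g (x + Y \<omega>) \<partial>M)"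
     "vanishing (\<lambda>x. \<integral>\<omega>. h (x + Y \<omega>) \<partial>M)"
    using v by (auto intro: vanishing_shift_mean)
  have i1: "(\<lambda>v. (\<integral>\<omega>. g (x + Y \<omega>) \<partial>M) \<bullet> v) = (\<lambda>v. \<integral>\<omega>. g (x + Y \<omega>) \<bullet> v \<partial>M)" for x
    using int(2) by simp
  have i2: "(\<lambda>v. (\<integral>\<omega>. h (x + Y \<omega>) \<partial>M) *v v) = (\<lambda>v. \<integral>\<omega>. h (x + Y \<omega>) *v v \<partial>M)" for x
    using integral_bounded_linear[OF bounded_linear_matrix_vector_left int(3)] by (simp add: fun_eq_iff)
  have "((\<lambda>x. \<integral>\<omega>. f (x + Y \<omega>) \<partial>M) has_derivative (\<lambda>v. (\<integral>\<omega>. g (x + Y \<omega>) \<partial>M) \<bullet> v)) (at x)" for x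
    unfolding i1
  proof (rule has_derivative_integral_param[where C = "\<lambda>_. 1"])
    show "bounded_linear (\<lambda>v. \<integral>\<omega>. g (x + Y \<omega>) \<bullet> v \<partial>M)"
      unfolding i1[symmetric] by (rule bounded_linear_inner_right)
    fix e :: real assume e: "e > 0"
    have "\<exists>d>0. \<forall>x v. norm v < d \<longrightarrow> norm (f (x + v) - f x - g x \<bullet> v) \<le> e * norm v"
      by (rule vanishing_remainder[where L="(\<bullet>)" and K=1, OF df v(2) _ _ e])
         (auto simp: Cauchy_Schwarz_ineq2 inner_diff_left[symmetric])
    then obtain d where d: "d > 0" "\<And>x v. norm v < d \<Longrightarrow> norm (f (x + v) - f x - g x \<bullet> v) \<le> e * norm v" by blast
    show "\<exists>d>0. \<forall>v. norm v < d \<longrightarrow> (\<forall>\<omega>. norm (f (x + v + Y \<omega>) - f (x + Y \<omega>) - g (x + Y \<omega>) \<bullet> v) \<le> e * norm v * 1)"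
    proof (intro exI[of _ d] conjI allI impI)
      fix v :: "real^'b" and \<omega> assume "norm v < d"
      then show "norm (f (x + v + Y \<omega>) - f (x + Y \<omega>) - g (x + Y \<omega>) \<bullet> v) \<le> e * norm v * 1"
        using d(2)[of v "x + Y \<omega>"] by (simp add: algebra_simps)
    qed (use d in auto)
  qed (use int in auto)
  moreover have "((\<lambda>x. \<integral>\<omega>. g (x + Y \<omega>) \<partial>M) has_derivative (\<lambda>v. (\<integral>\<omega>. h (x + Y \<omega>) \<partial>M) *v v)) (at x)" for x
    unfolding i2
  proof (rule has_derivative_integral_param[where C = "\<lambda>_. 1"])
    show "bounded_linear (\<lambda>v. \<integral>\<omega>. h (x + Y \<omega>) *v v \<partial>M)"
      unfolding i2[symmetric] by (rule bounded_linear_matrix_vector_right)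
    show "integrable M (\<lambda>\<omega>. h (x + Y \<omega>) *v v)" for v
      using integrable_bounded_linear[OF bounded_linear_matrix_vector_left int(3)] .
    fix e :: real assume e: "e > 0"
    have "\<exists>d>0. \<forall>x v. norm v < d \<longrightarrow> norm (g (x + v) - g x - h x *v v) \<le> e * norm v"
      by (rule vanishing_remainder[where L="(*v)" and K=1, OF dg v(3) _ _ e])
         (metis norm_matrix_vector_le matrix_vector_mult_diff_rdistrib mult_1, simp)
    then obtain d where d: "d > 0" "\<And>x v. norm v < d \<Longrightarrow> norm (g (x + v) - g x - h x *v v) \<le> e * norm v" by blast
    show "\<exists>d>0. \<forall>v. norm v < d \<longrightarrow> (\<forall>\<omega>. norm (g (x + v + Y \<omega>) - g (x + Y \<omega>) - h (x + Y \<omega>) *v v) \<le> e * norm v * 1)"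
    proof (intro exI[of _ d] conjI allI impI)
      fix v :: "real^'b" and \<omega> assume "norm v < d"
      then show "norm (g (x + v + Y \<omega>) - g (x + Y \<omega>) - h (x + Y \<omega>) *v v) \<le> e * norm v * 1"
        using d(2)[of v "x + Y \<omega>"] by (simp add: algebra_simps)
    qed (use d in auto)
  qed (use int in auto)
  ultimately show ?thesis
    using vm by (auto simp: C2_vanishing_def C2_def vanishing_def)
qed

end


section \<open>The Levy operator on C^2 functions\<close>

text \<open>\<open>K\<close> bounds the C^2 norm. Later estimates are linear in \<open>K\<close>,
  which is what an approximation in C^2 norm exploits.\<close>

definition C2_bounded :: "real \<Rightarrow> (real^'n \<Rightarrow> real) \<Rightarrow> (real^'n \<Rightarrow> real^'n) \<Rightarrow> (real^'n \<Rightarrow> real^'n^'n) \<Rightarrow> bool" where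
  "C2_bounded K f g h \<longleftrightarrow> C2 f g h \<and> (\<forall>x. \<bar>f x\<bar> \<le> K) \<and> (\<forall>x. norm (g x) \<le> K) \<and> (\<forall>x. norm (h x) \<le> K)"

lemma C2_bounded_nonneg: "C2_bounded K f g h \<Longrightarrow> 0 \<le> K"
  unfolding C2_bounded_def by (meson abs_ge_zero order_trans)

lemma C2_vanishing_bounded:
  assumes "C2_vanishing f g h" obtains K where "C2_bounded K f g h"
proof -
  have v: "vanishing f" "vanishing g" "vanishing h" and C: "C2 f g h"
    using assms by (auto simp: C2_vanishing_def)
  obtain a b c where "\<And>x. norm (f x) \<le> a" "\<And>x. norm (g x) \<le> b" "\<And>x. norm (h x) \<le> c"
    using vanishing_bounded[OF v(1)] vanishing_bounded[OF v(2)] vanishing_bounded[OF v(3)] by metis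
  then have "C2_bounded (max a (max b c)) f g h"
    unfolding C2_bounded_def using C by (auto simp: le_max_iff_disj)
  then show thesis by (rule that)
qed

lemma C2_add:
  "C2 f g h \<Longrightarrow> C2 f' g' h' \<Longrightarrow> C2 (\<lambda>x. f x + f' x) (\<lambda>x. g x + g' x) (\<lambda>x. h x + h' x)"
  unfolding C2_def inner_add_left matrix_vector_mult_add_rdistrib
  by (intro conjI allI has_derivative_add continuous_on_add) blast+

lemma C2_cmult:
  assumes "C2 f g h" shows "C2 (\<lambda>x. c * f x) (\<lambda>x. c *\<^sub>R g x) (\<lambda>x. c *\<^sub>R h x)"
proof -
  have "((\<lambda>x. c * f x) has_derivative (\<lambda>v. c *\<^sub>R g x \<bullet> v)) (at x)"
    "((\<lambda>x. c *\<^sub>R g x) has_derivative (\<lambda>v. (c *\<^sub>R h x) *v v)) (at x)" for x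
    using assms has_derivative_mult_right[of f "\<lambda>v. g x \<bullet> v" "at x" c]
      has_derivative_scaleR_right[of g "\<lambda>v. h x *v v" "at x" c]
    by (auto simp: C2_def scaleR_matrix_vector_assoc[symmetric])
  then show ?thesis using assms by (auto simp: C2_def intro!: continuous_intros)
qed

lemma C2_diff:
  "C2 f g h \<Longrightarrow> C2 f' g' h' \<Longrightarrow> C2 (\<lambda>x. f x - f' x) (\<lambda>x. g x - g' x) (\<lambda>x. h x - h' x)"
  using C2_add[OF _ C2_cmult[of f' g' h' "-1"], of f g h] by simp

lemma C2_vanishing_add:
  "C2_vanishing f g h \<Longrightarrow> C2_vanishing f' g' h' \<Longrightarrow>
   C2_vanishing (\<lambda>x. f x + f' x) (\<lambda>x. g x + g' x) (\<lambda>x. h x + h' x)"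
  by (simp add: C2_vanishing_def C2_add vanishing_add)

lemma C2_vanishing_cmult:
  "C2_vanishing f g h \<Longrightarrow> C2_vanishing (\<lambda>x. c * f x) (\<lambda>x. c *\<^sub>R g x) (\<lambda>x. c *\<^sub>R h x)"
  by (simp add: C2_vanishing_def C2_cmult vanishing_cmult vanishing_bounded_linear[OF bounded_linear_scaleR_right])

text \<open>The mean value inequality is used twice: \<open>g\<close> is \<open>K\<close>-Lipschitz,
  so on the ball of radius \<open>norm y\<close> the derivative of \<open>f\<close> minus its linear
  part at \<open>x\<close> is at most \<open>K * norm y\<close>. This gives the constant
  \<open>K\<close> where Taylor would give half of it.\<close>

lemma C2_bounded_second_order:
  assumes "C2_bounded K f g h"
  shows "\<bar>f (x + y) - f x - g x \<bullet> y\<bar> \<le> K * (norm y)\<^sup>2"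
proof -
  have K0: "K \<ge> 0" using C2_bounded_nonneg[OF assms] .
  have df: "\<And>x. (f has_derivative (\<lambda>v. g x \<bullet> v)) (at x)"
    and dg: "\<And>x. (g has_derivative (\<lambda>v. h x *v v)) (at x)"
    using assms by (auto simp: C2_bounded_def C2_def)
  have L: "norm (g z - g x) \<le> K * norm (z - x)" for z
  proof (rule differentiable_bound[where S = UNIV and f' = "\<lambda>z v. h z *v v"])
    fix z show "onorm (\<lambda>v. h z *v v) \<le> K"
    proof (rule onorm_bound)
      fix v have "norm (h z *v v) \<le> norm (h z) * norm v" by (rule norm_matrix_vector_le)
      also have "\<dots> \<le> K * norm v" using assms by (intro mult_right_mono) (auto simp: C2_bounded_def)
      finally show "norm (h z *v v) \<le> K * norm v" .
    qed (rule K0)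
  qed (use dg in auto)
  have "norm ((f (x + y) - g x \<bullet> (x + y)) - (f x - g x \<bullet> x)) \<le> (K * norm y) * norm ((x + y) - x)"
  proof (rule differentiable_bound[where S = "cball x (norm y)" and f' = "\<lambda>z v. g z \<bullet> v - g x \<bullet> v"])
    fix z assume z: "z \<in> cball x (norm y)"
    show "((\<lambda>y. f y - g x \<bullet> y) has_derivative (\<lambda>v. g z \<bullet> v - g x \<bullet> v)) (at z within cball x (norm y))"
      by (rule has_derivative_diff[OF has_derivative_at_withinI[OF df]
         bounded_linear_imp_has_derivative[OF bounded_linear_inner_right]])
    show "onorm (\<lambda>v. g z \<bullet> v - g x \<bullet> v) \<le> K * norm y"
    proof (rule onorm_bound)
      fix v have "norm (g z \<bullet> v - g x \<bullet> v) \<le> norm (g z - g x) * norm v"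
        by (simp add: Cauchy_Schwarz_ineq2 inner_diff_left[symmetric])
      also have "\<dots> \<le> (K * norm y) * norm v"
        using L[of z] z K0 mult_left_mono[of "norm (z - x)" "norm y" K]
        by (intro mult_right_mono) (auto simp: dist_norm norm_minus_commute)
      finally show "norm (g z \<bullet> v - g x \<bullet> v) \<le> K * norm y * norm v" .
    qed (use K0 in auto)
  qed (auto simp: dist_norm)
  then show ?thesis by (simp add: inner_add_right power2_eq_square algebra_simps)
qed

lemma sin_minus_id_bound: "\<bar>sin x - x\<bar> \<le> (x::real)\<^sup>2"
proof -
  have "\<bar>sin x - (\<Sum>m<2. sin_coeff m * x ^ m)\<bar> \<le> inverse (fact 2) * \<bar>x\<bar> ^ 2"
    by (rule Maclaurin_sin_bound)
  also have "\<dots> \<le> x\<^sup>2" by simp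
  finally show ?thesis by (simp add: numeral_2_eq_2 sin_coeff_def)
qed

text \<open>Replacing \<open>y\<close> by the vector of sines in the linear term makes both sides expressible
  through characteristic functions.\<close>

lemma C2_bounded_sin_expansion:
  fixes f :: "real^'n \<Rightarrow> real"
  assumes "C2_bounded K f g h"
  defines "d \<equiv> real DIM(real^'n)"
  shows "\<bar>f (x + y) - f x - (\<Sum>b\<in>Basis. (g x \<bullet> b) * sin (y \<bullet> b))\<bar> \<le> (2 + d) * K * min 1 ((norm y)\<^sup>2)"
proof -
  have gb: "\<bar>g x \<bullet> b\<bar> \<le> K" if "b \<in> Basis" for b
    using Basis_le_norm[OF that, of "g x"] assms(1) order_trans unfolding C2_bounded_def by blast
  have K0: "K \<ge> 0" and d0: "d \<ge> 0" using C2_bounded_nonneg[OF assms(1)] by (auto simp: d_def)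
  show ?thesis
  \<comment> \<open>For small \<open>y\<close> the second-order remainder costs \<open>K\<close> and
    each sine replacing a coordinate costs another \<open>K\<close>. For large \<open>y\<close> the
    two values of \<open>f\<close> cost \<open>2 * K\<close> and each sine term at most
    \<open>K\<close>.\<close>
  proof (cases "norm y \<le> 1")
    case True
    then have m: "min 1 ((norm y)\<^sup>2) = (norm y)\<^sup>2" by (simp add: power_le_one)
    have "g x \<bullet> y - (\<Sum>b\<in>Basis. (g x \<bullet> b) * sin (y \<bullet> b)) = (\<Sum>b\<in>Basis. (g x \<bullet> b) * (y \<bullet> b - sin (y \<bullet> b)))"
      by (simp add: euclidean_inner[of "g x" y] sum_subtractf right_diff_distrib)
    also have "\<bar>\<dots>\<bar> \<le> (\<Sum>b\<in>(Basis::(real^'n) set). K * (norm y)\<^sup>2)"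
    proof (rule order_trans[OF sum_abs], rule sum_mono)
      fix b :: "real^'n" assume b: "b \<in> Basis"
      have "\<bar>y \<bullet> b - sin (y \<bullet> b)\<bar> \<le> \<bar>y \<bullet> b\<bar>\<^sup>2"
        using sin_minus_id_bound[of "y \<bullet> b"] by (simp add: abs_minus_commute)
      also have "\<dots> \<le> (norm y)\<^sup>2" using Basis_le_norm[OF b] by (intro power_mono) auto
      finally show "\<bar>(g x \<bullet> b) * (y \<bullet> b - sin (y \<bullet> b))\<bar> \<le> K * (norm y)\<^sup>2"
        unfolding abs_mult using gb[OF b] K0 by (intro mult_mono) auto
    qed
    also have "\<dots> = d * K * (norm y)\<^sup>2" by (simp add: d_def)
    finally have "\<bar>f (x + y) - f x - (\<Sum>b\<in>Basis. (g x \<bullet> b) * sin (y \<bullet> b))\<bar> \<le> K * (norm y)\<^sup>2 + d * K * (norm y)\<^sup>2"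
      using C2_bounded_second_order[OF assms(1), of x y] by linarith
    also have "\<dots> \<le> (2 + d) * K * (norm y)\<^sup>2" using K0 by (simp add: algebra_simps)
    finally show ?thesis by (simp add: m)
  next
    case False
    then have m: "min 1 ((norm y)\<^sup>2) = 1" by (simp add: min_def)
    have "\<bar>\<Sum>b\<in>Basis. (g x \<bullet> b) * sin (y \<bullet> b)\<bar> \<le> (\<Sum>b\<in>(Basis::(real^'n) set). K * 1)"
    proof (rule order_trans[OF sum_abs], rule sum_mono)
      fix b :: "real^'n" assume "b \<in> Basis"
      then show "\<bar>(g x \<bullet> b) * sin (y \<bullet> b)\<bar> \<le> K * 1"
        unfolding abs_mult using gb K0 by (intro mult_mono) auto
    qed
    moreover have "\<bar>f (x + y)\<bar> \<le> K" "\<bar>f x\<bar> \<le> K" using assms by (auto simp: C2_bounded_def)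
    ultimately show ?thesis unfolding m by (simp add: d_def algebra_simps abs_le_iff)
  qed
qed

text \<open>Expectation of the sine expansion. The remainder contributes the factor 2 plus the
  dimension, the means of the sines contribute the dimension once more.\<close>

lemma (in prob_space) shift_mean_bound:
  fixes f :: "real^'n \<Rightarrow> real"
  assumes B: "C2_bounded K f g h" and Y[measurable]: "Y \<in> borel_measurable M"
    and c1: "(\<integral>\<omega>. min 1 ((norm (Y \<omega>))\<^sup>2) \<partial>M) \<le> c"
    and c2: "\<And>b. b \<in> Basis \<Longrightarrow> \<bar>\<integral>\<omega>. sin (Y \<omega> \<bullet> b) \<partial>M\<bar> \<le> c"
  shows "\<bar>(\<integral>\<omega>. f (x + Y \<omega>) \<partial>M) - f x\<bar> \<le> (2 + 2 * real DIM(real^'n)) * K * c"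
proof -
  have "\<And>x. (f has_derivative (\<lambda>v. g x \<bullet> v)) (at x)" using B by (simp add: C2_bounded_def C2_def)
  then have "continuous_on UNIV f" by (meson continuous_at_imp_continuous_on has_derivative_continuous)
  then have [measurable]: "f \<in> borel_measurable borel" by (rule borel_measurable_continuous_onI)
  have fK: "\<And>x. \<bar>f x\<bar> \<le> K" and gK: "norm (g x) \<le> K" using B by (auto simp: C2_bounded_def)
  then have K0: "K \<ge> 0" using norm_ge_zero order_trans by blast
  have gb: "\<bar>g x \<bullet> b\<bar> \<le> K" if "b \<in> Basis" for b
    using Basis_le_norm[OF that, of "g x"] gK order_trans by blast
  let ?d = "real DIM(real^'n)"
  let ?R = "\<lambda>\<omega>. f (x + Y \<omega>) - f x - (\<Sum>b\<in>Basis. (g x \<bullet> b) * sin (Y \<omega> \<bullet> b))"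
  have i1: "integrable M (\<lambda>\<omega>. f (x + Y \<omega>))" by (rule integrable_const_bound[of _ K]) (auto simp: fK)
  have i2: "integrable M (\<lambda>\<omega>. sin (Y \<omega> \<bullet> b))" for b by (rule integrable_const_bound[of _ 1]) auto
  have i3: "integrable M (\<lambda>\<omega>. min 1 ((norm (Y \<omega>))\<^sup>2))" by (rule integrable_const_bound[of _ 1]) auto
  have "(\<integral>\<omega>. f (x + Y \<omega>) \<partial>M) - f x = (\<integral>\<omega>. ?R \<omega> \<partial>M) + (\<Sum>b\<in>Basis. (g x \<bullet> b) * (\<integral>\<omega>. sin (Y \<omega> \<bullet> b) \<partial>M))"
    using i1 i2 by (simp add: prob_space Bochner_Integration.integral_sum)
  moreover have "\<bar>\<integral>\<omega>. ?R \<omega> \<partial>M\<bar> \<le> (2 + ?d) * K * c"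
  proof -
    have "norm (\<integral>\<omega>. ?R \<omega> \<partial>M) \<le> (\<integral>\<omega>. (2 + ?d) * K * min 1 ((norm (Y \<omega>))\<^sup>2) \<partial>M)"
      using i1 i2 i3 C2_bounded_sin_expansion[OF B, of x] by (intro norm_integral_le) auto
    also have "\<dots> = (2 + ?d) * K * (\<integral>\<omega>. min 1 ((norm (Y \<omega>))\<^sup>2) \<partial>M)" by simp
    also have "\<dots> \<le> (2 + ?d) * K * c" using c1 K0 by (intro mult_left_mono) auto
    finally show ?thesis by simp
  qed
  moreover have "\<bar>\<Sum>b\<in>Basis. (g x \<bullet> b) * (\<integral>\<omega>. sin (Y \<omega> \<bullet> b) \<partial>M)\<bar> \<le> (\<Sum>b\<in>(Basis::(real^'n) set). K * c)"
  proof (rule order_trans[OF sum_abs], rule sum_mono)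
    fix b :: "real^'n" assume b: "b \<in> Basis"
    show "\<bar>(g x \<bullet> b) * (\<integral>\<omega>. sin (Y \<omega> \<bullet> b) \<partial>M)\<bar> \<le> K * c"
      unfolding abs_mult using gb[OF b] c2[OF b] K0 by (intro mult_mono) auto
  qed
  ultimately have "\<bar>(\<integral>\<omega>. f (x + Y \<omega>) \<partial>M) - f x\<bar> \<le> (2 + ?d) * K * c + ?d * (K * c)"
    by simp
  then show ?thesis by (simp add: algebra_simps)
qed

text \<open>Gradient and Hessian are arguments, so that bounds apply directly to the difference of a
  function and an approximating mixture.\<close>

definition levy_op ::
  "real^'n^'n \<Rightarrow> real^'n \<Rightarrow> (real^'n) measure \<Rightarrow> (real^'n \<Rightarrow> real) \<Rightarrow> (real^'n \<Rightarrow> real^'n) \<Rightarrow>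
    (real^'n \<Rightarrow> real^'n^'n) \<Rightarrow> real^'n \<Rightarrow> real" where
  "levy_op Q a \<nu> f g h x = 1/2 * trace (Q ** h x) + a \<bullet> g x
     + (\<integral> y. (f (x + y) - f x - (if norm y \<le> 1 then y \<bullet> g x else 0)) \<partial>\<nu>)"

lemma OU_operator_eq_levy_op:
  "OU_operator A Q a \<nu> f x = levy_op Q a \<nu> f (grad f) (hess f) x + (A *v x) \<bullet> grad f x"
  by (simp add: OU_operator_def levy_op_def)

lemma levy_measure_integrable:
  assumes "levy_measure \<nu>" shows "integrable \<nu> (\<lambda>y. min 1 ((norm y)\<^sup>2))"
proof (rule integrableI_nonneg)
  have s: "sets \<nu> = sets borel" using assms by (simp add: levy_measure_def)
  show "(\<lambda>y. min 1 ((norm y)\<^sup>2)) \<in> borel_measurable \<nu>"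
    unfolding measurable_cong_sets[OF s refl] by measurable
qed (use assms in \<open>auto simp: levy_measure_def\<close>)

text \<open>Small jumps are compensated and use the second-order remainder; large jumps only use
  boundedness of \<open>f\<close>.\<close>

lemma levy_integrand_bound:
  assumes B: "C2_bounded K f g h"
  shows "\<bar>f (x + y) - f x - (if norm y \<le> 1 then y \<bullet> g x else 0)\<bar> \<le> 2 * K * min 1 ((norm y)\<^sup>2)"
proof (cases "norm y \<le> 1")
  case True
  then have m: "min 1 ((norm y)\<^sup>2) = (norm y)\<^sup>2" by (simp add: power_le_one)
  have "K \<ge> 0" using C2_bounded_nonneg[OF assms] .
  then have "K * (norm y)\<^sup>2 \<ge> 0" by simp
  then show ?thesis using C2_bounded_second_order[OF assms, of x y] True by (simp add: m inner_commute)
next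
  case False
  then have m: "min 1 ((norm y)\<^sup>2) = 1" by (simp add: min_def)
  have "\<bar>f (x + y)\<bar> \<le> K" "\<bar>f x\<bar> \<le> K" using assms by (auto simp: C2_bounded_def)
  then show ?thesis using False by (simp add: m)
qed

lemma C2_continuous: "C2 f g h \<Longrightarrow> continuous_on UNIV f"
  by (meson C2_def continuous_at_imp_continuous_on has_derivative_continuous)

lemma levy_integrand_integrable:
  assumes B: "C2_bounded K f g h" and \<nu>: "levy_measure \<nu>"
  shows "integrable \<nu> (\<lambda>y. f (x + y) - f x - (if norm y \<le> 1 then y \<bullet> g x else 0))"
proof (rule Bochner_Integration.integrable_bound)
  show "integrable \<nu> (\<lambda>y. 2 * K * min 1 ((norm y)\<^sup>2))"
    using levy_measure_integrable[OF \<nu>] by simp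
  have s: "sets \<nu> = sets borel" using \<nu> by (simp add: levy_measure_def)
  have [measurable]: "f \<in> borel_measurable borel"
    using B by (auto simp: C2_bounded_def intro: C2_continuous borel_measurable_continuous_onI)
  show "(\<lambda>y. f (x + y) - f x - (if norm y \<le> 1 then y \<bullet> g x else 0)) \<in> borel_measurable \<nu>"
    unfolding measurable_cong_sets[OF s refl] by measurable
  show "AE y in \<nu>. norm (f (x + y) - f x - (if norm y \<le> 1 then y \<bullet> g x else 0)) \<le> norm (2 * K * min 1 ((norm y)\<^sup>2))"
    using levy_integrand_bound[OF B, of x] by (intro AE_I2) (simp add: abs_le_iff order.trans[OF _ abs_ge_self])
qed

lemma bounded_linear_trace_mult: "bounded_linear (\<lambda>H. trace ((Q::real^'n^'n) ** H))"
  unfolding linear_conv_bounded_linear[symmetric] linear_iff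
  by (simp add: trace_def matrix_matrix_mult_def sum_distrib_left sum.distrib algebra_simps)

text \<open>\<open>C\<close> is independent of the function, so the operator is continuous for the
  C^2 norm. This is one half of the density argument; the other half is the corresponding bound on
  difference quotients.\<close>

lemma levy_op_bound:
  fixes Q :: "real^'n^'n"
  assumes \<nu>: "levy_measure \<nu>"
  obtains C where "C > 0" "\<And>K f g h x. C2_bounded K f g h \<Longrightarrow> \<bar>levy_op Q a \<nu> f g h x\<bar> \<le> C * K"
proof -
  obtain q where q: "q > 0" "\<And>H. norm (trace (Q ** H)) \<le> norm H * q"
    using bounded_linear.pos_bounded[OF bounded_linear_trace_mult] by blast
  let ?I = "\<integral>y. min 1 ((norm y)\<^sup>2) \<partial>\<nu>"
  have I: "?I \<ge> 0" by simp
  define C where "C = q + norm a + 2 * ?I"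
  show thesis
  proof (rule that[of C])
    show "C > 0" using q(1) I by (simp add: C_def add_pos_nonneg)
    fix K f g x and h :: "real^'n \<Rightarrow> real^'n^'n" assume B: "C2_bounded K f g h"
    have g: "norm (g x) \<le> K" and h: "norm (h x) \<le> K" using B by (auto simp: C2_bounded_def)
    have K0: "K \<ge> 0" using g norm_ge_zero order_trans by blast
    have "\<bar>trace (Q ** h x)\<bar> \<le> q * K"
      using order_trans[OF q(2)[of "h x"] mult_right_mono[OF h, of q]] q(1) by (simp add: mult.commute[of K])
    moreover have "\<bar>a \<bullet> g x\<bar> \<le> norm a * K"
      using Cauchy_Schwarz_ineq2[of a "g x"] mult_left_mono[OF g, of "norm a"] by simp
    moreover have "norm (\<integral> y. (f (x + y) - f x - (if norm y \<le> 1 then y \<bullet> g x else 0)) \<partial>\<nu>) \<le> (\<integral>y. 2 * K * min 1 ((norm y)\<^sup>2) \<partial>\<nu>)"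
      using levy_integrand_bound[OF B, of x] levy_measure_integrable[OF \<nu>]
      by (intro norm_integral_le levy_integrand_integrable[OF B \<nu>]) auto
    moreover have "0 \<le> q * K" using q(1) K0 by simp
    ultimately show "\<bar>levy_op Q a \<nu> f g h x\<bar> \<le> C * K"
      unfolding levy_op_def C_def by (simp add: algebra_simps abs_le_iff)
  qed
qed

lemma levy_op_diff:
  assumes "C2_bounded K f g h" "C2_bounded K' f' g' h'" and \<nu>: "levy_measure \<nu>"
  shows "levy_op Q a \<nu> (\<lambda>x. f x - f' x) (\<lambda>x. g x - g' x) (\<lambda>x. h x - h' x) x
     = levy_op Q a \<nu> f g h x - levy_op Q a \<nu> f' g' h' x"
proof -
  have "(\<integral> y. ((f (x + y) - f' (x + y)) - (f x - f' x) - (if norm y \<le> 1 then y \<bullet> (g x - g' x) else 0)) \<partial>\<nu>)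
     = (\<integral> y. (f (x + y) - f x - (if norm y \<le> 1 then y \<bullet> g x else 0)) - (f' (x + y) - f' x - (if norm y \<le> 1 then y \<bullet> g' x else 0)) \<partial>\<nu>)"
    by (intro Bochner_Integration.integral_cong) (auto simp: inner_diff_right)
  also have "\<dots> = (\<integral> y. (f (x + y) - f x - (if norm y \<le> 1 then y \<bullet> g x else 0)) \<partial>\<nu>) - (\<integral>y. (f' (x + y) - f' x - (if norm y \<le> 1 then y \<bullet> g' x else 0)) \<partial>\<nu>)"
    by (intro Bochner_Integration.integral_diff levy_integrand_integrable[OF assms(1) \<nu>] levy_integrand_integrable[OF assms(2) \<nu>])
  finally show ?thesis
    unfolding levy_op_def using linear_diff[OF bounded_linear.linear[OF bounded_linear_trace_mult], of Q "h x" "h' x"]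
    by (simp add: inner_diff_right algebra_simps)
qed


section \<open>The standard Gaussian measure\<close>

lemma measurable_cis[measurable]: "cis \<in> borel_measurable borel"
  unfolding cis_conv_exp by (intro borel_measurable_continuous_onI continuous_intros)

text \<open>Given by its density, because the Fourier formula below is an identity between
  densities.\<close>

definition gauss :: "'a::euclidean_space measure" where
  "gauss = density lborel (\<lambda>x. ennreal (\<Prod>b\<in>Basis. std_normal_density (x \<bullet> b)))"

lemma sets_gauss[simp, measurable_cong]: "sets gauss = sets borel"
  and space_gauss[simp]: "space gauss = UNIV"
  by (simp_all add: gauss_def)

text \<open>\<open>lborel\<close> is the image of a product of one-dimensional Lebesgue measures
  under the coordinate map, which reduces the claim to Fubini for a product of one-variable
  functions.\<close>

lemma lborel_integral_prod:
  fixes \<phi> :: "'a::euclidean_space \<Rightarrow> real \<Rightarrow> 'c::{real_normed_field, banach, second_countable_topology}"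
  assumes int: "\<And>b. b \<in> Basis \<Longrightarrow> integrable lborel (\<phi> b)"
  shows "integrable lborel (\<lambda>x. \<Prod>b\<in>Basis. \<phi> b (x \<bullet> b))"
    and "(\<integral>x. (\<Prod>b\<in>Basis. \<phi> b (x \<bullet> b)) \<partial>lborel) = (\<Prod>b\<in>Basis. \<integral>s. \<phi> b s \<partial>lborel)"
proof -
  interpret product_sigma_finite "\<lambda>b::'a. lborel :: real measure" by standard
  let ?S = "\<lambda>f. \<Sum>b\<in>Basis. f b *\<^sub>R (b::'a)"
  have m: "?S \<in> (\<Pi>\<^sub>M b\<in>Basis. lborel) \<rightarrow>\<^sub>M borel" by measurable
  have \<phi>: "\<phi> b \<in> borel_measurable borel" if "b \<in> Basis" for b
    using borel_measurable_integrable[OF int[OF that]] by simp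
  have m2: "(\<lambda>x. \<Prod>b\<in>Basis. \<phi> b (x \<bullet> b)) \<in> borel_measurable borel"
    by (intro borel_measurable_prod measurable_compose[OF _ \<phi>]) auto
  have e: "(\<lambda>f. \<Prod>b\<in>Basis. \<phi> b (?S f \<bullet> b)) = (\<lambda>f. \<Prod>b\<in>Basis. \<phi> b (f b))"
    by (intro ext prod.cong) auto
  show "integrable lborel (\<lambda>x. \<Prod>b\<in>Basis. \<phi> b (x \<bullet> b))"
    by (subst lborel_eq, subst integrable_distr_eq[OF m m2]) (unfold e, intro product_integrable_prod int, auto)
  show "(\<integral>x. (\<Prod>b\<in>Basis. \<phi> b (x \<bullet> b)) \<partial>lborel) = (\<Prod>b\<in>Basis. \<integral>s. \<phi> b s \<partial>lborel)"
    by (subst lborel_eq, subst integral_distr[OF m m2]) (unfold e, intro product_integral_prod int, auto)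
qed

lemma prod_std_normal_nonneg: "0 \<le> (\<Prod>b\<in>Basis. std_normal_density (x \<bullet> b))"
  by (intro prod_nonneg) auto

lemma prod_std_normal_measurable[measurable]:
  "(\<lambda>x. \<Prod>b\<in>Basis. std_normal_density (x \<bullet> b)) \<in> borel_measurable borel"
  by measurable

lemma integral_gauss_prod:
  fixes \<phi> :: "'a::euclidean_space \<Rightarrow> real \<Rightarrow> 'c::{real_normed_field, banach, second_countable_topology}"
  assumes int: "\<And>b. b \<in> Basis \<Longrightarrow> integrable lborel (\<lambda>s. std_normal_density s *\<^sub>R \<phi> b s)"
    and m: "\<And>b. b \<in> Basis \<Longrightarrow> \<phi> b \<in> borel_measurable borel"
  shows "integrable gauss (\<lambda>x. \<Prod>b\<in>Basis. \<phi> b (x \<bullet> b))"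
    and "(\<integral>x. (\<Prod>b\<in>Basis. \<phi> b (x \<bullet> b)) \<partial>gauss) = (\<Prod>b\<in>Basis. \<integral>s. std_normal_density s *\<^sub>R \<phi> b s \<partial>lborel)"
proof -
  have m2: "(\<lambda>x. \<Prod>b\<in>Basis. \<phi> b (x \<bullet> b)) \<in> borel_measurable lborel"
    by (simp, intro borel_measurable_prod measurable_compose[OF _ m]) auto
  have e: "(\<Prod>b\<in>Basis. std_normal_density (x \<bullet> b)) *\<^sub>R (\<Prod>b\<in>Basis. \<phi> b (x \<bullet> b))
      = (\<Prod>b\<in>Basis. std_normal_density (x \<bullet> b) *\<^sub>R \<phi> b (x \<bullet> b))" for x :: 'a
    unfolding scaleR_conv_of_real by (simp only: of_real_prod prod.distrib)
  show "integrable gauss (\<lambda>x. \<Prod>b\<in>Basis. \<phi> b (x \<bullet> b))"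
    unfolding gauss_def using lborel_integral_prod(1)[OF int] m2 prod_std_normal_nonneg
    by (subst integrable_density) (auto simp: e)
  show "(\<integral>x. (\<Prod>b\<in>Basis. \<phi> b (x \<bullet> b)) \<partial>gauss) = (\<Prod>b\<in>Basis. \<integral>s. std_normal_density s *\<^sub>R \<phi> b s \<partial>lborel)"
    unfolding gauss_def using lborel_integral_prod(2)[OF int] m2 prod_std_normal_nonneg
    by (subst integral_density) (auto simp: e)
qed

lemma prob_space_gauss: "prob_space (gauss :: 'a::euclidean_space measure)"
proof
  have "integrable (lborel :: 'a measure) (\<lambda>x. \<Prod>b\<in>Basis. std_normal_density (x \<bullet> b))"
    by (rule lborel_integral_prod(1)) (rule integrable_normal_density, simp)
  moreover have "(\<integral>x. (\<Prod>b\<in>Basis. std_normal_density (x \<bullet> b)) \<partial>(lborel :: 'a measure)) = 1"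
    using lborel_integral_prod(2)[of "\<lambda>_. std_normal_density"] integral_normal_density[of 1 0]
     integrable_normal_density[of 1 0] by simp
  ultimately show "emeasure gauss (space gauss :: 'a set) = 1"
    unfolding gauss_def by (simp add: emeasure_density nn_integral_eq_integral prod_std_normal_nonneg)
qed

lemma gauss_char: "(\<integral>x. cis (u \<bullet> x) \<partial>gauss) = of_real (exp (- (norm u)\<^sup>2 / 2))"
proof -
  have cis_sum: "cis (\<Sum>b\<in>S. f b) = (\<Prod>b\<in>S. cis (f b))" if "finite S" for f :: "'a \<Rightarrow> real" and S
    using that by induction (auto simp: cis_mult[symmetric])
  have 1: "(\<integral>s. std_normal_density s *\<^sub>R cis (t * s) \<partial>lborel) = of_real (exp (- t\<^sup>2 / 2))" for t
  proof -
    have "(\<integral>s. std_normal_density s *\<^sub>R cis (t * s) \<partial>lborel) = char std_normal_distribution t"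
      unfolding char_def cis_conv_exp
      by (subst integral_density) (auto simp: normal_density_nonneg mult.commute)
    then show ?thesis by (simp add: char_std_normal_distribution)
  qed
  have 2: "integrable lborel (\<lambda>s. std_normal_density s *\<^sub>R cis (t * s))" for t
    by (rule Bochner_Integration.integrable_bound[OF integrable_normal_density[of 1 0]]) auto
  have "(\<integral>x. cis (u \<bullet> x) \<partial>gauss) = (\<integral>x. (\<Prod>b\<in>Basis. cis ((u \<bullet> b) * (x \<bullet> b))) \<partial>gauss)"
    by (subst euclidean_inner) (simp add: cis_sum)
  also have "\<dots> = (\<Prod>b\<in>Basis. of_real (exp (- (u \<bullet> b)\<^sup>2 / 2)))"
    using integral_gauss_prod(2)[of "\<lambda>b s. cis ((u \<bullet> b) * s)"] 2 by (simp add: 1)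
  also have "\<dots> = of_real (exp (\<Sum>b\<in>Basis. - (u \<bullet> b)\<^sup>2 / 2))"
    by (simp add: exp_sum)
  also have "(\<Sum>b\<in>Basis. - (u \<bullet> b)\<^sup>2 / 2) = - (norm u)\<^sup>2 / 2"
    unfolding power2_norm_eq_inner by (subst (2) euclidean_inner) (simp add: sum_negf sum_divide_distrib power2_eq_square)
  finally show ?thesis .
qed

lemma integrable_gauss_bounded:
  fixes f :: "'a::euclidean_space \<Rightarrow> 'b::{banach, second_countable_topology}"
  assumes "f \<in> borel_measurable borel" "\<And>x. norm (f x) \<le> B"
  shows "integrable gauss f"
proof -
  interpret prob_space "gauss :: 'a measure" by (rule prob_space_gauss)
  show ?thesis by (rule integrable_const_bound[of _ B]) (use assms in auto)
qed

lemma gauss_cos: "(\<integral>x. cos (u \<bullet> x) \<partial>gauss) = exp (- (norm u)\<^sup>2 / 2)"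
proof -
  have "integrable gauss (\<lambda>x. cis (u \<bullet> x))"
    by (rule integrable_gauss_bounded[of _ 1]) auto
  from integral_Re[OF this] show ?thesis by (simp add: gauss_char)
qed

text \<open>The exponent 3 is that of the weight in \<open>trig_mixture\<close>. The function is
  dominated by a product over the coordinates, because \<open>1 + norm x\<close> is at most the
  product of the factors \<open>1 + \<bar>x \<bullet> b\<bar>\<close>; that product integrates
  factor by factor.\<close>

lemma integrable_gauss_moment: "integrable gauss (\<lambda>x::'a::euclidean_space. (1 + norm x) ^ 3)"
proof (rule Bochner_Integration.integrable_bound)
  have "integrable lborel (\<lambda>s. std_normal_density s *\<^sub>R (1 + \<bar>s\<bar>) ^ 3)"
  proof -
    have "(\<lambda>s. std_normal_density s *\<^sub>R (1 + \<bar>s\<bar>) ^ 3) = (\<lambda>s. std_normal_density s * \<bar>s\<bar>^0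
        + 3 * (std_normal_density s * \<bar>s\<bar>^1) + 3 * (std_normal_density s * \<bar>s\<bar>^2) + std_normal_density s * \<bar>s\<bar>^3)"
      by (simp add: fun_eq_iff power3_eq_cube power2_eq_square algebra_simps)
    then show ?thesis
      using integrable_std_normal_moment_abs by (simp only:) (intro Bochner_Integration.integrable_add integrable_mult_right)
  qed
  then show "integrable gauss (\<lambda>x::'a. \<Prod>b\<in>Basis. (1 + \<bar>x \<bullet> b\<bar>) ^ 3)"
    by (intro integral_gauss_prod(1)) auto
  have s: "1 + (\<Sum>b\<in>S. f b) \<le> (\<Prod>b\<in>S. 1 + f b)" if "finite S" "\<And>b. 0 \<le> f b" for S and f :: "'a \<Rightarrow> real"
    using that(1)
  proof induction
    case (insert b S)
    have "(1 + f b) * (1 + (\<Sum>b\<in>S. f b)) \<le> (1 + f b) * (\<Prod>b\<in>S. 1 + f b)"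
      using insert that(2)[of b] by (intro mult_left_mono) auto
    moreover have "0 \<le> f b * (\<Sum>b\<in>S. f b)" using that(2) by (intro mult_nonneg_nonneg sum_nonneg) auto
    ultimately show ?case using insert by (simp add: algebra_simps)
  qed auto
  have "(1 + norm x) ^ 3 \<le> (\<Prod>b\<in>Basis. (1 + \<bar>x \<bullet> b\<bar>) ^ 3)" for x :: 'a
  proof -
    have "1 + norm x \<le> 1 + (\<Sum>b\<in>Basis. \<bar>x \<bullet> b\<bar>)" using norm_le_l1[of x] by simp
    also have "\<dots> \<le> (\<Prod>b\<in>Basis. 1 + \<bar>x \<bullet> b\<bar>)" by (rule s) auto
    finally have "(1 + norm x) ^ 3 \<le> (\<Prod>b\<in>Basis. 1 + \<bar>x \<bullet> b\<bar>) ^ 3" by (intro power_mono) auto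
    then show ?thesis by (simp add: prod_power_distrib)
  qed
  then show "AE x::'a in gauss. norm ((1 + norm x) ^ 3) \<le> norm (\<Prod>b\<in>Basis. (1 + \<bar>x \<bullet> b\<bar>) ^ 3)"
    by (intro AE_I2) (auto intro: order_trans abs_ge_self)
qed auto

lemma gauss_moment_le:
  assumes "f \<in> borel_measurable borel" "\<And>x. norm (f x) \<le> c * (1 + norm (x::'a::euclidean_space)) ^ 3"
  shows "integrable gauss (f :: 'a \<Rightarrow> 'b::{banach, second_countable_topology})"
  by (rule Bochner_Integration.integrable_bound[OF integrable_mult_right[OF integrable_gauss_moment]])
    (use assms in \<open>auto intro!: AE_I2 intro: order_trans abs_ge_self\<close>)

text \<open>Up to a power of 2 pi the standard Gaussian density is its own Fourier transform.
  Writing the density as an average of cosines is what later turns a Gaussian convolution into a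
  trigonometric mixture.\<close>

lemma integral_gauss_eq_fourier:
  obtains c :: real where "\<And>f :: 'a::euclidean_space \<Rightarrow> real. f \<in> borel_measurable borel \<Longrightarrow>
    (\<integral>w. f w \<partial>gauss) = (\<integral>w. f w * (c * (\<integral>k. cos (k \<bullet> w) \<partial>gauss)) \<partial>lborel)"
proof
  fix f :: "'a \<Rightarrow> real" assume f: "f \<in> borel_measurable borel"
  have "(\<Prod>b\<in>Basis. std_normal_density (w \<bullet> b)) = (\<Prod>b\<in>(Basis::'a set). 1 / sqrt (2 * pi)) * (\<integral>k. cos (k \<bullet> w) \<partial>gauss)" for w :: 'a
  proof -
    have "(\<Sum>b\<in>Basis. - (w \<bullet> b)\<^sup>2 / 2) = - (norm w)\<^sup>2 / 2"
      unfolding power2_norm_eq_inner by (subst (2) euclidean_inner) (simp add: sum_negf sum_divide_distrib power2_eq_square)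
    then have "(\<Prod>b\<in>Basis. exp (- (w \<bullet> b)\<^sup>2 / 2)) = exp (- (norm w)\<^sup>2 / 2)"
      by (metis exp_sum finite_Basis)
    moreover have "(\<integral>k. cos (k \<bullet> w) \<partial>gauss) = exp (- (norm w)\<^sup>2 / 2)"
      using gauss_cos[of w] by (simp add: inner_commute)
    ultimately show ?thesis by (simp only: std_normal_density_def prod.distrib)
  qed
  note dens = this
  have "(\<integral>w. f w \<partial>gauss) = (\<integral>w. (\<Prod>b\<in>Basis. std_normal_density (w \<bullet> b)) *\<^sub>R f w \<partial>lborel)"
    unfolding gauss_def by (rule integral_density) (use f in \<open>auto simp: prod_std_normal_nonneg\<close>)
  then show "(\<integral>w. f w \<partial>gauss) = (\<integral>w. f w * ((\<Prod>b\<in>(Basis::'a set). 1 / sqrt (2 * pi)) * (\<integral>k. cos (k \<bullet> w) \<partial>gauss)) \<partial>lborel)"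
    unfolding dens by (simp only: real_scaleR_def mult.commute[of "f _"])
qed


section \<open>The matrix exponential\<close>

definition mpow :: "real^'n^'n \<Rightarrow> nat \<Rightarrow> real^'n^'n" where
  "mpow A k = ((**) A ^^ k) (mat 1)"

lemma mpow_0: "mpow A 0 = mat 1" and mpow_Suc: "mpow A (Suc k) = A ** mpow A k"
  by (simp_all add: mpow_def)

lemma mpow_commute: "A ** mpow A k = mpow A k ** A"
  by (induction k) (simp_all add: mpow_0 mpow_Suc matrix_mul_assoc)

lemma scaleR_matrix_mult_left: "(t *\<^sub>R A) ** B = t *\<^sub>R ((A::real^'n^'m) ** (B::real^'k^'n))"
  by (simp add: vec_eq_iff matrix_matrix_mult_def sum_distrib_left mult.assoc)

lemma scaleR_matrix_mult_right: "A ** (t *\<^sub>R B) = t *\<^sub>R ((A::real^'n^'m) ** (B::real^'k^'n))"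
  by (simp add: vec_eq_iff matrix_matrix_mult_def sum_distrib_left mult_ac)

lemma mpow_scaleR: "mpow (t *\<^sub>R A) k = t ^ k *\<^sub>R mpow A k"
  by (induction k) (simp_all add: mpow_0 mpow_Suc scaleR_matrix_mult_left scaleR_matrix_mult_right)

lemma mpow_entry_bound:
  fixes A :: "real^'n^'n"
  shows "\<bar>mpow A k $ i $ j\<bar> \<le> (real CARD('n) * norm A) ^ k"
proof (induction k arbitrary: i)
  case (Suc k)
  have e: "\<bar>A $ i $ l\<bar> \<le> norm A" for l
    using component_le_norm_cart[of "A $ i" l] Finite_Cartesian_Product.norm_nth_le[of A i] by linarith
  have "\<bar>mpow A (Suc k) $ i $ j\<bar> \<le> (\<Sum>l\<in>UNIV. \<bar>A $ i $ l * mpow A k $ l $ j\<bar>)"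
    by (simp add: mpow_Suc matrix_matrix_mult_def sum_abs)
  also have "\<dots> \<le> (\<Sum>l\<in>(UNIV::'n set). norm A * (real CARD('n) * norm A) ^ k)"
    unfolding abs_mult using e Suc by (intro sum_mono mult_mono) auto
  finally show ?case by (simp add: mult_ac)
qed (auto simp: mpow_0 mat_def)

text \<open>Coefficients of each entry of \<open>mexp (t *\<^sub>R A)\<close> as a scalar power
  series in \<open>t\<close>, so that summation and termwise differentiation happen entry by
  entry.\<close>

definition mexp_coeff :: "real^'n^'n \<Rightarrow> 'n \<Rightarrow> 'n \<Rightarrow> nat \<Rightarrow> real" where
  "mexp_coeff A i j k = mpow A k $ i $ j / fact k"

lemma mexp_coeff_summable:
  fixes A :: "real^'n^'n"
  shows "summable (\<lambda>k. mexp_coeff A i j k * t ^ k)"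
proof (rule summable_comparison_test)
  let ?r = "real CARD('n) * norm A * \<bar>t\<bar>"
  have "norm (mexp_coeff A i j k * t ^ k) \<le> inverse (fact k) * ?r ^ k" for k
    using mult_right_mono[OF mpow_entry_bound[of A k i j], of "\<bar>t\<bar> ^ k"]
    by (simp add: mexp_coeff_def abs_mult power_abs power_mult_distrib field_simps divide_right_mono)
  then show "\<exists>N. \<forall>n\<ge>N. norm (mexp_coeff A i j n * t ^ n) \<le> inverse (fact n) * ?r ^ n" by blast
  show "summable (\<lambda>k. inverse (fact k) * ?r ^ k)" by (rule summable_exp)
qed

lemma mexp_entry: "mexp (t *\<^sub>R A) $ i $ j = (\<Sum>k. mexp_coeff A i j k * t ^ k)"
proof -
  let ?S = "\<chi> i j. \<Sum>k. mexp_coeff A i j k * t ^ k"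
  have "(\<lambda>k. mpow (t *\<^sub>R A) k /\<^sub>R fact k) sums ?S"
    unfolding sums_def
  proof (intro vec_tendstoI)
    fix i j
    have "(\<lambda>n. \<Sum>k<n. mexp_coeff A i j k * t ^ k) \<longlonglongrightarrow> ?S $ i $ j"
      using summable_LIMSEQ[OF mexp_coeff_summable] by simp
    then show "(\<lambda>n. (\<Sum>k<n. mpow (t *\<^sub>R A) k /\<^sub>R fact k) $ i $ j) \<longlonglongrightarrow> ?S $ i $ j"
      by (simp add: mpow_scaleR mexp_coeff_def field_simps)
  qed
  then have "mexp (t *\<^sub>R A) = ?S"
    by (simp add: mexp_def mpow_def sums_iff)
  then show ?thesis by simp
qed

text \<open>The two power series agree coefficient by coefficient, since every power of
  \<open>A\<close> commutes with \<open>A\<close>.\<close>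

lemma mexp_commute: "A ** mexp (t *\<^sub>R A) = mexp (t *\<^sub>R A) ** A"
proof -
  have "(\<Sum>l\<in>UNIV. A $ i $ l * mexp (t *\<^sub>R A) $ l $ j) = (\<Sum>l\<in>UNIV. mexp (t *\<^sub>R A) $ i $ l * A $ l $ j)" for i j
  proof -
    have "(\<Sum>l\<in>UNIV. A $ i $ l * mexp (t *\<^sub>R A) $ l $ j) = (\<Sum>k. \<Sum>l\<in>UNIV. A $ i $ l * (mexp_coeff A l j k * t ^ k))"
      unfolding mexp_entry using mexp_coeff_summable
      by (subst suminf_sum) (auto simp: suminf_mult intro: summable_mult)
    also have "\<dots> = (\<Sum>k. \<Sum>l\<in>UNIV. (mexp_coeff A i l k * t ^ k) * A $ l $ j)"
    proof (rule suminf_cong)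
      fix k
      have "(\<Sum>l\<in>UNIV. A $ i $ l * mpow A k $ l $ j) = (\<Sum>l\<in>UNIV. mpow A k $ i $ l * A $ l $ j)"
        using mpow_commute[of A k] by (simp add: matrix_matrix_mult_def vec_eq_iff)
      then have "(\<Sum>l\<in>UNIV. A $ i $ l * mpow A k $ l $ j) * (t ^ k / fact k) = (\<Sum>l\<in>UNIV. mpow A k $ i $ l * A $ l $ j) * (t ^ k / fact k)"
        by simp
      then show "(\<Sum>l\<in>UNIV. A $ i $ l * (mexp_coeff A l j k * t ^ k)) = (\<Sum>l\<in>UNIV. (mexp_coeff A i l k * t ^ k) * A $ l $ j)"
        unfolding sum_distrib_right by (simp add: mexp_coeff_def field_simps)
    qed
    also have "\<dots> = (\<Sum>l\<in>UNIV. mexp (t *\<^sub>R A) $ i $ l * A $ l $ j)"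
      unfolding mexp_entry using mexp_coeff_summable
      by (subst suminf_sum) (auto simp: suminf_mult2 intro!: summable_mult2)
    finally show ?thesis .
  qed
  then show ?thesis by (simp add: matrix_matrix_mult_def vec_eq_iff)
qed

lemma DERIV_mexp_entry:
  "((\<lambda>t. mexp (t *\<^sub>R A) $ i $ j) has_real_derivative (A ** mexp (t *\<^sub>R A)) $ i $ j) (at t)"
proof -
  have "((\<lambda>t. \<Sum>k. mexp_coeff A i j k * t ^ k) has_real_derivative (\<Sum>k. diffs (mexp_coeff A i j) k * t ^ k)) (at t)"
    by (rule termdiffs_strong_converges_everywhere) (rule mexp_coeff_summable)
  moreover have "(\<Sum>k. diffs (mexp_coeff A i j) k * t ^ k) = (A ** mexp (t *\<^sub>R A)) $ i $ j"
  proof -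
    have "diffs (mexp_coeff A i j) k = (\<Sum>l\<in>UNIV. A $ i $ l * mexp_coeff A l j k)" for k
      by (simp add: diffs_def mexp_coeff_def mpow_Suc matrix_matrix_mult_def sum_divide_distrib
          del: of_nat_Suc) (simp add: sum_distrib_left)
    then have "(\<Sum>k. diffs (mexp_coeff A i j) k * t ^ k) = (\<Sum>k. \<Sum>l\<in>UNIV. A $ i $ l * (mexp_coeff A l j k * t ^ k))"
      by (simp add: sum_distrib_right mult.assoc)
    also have "\<dots> = (\<Sum>l\<in>UNIV. A $ i $ l * (\<Sum>k. mexp_coeff A l j k * t ^ k))"
      using mexp_coeff_summable by (subst suminf_sum) (auto simp: suminf_mult intro: summable_mult)
    finally show ?thesis by (simp add: matrix_matrix_mult_def mexp_entry)
  qed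
  ultimately show ?thesis by (simp add: mexp_entry)
qed

lemma mexp_0: "mexp (0 :: real^'n^'n) = mat 1"
proof -
  have "mexp (0 *\<^sub>R (0::real^'n^'n)) $ i $ j = mat 1 $ i $ j" for i j
    unfolding mexp_entry by (subst powser_zero) (simp add: mexp_coeff_def mpow_0)
  then show ?thesis by (simp add: vec_eq_iff)
qed

text \<open>For fixed \<open>c = s + t\<close>, the product
  \<open>mexp (r *\<^sub>R A) ** mexp ((c - r) *\<^sub>R A)\<close> has derivative 0 in
  \<open>r\<close>, because \<open>A\<close> commutes with its exponential. The values at
  \<open>r = s\<close> and \<open>r = 0\<close> are the two sides.\<close>

lemma mexp_add: "mexp ((s + t) *\<^sub>R A) = mexp (s *\<^sub>R A) ** mexp (t *\<^sub>R A)"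
proof -
  define c where "c = s + t"
  have "(mexp (s *\<^sub>R A) ** mexp ((c - s) *\<^sub>R A)) $ i $ j = (mexp (0 *\<^sub>R A) ** mexp ((c - 0) *\<^sub>R A)) $ i $ j" for i j
  proof (rule DERIV_isconst_all[where f = "\<lambda>s. (mexp (s *\<^sub>R A) ** mexp ((c - s) *\<^sub>R A)) $ i $ j" and x = s and y = 0])
    show "\<forall>s. ((\<lambda>s. (mexp (s *\<^sub>R A) ** mexp ((c - s) *\<^sub>R A)) $ i $ j) has_real_derivative 0) (at s)"
    proof
      fix s
      have d2: "((\<lambda>s. mexp ((c - s) *\<^sub>R A) $ l $ j) has_real_derivative - (A ** mexp ((c - s) *\<^sub>R A)) $ l $ j) (at s)" for l
      proof -
        have "((\<lambda>s. c - s) has_real_derivative - 1) (at s)" by (auto intro!: derivative_eq_intros)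
        from DERIV_chain2[where f = "\<lambda>t. mexp (t *\<^sub>R A) $ l $ j", OF DERIV_mexp_entry this] show ?thesis by simp
      qed
      have "((\<lambda>s. \<Sum>l\<in>UNIV. mexp (s *\<^sub>R A) $ i $ l * mexp ((c - s) *\<^sub>R A) $ l $ j) has_real_derivative
          (\<Sum>l\<in>UNIV. (A ** mexp (s *\<^sub>R A)) $ i $ l * mexp ((c - s) *\<^sub>R A) $ l $ j
             + - (A ** mexp ((c - s) *\<^sub>R A)) $ l $ j * mexp (s *\<^sub>R A) $ i $ l)) (at s)"
        by (intro DERIV_sum DERIV_mult DERIV_mexp_entry d2)
      moreover have "(\<Sum>l\<in>UNIV. (A ** mexp (s *\<^sub>R A)) $ i $ l * mexp ((c - s) *\<^sub>R A) $ l $ j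
             + - (A ** mexp ((c - s) *\<^sub>R A)) $ l $ j * mexp (s *\<^sub>R A) $ i $ l)
          = ((A ** mexp (s *\<^sub>R A)) ** mexp ((c - s) *\<^sub>R A)) $ i $ j - (mexp (s *\<^sub>R A) ** (A ** mexp ((c - s) *\<^sub>R A))) $ i $ j"
        unfolding matrix_matrix_mult_def[of "A ** mexp (s *\<^sub>R A)"] matrix_matrix_mult_def[of "mexp (s *\<^sub>R A)"]
        by (simp add: sum_subtractf mult.commute)
      moreover have "\<dots> = 0"
        by (simp add: mexp_commute[of A s] matrix_mul_assoc)
      ultimately show "((\<lambda>s. (mexp (s *\<^sub>R A) ** mexp ((c - s) *\<^sub>R A)) $ i $ j) has_real_derivative 0) (at s)"
        unfolding matrix_matrix_mult_def[of "mexp (_ *\<^sub>R A)"] by simp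
    qed
  qed
  then have "mexp (s *\<^sub>R A) ** mexp ((c - s) *\<^sub>R A) = mexp (c *\<^sub>R A)"
    by (simp add: vec_eq_iff[where 'a = "real^'a"] vec_eq_iff[where 'a = real] mexp_0)
  then show ?thesis by (simp add: c_def)
qed

lemma mexp_minus_left: "mexp (- (t *\<^sub>R A)) ** mexp (t *\<^sub>R A) = mat 1"
  using mexp_add[of "-t" t A] by (simp add: mexp_0)

lemma continuous_mexp: "isCont (\<lambda>t. mexp (t *\<^sub>R A)) t"
  unfolding isCont_def
  by (intro vec_tendstoI) (metis DERIV_isCont DERIV_mexp_entry isCont_def)

lemma mexp_vector_derivative:
  fixes A :: "real^'n^'n"
  shows "((\<lambda>t. mexp (t *\<^sub>R A) *v x) has_vector_derivative A *v (mexp (t *\<^sub>R A) *v x)) (at t)"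
  unfolding has_vector_derivative_def
proof (subst has_derivative_componentwise_within, intro ballI)
  fix b :: "real^'n" assume "b \<in> Basis"
  then obtain i where b: "b = axis i 1" by (auto simp: Basis_vec_def)
  have "((\<lambda>t. \<Sum>j\<in>UNIV. mexp (t *\<^sub>R A) $ i $ j * x $ j) has_real_derivative (\<Sum>j\<in>UNIV. (A ** mexp (t *\<^sub>R A)) $ i $ j * x $ j)) (at t)"
    by (intro DERIV_sum DERIV_cmult_right DERIV_mexp_entry)
  then have "((\<lambda>t. (mexp (t *\<^sub>R A) *v x) $ i) has_real_derivative ((A ** mexp (t *\<^sub>R A)) *v x) $ i) (at t)"
    by (simp add: matrix_vector_mult_def)
  then show "((\<lambda>t. (mexp (t *\<^sub>R A) *v x) \<bullet> b) has_derivative (\<lambda>s. s *\<^sub>R (A *v (mexp (t *\<^sub>R A) *v x)) \<bullet> b)) (at t)"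
    unfolding b by (simp add: inner_axis has_field_derivative_def matrix_vector_mul_assoc mult_commute_abs)
qed


section \<open>Characteristic functions and the Levy exponent\<close>

definition char_fun :: "'w measure \<Rightarrow> ('w \<Rightarrow> real^'n) \<Rightarrow> real^'n \<Rightarrow> complex" where
  "char_fun M Y u = (\<integral>\<omega>. cis (u \<bullet> Y \<omega>) \<partial>M)"

lemma (in prob_space) integral_cos_char_fun:
  assumes [measurable]: "Y \<in> borel_measurable M"
  shows "(\<integral>\<omega>. cos (\<theta> + u \<bullet> Y \<omega>) \<partial>M) = Re (cis \<theta> * char_fun M Y u)"
    and "(\<integral>\<omega>. sin (\<theta> + u \<bullet> Y \<omega>) \<partial>M) = Im (cis \<theta> * char_fun M Y u)"
proof -
  have i: "integrable M (\<lambda>\<omega>. cis \<theta> * cis (u \<bullet> Y \<omega>))"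
    by (rule integrable_const_bound[of _ 1]) (auto simp: norm_mult)
  have e: "cis \<theta> * char_fun M Y u = (\<integral>\<omega>. cis \<theta> * cis (u \<bullet> Y \<omega>) \<partial>M)"
    by (simp add: char_fun_def)
  show "(\<integral>\<omega>. cos (\<theta> + u \<bullet> Y \<omega>) \<partial>M) = Re (cis \<theta> * char_fun M Y u)"
    unfolding e integral_Re[OF i, symmetric] by (simp add: cis_mult)
  show "(\<integral>\<omega>. sin (\<theta> + u \<bullet> Y \<omega>) \<partial>M) = Im (cis \<theta> * char_fun M Y u)"
    unfolding e integral_Im[OF i, symmetric] by (simp add: cis_mult)
qed

lemma (in prob_space) norm_char_fun_le: "cmod (char_fun M Y u) \<le> 1"
  unfolding char_fun_def by (rule norm_integral_le_const) simp

text \<open>From \<open>1 + s / 2 \<le> exp (s / 2)\<close> one gets the lower bound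
  \<open>s / (2 + s)\<close> for \<open>1 - exp (- s / 2)\<close>. At \<open>s = 1\<close> this
  equals 1/3, whence the constant 3.\<close>

lemma min_le_one_minus_exp: "min 1 s \<le> 3 * (1 - exp (- s / 2))" if "0 \<le> (s::real)"
proof -
  have "(1 + s / 2) * exp (- s / 2) \<le> exp (s / 2) * exp (- s / 2)"
    by (intro mult_right_mono exp_ge_add_one_self) auto
  then have "exp (- s / 2) \<le> 1 / (1 + s / 2)"
    using that by (simp add: exp_add[symmetric] field_simps)
  then have "3 * (1 - exp (- s / 2)) \<ge> 3 * (1 - 1 / (1 + s / 2))" by simp
  moreover have "3 * (1 - 1 / (1 + s / 2)) = 3 * s / (2 + s)"
    using that by (simp add: field_simps)
  moreover have "min 1 s \<le> 3 * s / (2 + s)"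
  proof (cases "s \<le> 1")
    case True
    then have "s * (2 + s) \<le> 3 * s" using that by (simp add: mult_left_le algebra_simps)
    then show ?thesis using that True by (simp add: pos_le_divide_eq)
  qed (use that in \<open>simp add: pos_le_divide_eq\<close>)
  ultimately show ?thesis by linarith
qed

text \<open>Averaging \<open>1 - cos (k \<bullet> y)\<close> over a Gaussian \<open>k\<close> gives
  \<open>1 - exp (- (norm y)\<^sup>2 / 2)\<close>, which controls the truncated square. Fubini then
  exchanges the average with the expectation, leaving the Gaussian mean of
  \<open>1 - Re (char_fun M Y k)\<close>.\<close>

lemma (in prob_space) truncated_moment_le_char_fun:
  fixes Y :: "'a \<Rightarrow> real^'n"
  assumes [measurable]: "Y \<in> borel_measurable M"
    and c: "\<And>u. cmod (char_fun M Y u - 1) \<le> c * (1 + norm u)\<^sup>2"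
  shows "(\<integral>\<omega>. min 1 ((norm (Y \<omega>))\<^sup>2) \<partial>M) \<le> 3 * (\<integral>k. (1 + norm k) ^ 3 \<partial>(gauss :: (real^'n) measure)) * c"
proof -
  interpret G: prob_space "gauss :: (real^'n) measure" by (rule prob_space_gauss)
  interpret P: pair_prob_space M "gauss :: (real^'n) measure" by standard
  have c0: "c \<ge> 0" using order_trans[OF norm_ge_zero c[of 0]] by simp
  have ii: "integrable (M \<Otimes>\<^sub>M gauss) (\<lambda>(\<omega>, k). 1 - cos (k \<bullet> Y \<omega>))"
  proof (rule P.integrable_const_bound[of _ 2])
    have "\<bar>1 - cos r\<bar> \<le> 2" for r :: real
      using cos_ge_minus_one[of r] cos_le_one[of r] by linarith
    then show "AE z in M \<Otimes>\<^sub>M gauss. norm (case z of (\<omega>, k) \<Rightarrow> 1 - cos (k \<bullet> Y \<omega>)) \<le> 2"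
      by (simp add: split_beta)
  qed measurable
  have "(\<integral>\<omega>. min 1 ((norm (Y \<omega>))\<^sup>2) \<partial>M) \<le> (\<integral>\<omega>. 3 * (1 - exp (- (norm (Y \<omega>))\<^sup>2 / 2)) \<partial>M)"
    by (intro integral_mono min_le_one_minus_exp integrable_const_bound[of _ 1] integrable_const_bound[of _ 3] AE_I2) auto
  also have "\<dots> = 3 * (\<integral>\<omega>. (\<integral>k. 1 - cos (k \<bullet> Y \<omega>) \<partial>gauss) \<partial>M)"
  proof -
    have "(\<integral>k. 1 - cos (k \<bullet> y) \<partial>gauss) = 1 - exp (- (norm y)\<^sup>2 / 2)" for y :: "real^'n"
    proof -
      have "integrable gauss (\<lambda>k. cos (k \<bullet> y))"
        by (rule integrable_gauss_bounded[of _ 1]) auto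
      then have "(\<integral>k. 1 - cos (k \<bullet> y) \<partial>gauss) = 1 - (\<integral>k. cos (k \<bullet> y) \<partial>gauss)"
        by (simp add: G.prob_space[unfolded space_gauss])
      then show ?thesis using gauss_cos[of y] by (simp add: inner_commute)
    qed
    then show ?thesis by (simp only: integral_mult_right_zero)
  qed
  also have "(\<integral>\<omega>. (\<integral>k. 1 - cos (k \<bullet> Y \<omega>) \<partial>gauss) \<partial>M) = (\<integral>k. (\<integral>\<omega>. 1 - cos (k \<bullet> Y \<omega>) \<partial>M) \<partial>gauss)"
    by (rule P.Fubini_integral[symmetric]) (rule ii)
  also have "\<dots> = (\<integral>k. 1 - Re (char_fun M Y k) \<partial>gauss)"
  proof -
    have "(\<integral>\<omega>. 1 - cos (k \<bullet> Y \<omega>) \<partial>M) = 1 - Re (char_fun M Y k)" for k :: "real^'n"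
    proof -
      have "integrable M (\<lambda>\<omega>. cos (k \<bullet> Y \<omega>))" by (rule integrable_const_bound[of _ 1]) auto
      then show ?thesis using integral_cos_char_fun(1)[of Y 0 k] by (simp add: prob_space)
    qed
    then show ?thesis by simp
  qed
  also have "\<dots> \<le> (\<integral>k. c * (1 + norm k) ^ 3 \<partial>(gauss :: (real^'n) measure))"
  proof (rule integral_mono_AE')
    show "integrable gauss (\<lambda>k::real^'n. c * (1 + norm k) ^ 3)" by (intro integrable_mult_right integrable_gauss_moment)
    show "AE k in gauss. 1 - Re (char_fun M Y k) \<le> c * (1 + norm k) ^ 3"
    proof (rule AE_I2)
      fix k :: "real^'n"
      have "1 - Re (char_fun M Y k) \<le> cmod (char_fun M Y k - 1)"
        using abs_Re_le_cmod[of "char_fun M Y k - 1"] by simp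
      also have "\<dots> \<le> c * (1 + norm k)\<^sup>2" by (rule c)
      \<comment> \<open>The square is raised to a cube so that the Gaussian moment already shown
        finite can be reused.\<close>
      also have "\<dots> \<le> c * (1 + norm k) ^ 3" using c0 by (intro mult_left_mono power_increasing) auto
      finally show "1 - Re (char_fun M Y k) \<le> c * (1 + norm k) ^ 3" .
    qed
    show "AE k::real^'n in gauss. 0 \<le> c * (1 + norm k) ^ 3" using c0 by simp
  qed
  finally show ?thesis by (simp add: mult_ac)
qed

text \<open>Here \<open>C0\<close> is a real constant, not the function space. It depends on the
  dimension alone, so one constant serves every \<open>Y t\<close>; the dependence on
  \<open>t\<close> enters only through \<open>c\<close>.\<close>

lemma shift_mean_le_char_fun:
  obtains C0 :: real where "C0 > 0"
    "\<And>(M :: 'w measure) (Y :: 'w \<Rightarrow> real^'n) c K f g h x. prob_space M \<Longrightarrow> Y \<in> borel_measurable M \<Longrightarrow>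
       (\<And>u. cmod (char_fun M Y u - 1) \<le> c * (1 + norm u)\<^sup>2) \<Longrightarrow> C2_bounded K f g h \<Longrightarrow>
       \<bar>(\<integral>\<omega>. f (x + Y \<omega>) \<partial>M) - f x\<bar> \<le> C0 * K * c"
proof
  let ?G = "\<integral>k. (1 + norm k) ^ 3 \<partial>(gauss :: (real^'n) measure)"
  let ?d = "real DIM(real^'n)"
  have G: "?G \<ge> 0" by simp
  show "(2 + 2 * ?d) * (3 * ?G + 4) > 0" using G by (intro mult_pos_pos) (auto simp: add_nonneg_pos)
  fix M :: "'w measure" and Y :: "'w \<Rightarrow> real^'n" and c K f x and g :: "real^'n \<Rightarrow> real^'n" and h
  assume M: "prob_space M" and Y: "Y \<in> borel_measurable M"
    and c: "\<And>u. cmod (char_fun M Y u - 1) \<le> c * (1 + norm u)\<^sup>2" and B: "C2_bounded K f g h"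
  interpret prob_space M by (rule M)
  have c0: "c \<ge> 0" using order_trans[OF norm_ge_zero c[of 0]] by simp
  have "\<bar>(\<integral>\<omega>. f (x + Y \<omega>) \<partial>M) - f x\<bar> \<le> (2 + 2 * ?d) * K * ((3 * ?G + 4) * c)"
  proof (rule shift_mean_bound[OF B Y])
    show "(\<integral>\<omega>. min 1 ((norm (Y \<omega>))\<^sup>2) \<partial>M) \<le> (3 * ?G + 4) * c"
      using truncated_moment_le_char_fun[OF Y c] c0 by (simp add: distrib_right)
    fix b :: "real^'n" assume b: "b \<in> Basis"
    have "(\<integral>\<omega>. sin (Y \<omega> \<bullet> b) \<partial>M) = Im (char_fun M Y b - 1)"
      using integral_cos_char_fun(2)[OF Y, of 0 b] by (simp add: inner_commute)
    also have "\<bar>\<dots>\<bar> \<le> c * (1 + norm b)\<^sup>2" by (rule order_trans[OF abs_Im_le_cmod c])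
    \<comment> \<open>Basis vectors have norm 1; this 4 is the one in the constant.\<close>
    also have "\<dots> = 4 * c" using b by simp
    also have "\<dots> \<le> (3 * ?G + 4) * c" using c0 G by (intro mult_right_mono) auto
    finally show "\<bar>\<integral>\<omega>. sin (Y \<omega> \<bullet> b) \<partial>M\<bar> \<le> (3 * ?G + 4) * c" .
  qed
  then show "\<bar>(\<integral>\<omega>. f (x + Y \<omega>) \<partial>M) - f x\<bar> \<le> (2 + 2 * ?d) * (3 * ?G + 4) * K * c"
    by (simp add: mult_ac)
qed

definition levy_kernel :: "real^'n \<Rightarrow> real^'n \<Rightarrow> complex" where
  "levy_kernel u y = cis (u \<bullet> y) - 1 - \<i> * of_real (if norm y \<le> 1 then u \<bullet> y else 0)"

lemma levy_exponent_eq: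
  "levy_exponent Q a \<nu> u = of_real (1/2 * ((Q *v u) \<bullet> u)) - \<i> * of_real (a \<bullet> u) - (\<integral>y. levy_kernel u y \<partial>\<nu>)"
  by (simp add: levy_exponent_def levy_kernel_def cis_conv_exp)

lemma cis_second_order: "cmod (cis r - 1 - \<i> * of_real r) \<le> r\<^sup>2"
proof -
  have "cmod (iexp r - (\<Sum>k\<le>1. (\<i> * r) ^ k / fact k)) \<le> \<bar>r\<bar> ^ Suc 1 / fact (Suc 1)"
    by (rule iexp_approx1)
  then have "cmod (cis r - 1 - \<i> * of_real r) \<le> r\<^sup>2 / 2"
    by (simp add: cis_conv_exp numeral_2_eq_2 diff_diff_eq)
  then show ?thesis using zero_le_power2[of r] by linarith
qed

text \<open>Second-order expansion of \<open>cis\<close> for small jumps, modulus at most 2 for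
  large ones. The growth is quadratic in \<open>u\<close>, below the cubic weight of
  \<open>trig_mixture\<close>.\<close>

lemma levy_kernel_bound: "cmod (levy_kernel u y) \<le> 2 * (1 + norm u)\<^sup>2 * min 1 ((norm y)\<^sup>2)"
proof (cases "norm y \<le> 1")
  case True
  then have m: "min 1 ((norm y)\<^sup>2) = (norm y)\<^sup>2" by (simp add: power_le_one)
  have "cmod (levy_kernel u y) \<le> \<bar>u \<bullet> y\<bar>\<^sup>2"
    using True cis_second_order[of "u \<bullet> y"] by (simp add: levy_kernel_def)
  also have "\<dots> \<le> (norm u * norm y)\<^sup>2" by (intro power_mono Cauchy_Schwarz_ineq2) auto
  also have "\<dots> = (norm u)\<^sup>2 * (norm y)\<^sup>2" by (simp add: power_mult_distrib)
  also have "\<dots> \<le> (2 * (1 + norm u)\<^sup>2) * (norm y)\<^sup>2"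
  proof (rule mult_right_mono)
    have "(norm u)\<^sup>2 \<le> (1 + norm u)\<^sup>2" by (intro power_mono) auto
    then show "(norm u)\<^sup>2 \<le> 2 * (1 + norm u)\<^sup>2" using zero_le_power2[of "1 + norm u"] by linarith
  qed auto
  finally show ?thesis by (simp add: m)
next
  case False
  then have m: "min 1 ((norm y)\<^sup>2) = 1" by (simp add: min_def)
  have "cmod (levy_kernel u y) \<le> 2"
    using False norm_triangle_ineq4[of "cis (u \<bullet> y)" 1] by (simp add: levy_kernel_def)
  also have "\<dots> \<le> 2 * (1 + norm u)\<^sup>2" by (simp add: one_le_power)
  finally show ?thesis by (simp add: m)
qed

lemma levy_kernel_integrable:
  fixes \<nu> :: "(real^'n) measure"
  assumes "levy_measure \<nu>" shows "integrable \<nu> (levy_kernel u)"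
proof (rule Bochner_Integration.integrable_bound)
  show "integrable \<nu> (\<lambda>y. 2 * (1 + norm u)\<^sup>2 * min 1 ((norm y)\<^sup>2))"
    using levy_measure_integrable[OF assms] by simp
  have s: "sets \<nu> = sets borel" using assms by (simp add: levy_measure_def)
  show "levy_kernel u \<in> borel_measurable \<nu>"
    unfolding measurable_cong_sets[OF s refl] levy_kernel_def[abs_def] by measurable
qed (auto intro!: AE_I2 order_trans[OF levy_kernel_bound] abs_ge_self)

lemma levy_exponent_bound:
  fixes Q :: "real^'n^'n"
  assumes \<nu>: "levy_measure \<nu>"
  obtains C where "C > 0" "\<And>u. cmod (levy_exponent Q a \<nu> u) \<le> C * (1 + norm u)\<^sup>2"
proof -
  let ?I = "\<integral>y. min 1 ((norm y)\<^sup>2) \<partial>\<nu>"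
  show thesis
  proof (rule that)
    show "norm Q + norm a + 2 * ?I + 1 > 0"
      using integral_nonneg_AE[where M = \<nu> and f = "\<lambda>y. min 1 ((norm y)\<^sup>2)"] by (simp add: add_nonneg_pos)
    fix u :: "real^'n"
    let ?w = "(1 + norm u)\<^sup>2"
    have w: "1 \<le> ?w" "norm u \<le> ?w" "(norm u)\<^sup>2 \<le> ?w"
      by (auto simp: power2_eq_square algebra_simps)
    have "\<bar>1/2 * ((Q *v u) \<bullet> u)\<bar> \<le> norm (Q *v u) * norm u"
      using Cauchy_Schwarz_ineq2[of "Q *v u" u] by simp
    also have "\<dots> \<le> (norm Q * norm u) * norm u"
      by (intro mult_right_mono norm_matrix_vector_le) auto
    also have "\<dots> \<le> norm Q * ?w"
      using mult_left_mono[OF w(3), of "norm Q"] by (simp add: power2_eq_square mult.assoc)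
    finally have 1: "cmod (of_real (1/2 * ((Q *v u) \<bullet> u))) \<le> norm Q * ?w" by (simp only: norm_of_real)
    have "\<bar>a \<bullet> u\<bar> \<le> norm a * norm u" by (rule Cauchy_Schwarz_ineq2)
    also have "\<dots> \<le> norm a * ?w" using w by (intro mult_left_mono) auto
    finally have 2: "cmod (\<i> * of_real (a \<bullet> u)) \<le> norm a * ?w" by (simp add: norm_mult)
    have "cmod (\<integral>y. levy_kernel u y \<partial>\<nu>) \<le> (\<integral>y. 2 * ?w * min 1 ((norm y)\<^sup>2) \<partial>\<nu>)"
      using levy_measure_integrable[OF \<nu>] levy_kernel_integrable[OF \<nu>] levy_kernel_bound
      by (intro norm_integral_le) auto
    also have "\<dots> = 2 * ?I * ?w" by simp
    finally have 3: "cmod (\<integral>y. levy_kernel u y \<partial>\<nu>) \<le> 2 * ?I * ?w" .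
    have "cmod (levy_exponent Q a \<nu> u) \<le> norm Q * ?w + norm a * ?w + 2 * ?I * ?w"
      unfolding levy_exponent_eq
      by (intro order_trans[OF norm_triangle_ineq4] add_mono 1 2 3)
    also have "\<dots> \<le> (norm Q + norm a + 2 * ?I + 1) * ?w"
      using w(1) by (simp add: algebra_simps)
    finally show "cmod (levy_exponent Q a \<nu> u) \<le> (norm Q + norm a + 2 * ?I + 1) * ?w" .
  qed
qed

text \<open>Dominated convergence along a convergent sequence: the sequence is bounded, so
  \<open>levy_kernel_bound\<close> gives one integrable majorant.\<close>

lemma levy_exponent_continuous:
  fixes Q :: "real^'n^'n"
  assumes \<nu>: "levy_measure \<nu>"
  shows "continuous_on UNIV (levy_exponent Q a \<nu>)"
proof -
  have "continuous_on UNIV (\<lambda>u. \<integral>y. levy_kernel u y \<partial>\<nu>)"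
    unfolding continuous_on_sequentially comp_def
  proof (intro ballI allI impI, elim conjE)
    fix X :: "nat \<Rightarrow> real^'n" and u assume X: "X \<longlonglongrightarrow> u"
    have "bounded (range X)" by (rule convergent_imp_bounded[OF X])
    then obtain B where B: "\<And>n. norm (X n) \<le> B" by (auto simp: bounded_iff)
    show "(\<lambda>n. \<integral>y. levy_kernel (X n) y \<partial>\<nu>) \<longlonglongrightarrow> (\<integral>y. levy_kernel u y \<partial>\<nu>)"
    proof (rule integral_dominated_convergence[where w = "\<lambda>y. 2 * (1 + B)\<^sup>2 * min 1 ((norm y)\<^sup>2)"])
      show "AE y in \<nu>. (\<lambda>n. levy_kernel (X n) y) \<longlonglongrightarrow> levy_kernel u y"
        unfolding levy_kernel_def cis_conv_exp using X
        by (intro AE_I2 tendsto_intros) (auto intro!: tendsto_intros)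
      fix n
      have "2 * (1 + norm (X n))\<^sup>2 * min 1 ((norm y)\<^sup>2) \<le> 2 * (1 + B)\<^sup>2 * min 1 ((norm y)\<^sup>2)" for y :: "real^'n"
        using B[of n] by (intro mult_right_mono mult_left_mono power_mono) auto
      then show "AE y in \<nu>. cmod (levy_kernel (X n) y) \<le> 2 * (1 + B)\<^sup>2 * min 1 ((norm y)\<^sup>2)"
        using order_trans[OF levy_kernel_bound] by blast
    qed (use levy_measure_integrable[OF \<nu>] borel_measurable_integrable[OF levy_kernel_integrable[OF \<nu>]] in auto)
  qed
  moreover have "continuous_on UNIV (\<lambda>u. Q *v u)" by (rule linear_continuous_on) simp
  ultimately show ?thesis
    unfolding levy_exponent_eq[abs_def] by (intro continuous_intros)
qed


section \<open>Mixtures of trigonometric functions\<close>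

definition outer :: "real^'n \<Rightarrow> real^'n \<Rightarrow> real^'n^'n" where
  "outer u v = (\<chi> i j. u $ i * v $ j)"

lemma outer_mult_vec: "outer u v *v w = (v \<bullet> w) *\<^sub>R u"
  by (simp add: vec_eq_iff outer_def matrix_vector_mult_def inner_vec_def sum_distrib_left mult_ac)

lemma norm_outer: "norm (outer u v) = norm u * norm v"
proof -
  have "outer u v $ i = u $ i *\<^sub>R v" for i by (simp add: vec_eq_iff outer_def)
  then have "norm (outer u v) = L2_set (\<lambda>i. norm (u $ i) * norm v) UNIV"
    by (simp add: norm_vec_def[of "outer u v"])
  then show ?thesis by (simp add: L2_set_left_distrib[symmetric] norm_vec_def[of u])
qed

lemma trace_mult_outer: "trace (Q ** outer u u) = (Q *v u) \<bullet> u"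
  by (simp add: trace_def matrix_matrix_mult_def outer_def matrix_vector_mult_def inner_vec_def sum_distrib_left sum_distrib_right mult_ac)

lemma cis_add_expansion: "cmod (cis (s + r) - cis s - \<i> * of_real r * cis s) \<le> r\<^sup>2"
proof -
  have "cis (s + r) - cis s - \<i> * of_real r * cis s = cis s * (cis r - 1 - \<i> * of_real r)"
    by (simp add: cis_mult[symmetric] algebra_simps)
  then show ?thesis using cis_second_order[of r] by (simp add: norm_mult)
qed

lemma cos_add_expansion: "\<bar>cos (s + r) - cos s + r * sin s\<bar> \<le> (r::real)\<^sup>2"
  and sin_add_expansion: "\<bar>sin (s + r) - sin s - r * cos s\<bar> \<le> (r::real)\<^sup>2"
  using order_trans[OF abs_Re_le_cmod cis_add_expansion[of s r]]
        order_trans[OF abs_Im_le_cmod cis_add_expansion[of s r]] by auto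

text \<open>A superposition of waves with amplitude \<open>F\<close>, frequency \<open>H\<close> and
  phase \<open>\<Theta>\<close>. Phases keep everything real. The cube in the weight allows two
  derivatives plus one more power of the frequency for the remainder of the second.\<close>

locale trig_mixture = sigma_finite_measure \<kappa> for \<kappa> :: "'p measure" +
  fixes F :: "'p \<Rightarrow> real" and H :: "'p \<Rightarrow> real^'n" and \<Theta> :: "'p \<Rightarrow> real"
  assumes F_measurable[measurable]: "F \<in> borel_measurable \<kappa>"
    and H_measurable[measurable]: "H \<in> borel_measurable \<kappa>"
    and \<Theta>_measurable[measurable]: "\<Theta> \<in> borel_measurable \<kappa>"
    and integrable_weight: "integrable \<kappa> (\<lambda>p. \<bar>F p\<bar> * (1 + norm (H p)) ^ 3)"
begin

definition mix :: "real^'n \<Rightarrow> real" where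
  "mix x = (\<integral>p. F p * cos (\<Theta> p + H p \<bullet> x) \<partial>\<kappa>)"

definition mix_grad :: "real^'n \<Rightarrow> real^'n" where
  "mix_grad x = (\<integral>p. (- (F p * sin (\<Theta> p + H p \<bullet> x))) *\<^sub>R H p \<partial>\<kappa>)"

definition mix_hess :: "real^'n \<Rightarrow> real^'n^'n" where
  "mix_hess x = (\<integral>p. (- (F p * cos (\<Theta> p + H p \<bullet> x))) *\<^sub>R outer (H p) (H p) \<partial>\<kappa>)"

lemma outer_H_measurable[measurable]: "(\<lambda>p. outer (H p) (H p)) \<in> borel_measurable \<kappa>"
proof -
  have "continuous_on UNIV (\<lambda>u::real^'n. outer u u)"
    unfolding outer_def by (intro continuous_on_vec_lambda continuous_intros)
  then show ?thesis
    by (intro measurable_compose[OF H_measurable] borel_measurable_continuous_onI)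
qed

lemma integrable_le_weight:
  fixes f :: "'p \<Rightarrow> 'b::{banach, second_countable_topology}"
  assumes "f \<in> borel_measurable \<kappa>" "\<And>p. norm (f p) \<le> c * (\<bar>F p\<bar> * (1 + norm (H p)) ^ k)" "k \<le> 3" "0 \<le> c"
  shows "integrable \<kappa> f"
proof (rule Bochner_Integration.integrable_bound[OF integrable_mult_right[OF integrable_weight]])
  show "AE p in \<kappa>. norm (f p) \<le> norm (c * (\<bar>F p\<bar> * (1 + norm (H p)) ^ 3))"
  proof (rule AE_I2)
    fix p
    have "norm (f p) \<le> c * (\<bar>F p\<bar> * (1 + norm (H p)) ^ k)" by (rule assms)
    also have "\<dots> \<le> c * (\<bar>F p\<bar> * (1 + norm (H p)) ^ 3)"
      using assms by (intro mult_left_mono power_increasing) auto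
    finally show "norm (f p) \<le> norm (c * (\<bar>F p\<bar> * (1 + norm (H p)) ^ 3))"
      using abs_ge_self order_trans by (metis real_norm_def)
  qed
qed (rule assms)

lemma integrable_mix: "integrable \<kappa> (\<lambda>p. F p * cos (\<Theta> p + H p \<bullet> x))"
proof (rule integrable_le_weight[of _ 1 0])
  fix p show "norm (F p * cos (\<Theta> p + H p \<bullet> x)) \<le> 1 * (\<bar>F p\<bar> * (1 + norm (H p)) ^ 0)"
    by (simp add: abs_mult mult_left_le)
qed auto

lemma integrable_mix_grad: "integrable \<kappa> (\<lambda>p. (- (F p * sin (\<Theta> p + H p \<bullet> x))) *\<^sub>R H p)"
proof (rule integrable_le_weight[of _ 1 1])
  fix p
  have "\<bar>F p\<bar> * \<bar>sin (\<Theta> p + H p \<bullet> x)\<bar> * norm (H p) \<le> \<bar>F p\<bar> * 1 * (1 + norm (H p))"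
    by (intro mult_mono mult_nonneg_nonneg) auto
  then show "norm ((- (F p * sin (\<Theta> p + H p \<bullet> x))) *\<^sub>R H p) \<le> 1 * (\<bar>F p\<bar> * (1 + norm (H p)) ^ 1)"
    by (simp add: abs_mult)
qed auto

lemma integrable_mix_hess: "integrable \<kappa> (\<lambda>p. (- (F p * cos (\<Theta> p + H p \<bullet> x))) *\<^sub>R outer (H p) (H p))"
proof (rule integrable_le_weight[of _ 1 2])
  fix p
  have "\<bar>F p\<bar> * \<bar>cos (\<Theta> p + H p \<bullet> x)\<bar> * (norm (H p) * norm (H p)) \<le> \<bar>F p\<bar> * 1 * ((1 + norm (H p)) * (1 + norm (H p)))"
    by (intro mult_mono mult_nonneg_nonneg) auto
  then show "norm ((- (F p * cos (\<Theta> p + H p \<bullet> x))) *\<^sub>R outer (H p) (H p)) \<le> 1 * (\<bar>F p\<bar> * (1 + norm (H p)) ^ 2)"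
    by (simp add: abs_mult norm_outer power2_eq_square)
qed auto

text \<open>Common estimate for both derivatives: \<open>c = 1\<close> for \<open>mix\<close> and
  \<open>c = norm (H p)\<close> for \<open>mix_grad\<close>. The remainder \<open>z\<close> is
  quadratic in \<open>v\<close>, and \<open>norm v < e\<close> turns one of the two factors
  \<open>norm v\<close> into \<open>e\<close>, so \<open>d = e\<close> works later.\<close>

lemma remainder_le_weight:
  assumes "norm v < e" "norm z \<le> (H p \<bullet> v)\<^sup>2" "0 \<le> c" "c \<le> 1 + norm (H p)"
  shows "\<bar>F p\<bar> * norm z * c \<le> e * norm v * (\<bar>F p\<bar> * (1 + norm (H p)) ^ 3)"
proof -
  have "norm z \<le> \<bar>H p \<bullet> v\<bar>\<^sup>2" using assms by simp
  also have "\<dots> \<le> (norm (H p) * norm v)\<^sup>2" by (intro power_mono Cauchy_Schwarz_ineq2) auto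
  also have "\<dots> = (norm (H p))\<^sup>2 * (norm v * norm v)" by (simp add: power2_eq_square)
  also have "\<dots> \<le> (1 + norm (H p))\<^sup>2 * (e * norm v)"
    using assms(1) by (intro mult_mono power_mono mult_right_mono) auto
  finally have "\<bar>F p\<bar> * norm z * c \<le> \<bar>F p\<bar> * ((1 + norm (H p))\<^sup>2 * (e * norm v)) * (1 + norm (H p))"
    using assms less_le_trans[OF _ less_imp_le[OF assms(1)], of 0]
    by (intro mult_mono) (auto intro!: mult_nonneg_nonneg order_trans[OF norm_ge_zero less_imp_le[OF assms(1)]])
  then show ?thesis by (simp add: power3_eq_cube power2_eq_square mult_ac)
qed

lemma has_derivative_mix: "(mix has_derivative (\<lambda>v. mix_grad x \<bullet> v)) (at x)"
proof -
  have eq: "(\<lambda>v. mix_grad x \<bullet> v) = (\<lambda>v. \<integral>p. (- (F p * sin (\<Theta> p + H p \<bullet> x))) *\<^sub>R H p \<bullet> v \<partial>\<kappa>)"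
    unfolding mix_grad_def
    by (rule ext, rule integral_bounded_linear[OF bounded_linear_inner_left integrable_mix_grad[of x], symmetric])
  show ?thesis
    unfolding eq unfolding mix_def[abs_def]
  proof (rule has_derivative_integral_param)
    show "integrable \<kappa> (\<lambda>p. F p * cos (\<Theta> p + H p \<bullet> x))" for x by (rule integrable_mix)
    show "integrable \<kappa> (\<lambda>p. (- (F p * sin (\<Theta> p + H p \<bullet> x))) *\<^sub>R H p \<bullet> v)" for v
      using integrable_mix_grad by (intro integrable_inner_left) auto
    show "bounded_linear (\<lambda>v. \<integral>p. (- (F p * sin (\<Theta> p + H p \<bullet> x))) *\<^sub>R H p \<bullet> v \<partial>\<kappa>)"
      unfolding eq[symmetric] by (rule bounded_linear_inner_right)
    fix e :: real assume e: "e > 0"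
    show "\<exists>d>0. \<forall>v. norm v < d \<longrightarrow> (\<forall>p. norm (F p * cos (\<Theta> p + H p \<bullet> (x + v)) - F p * cos (\<Theta> p + H p \<bullet> x)
         - (- (F p * sin (\<Theta> p + H p \<bullet> x))) *\<^sub>R H p \<bullet> v) \<le> e * norm v * (\<bar>F p\<bar> * (1 + norm (H p)) ^ 3))"
    proof (intro exI[of _ e] conjI allI impI e)
      fix v :: "real^'n" and p assume v: "norm v < e"
      let ?z = "cos (\<Theta> p + H p \<bullet> x + H p \<bullet> v) - cos (\<Theta> p + H p \<bullet> x) + (H p \<bullet> v) * sin (\<Theta> p + H p \<bullet> x)"
      have "F p * cos (\<Theta> p + H p \<bullet> (x + v)) - F p * cos (\<Theta> p + H p \<bullet> x)
         - (- (F p * sin (\<Theta> p + H p \<bullet> x))) *\<^sub>R H p \<bullet> v = F p * ?z"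
        by (simp add: inner_add_right algebra_simps)
      moreover have "\<bar>F p\<bar> * norm ?z * 1 \<le> e * norm v * (\<bar>F p\<bar> * (1 + norm (H p)) ^ 3)"
        by (rule remainder_le_weight[OF v]) (use cos_add_expansion in auto)
      ultimately show "norm (F p * cos (\<Theta> p + H p \<bullet> (x + v)) - F p * cos (\<Theta> p + H p \<bullet> x)
         - (- (F p * sin (\<Theta> p + H p \<bullet> x))) *\<^sub>R H p \<bullet> v) \<le> e * norm v * (\<bar>F p\<bar> * (1 + norm (H p)) ^ 3)"
        by (simp only: real_norm_def abs_mult mult_1_right)
    qed
  qed (rule integrable_weight)
qed

lemma has_derivative_mix_grad: "(mix_grad has_derivative (\<lambda>v. mix_hess x *v v)) (at x)"
proof -
  let ?h = "\<lambda>p. (- (F p * cos (\<Theta> p + H p \<bullet> x))) *\<^sub>R outer (H p) (H p)"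
  have eq: "(\<lambda>v. mix_hess x *v v) = (\<lambda>v. \<integral>p. ?h p *v v \<partial>\<kappa>)"
    unfolding mix_hess_def
    using integral_bounded_linear[OF bounded_linear_matrix_vector_left integrable_mix_hess[of x]]
    by (simp add: fun_eq_iff)
  show ?thesis
    unfolding eq unfolding mix_grad_def[abs_def]
  proof (rule has_derivative_integral_param)
    show "integrable \<kappa> (\<lambda>p. (- (F p * sin (\<Theta> p + H p \<bullet> x))) *\<^sub>R H p)" for x by (rule integrable_mix_grad)
    show "integrable \<kappa> (\<lambda>p. ?h p *v v)" for v
      by (rule integrable_bounded_linear[OF bounded_linear_matrix_vector_left integrable_mix_hess])
    show "bounded_linear (\<lambda>v. \<integral>p. ?h p *v v \<partial>\<kappa>)"
      unfolding eq[symmetric] by (rule bounded_linear_matrix_vector_right)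
    fix e :: real assume e: "e > 0"
    show "\<exists>d>0. \<forall>v. norm v < d \<longrightarrow> (\<forall>p. norm ((- (F p * sin (\<Theta> p + H p \<bullet> (x + v)))) *\<^sub>R H p - (- (F p * sin (\<Theta> p + H p \<bullet> x))) *\<^sub>R H p
         - ?h p *v v) \<le> e * norm v * (\<bar>F p\<bar> * (1 + norm (H p)) ^ 3))"
    proof (intro exI[of _ e] conjI allI impI e)
      fix v :: "real^'n" and p assume v: "norm v < e"
      let ?z = "sin (\<Theta> p + H p \<bullet> x + H p \<bullet> v) - sin (\<Theta> p + H p \<bullet> x) - (H p \<bullet> v) * cos (\<Theta> p + H p \<bullet> x)"
      have hv: "?h p *v v = (- (F p * cos (\<Theta> p + H p \<bullet> x)) * (H p \<bullet> v)) *\<^sub>R H p"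
        by (simp only: scaleR_matrix_vector_assoc[symmetric] outer_mult_vec scaleR_scaleR)
      have "(- (F p * sin (\<Theta> p + H p \<bullet> (x + v)))) *\<^sub>R H p - (- (F p * sin (\<Theta> p + H p \<bullet> x))) *\<^sub>R H p
         - ?h p *v v = (- F p * ?z) *\<^sub>R H p"
        unfolding hv by (simp add: inner_add_right algebra_simps)
      moreover have "\<bar>F p\<bar> * norm ?z * norm (H p) \<le> e * norm v * (\<bar>F p\<bar> * (1 + norm (H p)) ^ 3)"
        by (rule remainder_le_weight[OF v]) (use sin_add_expansion in auto)
      ultimately show "norm ((- (F p * sin (\<Theta> p + H p \<bullet> (x + v)))) *\<^sub>R H p - (- (F p * sin (\<Theta> p + H p \<bullet> x))) *\<^sub>R H p
         - ?h p *v v) \<le> e * norm v * (\<bar>F p\<bar> * (1 + norm (H p)) ^ 3)"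
        by (simp only: norm_scaleR real_norm_def abs_mult abs_minus_cancel)
    qed
  qed (rule integrable_weight)
qed

lemma grad_mix: "grad mix = mix_grad"
  using grad_eq[OF has_derivative_mix] by (simp add: fun_eq_iff)

lemma hess_mix: "hess mix = mix_hess"
  using hess_eq[of mix] has_derivative_mix_grad by (simp add: fun_eq_iff grad_mix)

text \<open>By Fubini, averaging over the shift multiplies the wave of frequency \<open>H p\<close>
  by the characteristic function at \<open>H p\<close>.\<close>

lemma shift_mean_mix:
  assumes "prob_space M" and [measurable]: "Y \<in> borel_measurable M"
  shows "(\<integral>\<omega>. mix (x + Y \<omega>) \<partial>M) = (\<integral>p. F p * Re (cis (\<Theta> p + H p \<bullet> x) * char_fun M Y (H p)) \<partial>\<kappa>)"
proof -
  interpret M: prob_space M by (rule assms)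
  interpret P: pair_sigma_finite \<kappa> M by standard
  have "integrable (\<kappa> \<Otimes>\<^sub>M M) (\<lambda>(p, \<omega>). F p * cos (\<Theta> p + H p \<bullet> (x + Y \<omega>)))"
  proof (rule P.Fubini_integrable)
    show "integrable \<kappa> (\<lambda>p. \<integral>\<omega>. norm (case (p, \<omega>) of (p, \<omega>) \<Rightarrow> F p * cos (\<Theta> p + H p \<bullet> (x + Y \<omega>))) \<partial>M)"
      unfolding prod.case
    proof (rule integrable_le_weight[of _ 1 0])
      fix p
      have "norm (\<integral>\<omega>. norm (F p * cos (\<Theta> p + H p \<bullet> (x + Y \<omega>))) \<partial>M) \<le> \<bar>F p\<bar>"
        by (rule M.norm_integral_le_const) (simp add: abs_mult mult_left_le)
      then show "norm (\<integral>\<omega>. norm (F p * cos (\<Theta> p + H p \<bullet> (x + Y \<omega>))) \<partial>M) \<le> 1 * (\<bar>F p\<bar> * (1 + norm (H p)) ^ 0)"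
        by (simp only: power_0 mult_1_left mult_1_right)
      show "(\<lambda>p. \<integral>\<omega>. norm (F p * cos (\<Theta> p + H p \<bullet> (x + Y \<omega>))) \<partial>M) \<in> borel_measurable \<kappa>"
        by measurable
    qed simp_all
    have "integrable M (\<lambda>\<omega>. F p * cos (\<Theta> p + H p \<bullet> (x + Y \<omega>)))" for p
      by (rule M.integrable_const_bound[of _ "\<bar>F p\<bar>"]) (auto simp: abs_mult mult_left_le)
    then show "AE p in \<kappa>. integrable M (\<lambda>\<omega>. case (p, \<omega>) of (p, \<omega>) \<Rightarrow> F p * cos (\<Theta> p + H p \<bullet> (x + Y \<omega>)))"
      by simp
  qed measurable
  then have 1: "(\<integral>\<omega>. (\<integral>p. F p * cos (\<Theta> p + H p \<bullet> (x + Y \<omega>)) \<partial>\<kappa>) \<partial>M) = (\<integral>p. (\<integral>\<omega>. F p * cos (\<Theta> p + H p \<bullet> (x + Y \<omega>)) \<partial>M) \<partial>\<kappa>)"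
    by (rule P.Fubini_integral)
  have 2: "(\<integral>\<omega>. F p * cos (\<Theta> p + H p \<bullet> (x + Y \<omega>)) \<partial>M) = F p * Re (cis (\<Theta> p + H p \<bullet> x) * char_fun M Y (H p))" for p
    using M.integral_cos_char_fun(1)[OF assms(2), of "\<Theta> p + H p \<bullet> x" "H p"]
    by (simp add: inner_add_right add.assoc)
  show ?thesis unfolding mix_def 1 2 ..
qed

text \<open>The operator acts on a wave of frequency \<open>H p\<close> as the multiplier
  \<open>- levy_exponent Q a \<nu> (H p)\<close>. Trace and gradient terms are bounded linear and
  pass under the integral; the jump term requires Fubini, justified by the product majorant in
  \<open>k_bd\<close>.\<close>

lemma levy_op_mix:
  fixes a :: "real^'n"
  assumes \<nu>: "levy_measure \<nu>"
  shows "levy_op Q a \<nu> mix mix_grad mix_hess x = (\<integral>p. F p * Re (cis (\<Theta> p + H p \<bullet> x) * - levy_exponent Q a \<nu> (H p)) \<partial>\<kappa>)"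
    and "integrable \<kappa> (\<lambda>p. F p * Re (cis (\<Theta> p + H p \<bullet> x) * - levy_exponent Q a \<nu> (H p)))"
proof -
  have s[measurable_cong]: "sets \<nu> = sets borel" using \<nu> by (simp add: levy_measure_def)
  interpret N: sigma_finite_measure \<nu> using \<nu> by (simp add: levy_measure_def)
  interpret P: pair_sigma_finite \<kappa> \<nu> by standard
  let ?c = "\<lambda>p. cis (\<Theta> p + H p \<bullet> x)"
  let ?k = "\<lambda>p y. F p * Re (?c p * levy_kernel (H p) y)"
  let ?I = "\<integral>y. min 1 ((norm y)\<^sup>2) \<partial>\<nu>"
  have I0: "?I \<ge> 0" by (rule integral_nonneg_AE) auto
  \<comment> \<open>The real part of phase times kernel is exactly the compensated jump increment of
    a single wave, so the same function can be integrated over \<open>p\<close> first or over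
    \<open>y\<close> first.\<close>
  have k_eq: "?k p y = F p * cos (\<Theta> p + H p \<bullet> (x + y)) - F p * cos (\<Theta> p + H p \<bullet> x)
      - (if norm y \<le> 1 then y \<bullet> ((- (F p * sin (\<Theta> p + H p \<bullet> x))) *\<^sub>R H p) else 0)" for p y
    by (simp add: levy_kernel_def inner_add_right cos_add sin_add algebra_simps inner_commute)
  have k_bd: "norm (?k p y) \<le> \<bar>F p\<bar> * (2 * (1 + norm (H p))\<^sup>2) * min 1 ((norm y)\<^sup>2)" for p y
  proof -
    have "\<bar>Re (?c p * levy_kernel (H p) y)\<bar> \<le> cmod (?c p * levy_kernel (H p) y)" by (rule abs_Re_le_cmod)
    also have "\<dots> \<le> 2 * (1 + norm (H p))\<^sup>2 * min 1 ((norm y)\<^sup>2)"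
      using levy_kernel_bound[of "H p" y] by (simp add: norm_mult)
    finally have "\<bar>F p\<bar> * \<bar>Re (?c p * levy_kernel (H p) y)\<bar> \<le> \<bar>F p\<bar> * (2 * (1 + norm (H p))\<^sup>2 * min 1 ((norm y)\<^sup>2))"
      by (intro mult_left_mono) auto
    then show ?thesis by (simp only: real_norm_def abs_mult mult.assoc)
  qed
  have k_m[measurable]: "(\<lambda>p. levy_kernel (H (fst p)) (snd p)) \<in> borel_measurable (\<kappa> \<Otimes>\<^sub>M \<nu>)"
    unfolding levy_kernel_def by measurable
  have k_m2[measurable]: "levy_kernel u \<in> borel_measurable \<nu>" for u
    using levy_kernel_integrable[OF \<nu>] by (rule borel_measurable_integrable)
  have k_int: "integrable \<nu> (?k p)" for p
  proof (rule Bochner_Integration.integrable_bound[OF integrable_mult_right[OF levy_measure_integrable[OF \<nu>]]])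
    show "AE y in \<nu>. norm (?k p y) \<le> norm ((\<bar>F p\<bar> * (2 * (1 + norm (H p))\<^sup>2)) * min 1 ((norm y)\<^sup>2))"
      using k_bd abs_ge_self order_trans unfolding real_norm_def by (intro AE_I2) blast
  qed measurable
  have "integrable (\<kappa> \<Otimes>\<^sub>M \<nu>) (\<lambda>(p, y). ?k p y)"
  proof (rule P.Fubini_integrable)
    have "(\<integral>y. norm (?k p y) \<partial>\<nu>) \<le> (\<integral>y. \<bar>F p\<bar> * (2 * (1 + norm (H p))\<^sup>2) * min 1 ((norm y)\<^sup>2) \<partial>\<nu>)" for p
      using k_bd levy_measure_integrable[OF \<nu>] k_int by (intro integral_mono) auto
    then have "norm (\<integral>y. norm (?k p y) \<partial>\<nu>) \<le> (2 * ?I) * (\<bar>F p\<bar> * (1 + norm (H p))\<^sup>2)" for p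
      by (simp add: mult_ac)
    then show "integrable \<kappa> (\<lambda>p. \<integral>y. norm (case (p, y) of (p, y) \<Rightarrow> ?k p y) \<partial>\<nu>)"
      using I0 by (intro integrable_le_weight[of _ "2 * ?I" 2]) (auto simp: split_beta)
    show "AE p in \<kappa>. integrable \<nu> (\<lambda>y. case (p, y) of (p, y) \<Rightarrow> ?k p y)"
      using k_int by simp
  qed (simp add: split_beta, measurable)
  then have fub: "(\<integral>y. (\<integral>p. ?k p y \<partial>\<kappa>) \<partial>\<nu>) = (\<integral>p. (\<integral>y. ?k p y \<partial>\<nu>) \<partial>\<kappa>)"
    and fub_int: "integrable \<kappa> (\<lambda>p. \<integral>y. ?k p y \<partial>\<nu>)"
    using P.Fubini_integral[of ?k] P.integrable_fst'[of "\<lambda>(p, y). ?k p y"] by auto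
  have inner_p: "(\<integral>p. ?k p y \<partial>\<kappa>) = mix (x + y) - mix x - (if norm y \<le> 1 then y \<bullet> mix_grad x else 0)" for y
  proof (cases "norm y \<le> 1")
    case True
    note i = Bochner_Integration.integrable_diff[OF integrable_mix[of "x + y"] integrable_mix[of x]]
    note L = integrable_bounded_linear[OF bounded_linear_inner_right[of y] integrable_mix_grad[of x]]
      integral_bounded_linear[OF bounded_linear_inner_right[of y] integrable_mix_grad[of x]]
    show ?thesis
      unfolding k_eq mix_def mix_grad_def L(2)[symmetric] using True
      by (simp only: if_True Bochner_Integration.integral_diff[OF i L(1)]
         Bochner_Integration.integral_diff[OF integrable_mix[of "x + y"] integrable_mix[of x]])
  next
    case False
    then show ?thesis
      unfolding k_eq mix_def
      by (simp only: if_False diff_zero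
         Bochner_Integration.integral_diff[OF integrable_mix[of "x + y"] integrable_mix[of x]])
  qed
  have inner_y: "(\<integral>y. ?k p y \<partial>\<nu>) = F p * Re (?c p * (\<integral>y. levy_kernel (H p) y \<partial>\<nu>))" for p
  proof -
    have "integrable \<nu> (\<lambda>y. ?c p * levy_kernel (H p) y)"
      using levy_kernel_integrable[OF \<nu>] by (intro integrable_mult_right)
    from integral_Re[OF this] show ?thesis by simp
  qed
  have tr: "trace (Q ** mix_hess x) = (\<integral>p. - (F p * cos (\<Theta> p + H p \<bullet> x)) * ((Q *v H p) \<bullet> H p) \<partial>\<kappa>)"
    and tr_int: "integrable \<kappa> (\<lambda>p. - (F p * cos (\<Theta> p + H p \<bullet> x)) * ((Q *v H p) \<bullet> H p))"
  proof -
    have e: "trace (Q ** ((- (F p * cos (\<Theta> p + H p \<bullet> x))) *\<^sub>R outer (H p) (H p))) = - (F p * cos (\<Theta> p + H p \<bullet> x)) * ((Q *v H p) \<bullet> H p)" for p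
      using linear_cmul[OF bounded_linear.linear[OF bounded_linear_trace_mult[of Q]]] by (simp only: trace_mult_outer real_scaleR_def)
    show "trace (Q ** mix_hess x) = (\<integral>p. - (F p * cos (\<Theta> p + H p \<bullet> x)) * ((Q *v H p) \<bullet> H p) \<partial>\<kappa>)"
      using integral_bounded_linear[OF bounded_linear_trace_mult[of Q] integrable_mix_hess[of x]] unfolding e mix_hess_def by simp
    show "integrable \<kappa> (\<lambda>p. - (F p * cos (\<Theta> p + H p \<bullet> x)) * ((Q *v H p) \<bullet> H p))"
      using integrable_bounded_linear[OF bounded_linear_trace_mult[of Q] integrable_mix_hess[of x]] unfolding e .
  qed
  have gr: "a \<bullet> mix_grad x = (\<integral>p. - (F p * sin (\<Theta> p + H p \<bullet> x)) * (a \<bullet> H p) \<partial>\<kappa>)"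
    unfolding mix_grad_def
    using integral_bounded_linear[OF bounded_linear_inner_right[of a] integrable_mix_grad[of x]]
    by (simp only: inner_scaleR_right)
  have gr_int: "integrable \<kappa> (\<lambda>p. - (F p * sin (\<Theta> p + H p \<bullet> x)) * (a \<bullet> H p))"
    using integrable_bounded_linear[OF bounded_linear_inner_right[of a] integrable_mix_grad[of x]]
    by (simp only: inner_scaleR_right)
  have sum_eq: "F p * Re (?c p * - levy_exponent Q a \<nu> (H p)) =
      1/2 * (- (F p * cos (\<Theta> p + H p \<bullet> x)) * ((Q *v H p) \<bullet> H p)) + - (F p * sin (\<Theta> p + H p \<bullet> x)) * (a \<bullet> H p) + (\<integral>y. ?k p y \<partial>\<nu>)" for p
    unfolding inner_y levy_exponent_eq by (simp add: algebra_simps)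
  show "integrable \<kappa> (\<lambda>p. F p * Re (?c p * - levy_exponent Q a \<nu> (H p)))"
    unfolding sum_eq using tr_int gr_int fub_int by (intro Bochner_Integration.integrable_add integrable_mult_right)
  have "levy_op Q a \<nu> mix mix_grad mix_hess x = 1/2 * trace (Q ** mix_hess x) + a \<bullet> mix_grad x + (\<integral>y. (\<integral>p. ?k p y \<partial>\<kappa>) \<partial>\<nu>)"
    unfolding levy_op_def inner_p ..
  also have "\<dots> = (\<integral>p. F p * Re (?c p * - levy_exponent Q a \<nu> (H p)) \<partial>\<kappa>)"
    unfolding fub tr gr sum_eq using tr_int gr_int fub_int
    by (simp only: Bochner_Integration.integral_add Bochner_Integration.integrable_add integrable_mult_right integral_mult_right_zero)
  finally show "levy_op Q a \<nu> mix mix_grad mix_hess x = (\<integral>p. F p * Re (?c p * - levy_exponent Q a \<nu> (H p)) \<partial>\<kappa>)" .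
qed

end


section \<open>Approximation by mixtures\<close>

lemma C2_gradient_continuous: "C2 f g h \<Longrightarrow> continuous_on UNIV g"
  by (meson C2_def continuous_at_imp_continuous_on has_derivative_continuous)

lemma continuous_on_outer:
  "continuous_on S f \<Longrightarrow> continuous_on S g \<Longrightarrow> continuous_on S (\<lambda>x. outer (f x) (g x))"
  unfolding outer_def by (intro continuous_on_vec_lambda continuous_intros)

lemma C2_mult:
  assumes f: "C2 f g h" and f': "C2 f' g' h'"
  shows "C2 (\<lambda>x. f x * f' x) (\<lambda>x. f x *\<^sub>R g' x + f' x *\<^sub>R g x)
     (\<lambda>x. f x *\<^sub>R h' x + outer (g' x) (g x) + (f' x *\<^sub>R h x + outer (g x) (g' x)))"
proof -
  have d: "\<And>x. (f has_derivative (\<lambda>v. g x \<bullet> v)) (at x)" "\<And>x. (g has_derivative (\<lambda>v. h x *v v)) (at x)"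
    "\<And>x. (f' has_derivative (\<lambda>v. g' x \<bullet> v)) (at x)" "\<And>x. (g' has_derivative (\<lambda>v. h' x *v v)) (at x)"
    using f f' by (auto simp: C2_def)
  have "((\<lambda>x. f x * f' x) has_derivative (\<lambda>v. (f x *\<^sub>R g' x + f' x *\<^sub>R g x) \<bullet> v)) (at x)" for x
    using has_derivative_mult[OF d(1) d(3), of x] by (simp add: inner_add_left mult_ac)
  moreover have "((\<lambda>x. f x *\<^sub>R g' x + f' x *\<^sub>R g x) has_derivative
      (\<lambda>v. (f x *\<^sub>R h' x + outer (g' x) (g x) + (f' x *\<^sub>R h x + outer (g x) (g' x))) *v v)) (at x)" for x
    using has_derivative_add[OF has_derivative_scaleR[OF d(1) d(4), of x] has_derivative_scaleR[OF d(3) d(2), of x]]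
    by (simp only: matrix_vector_mult_add_rdistrib outer_mult_vec scaleR_matrix_vector_assoc[symmetric])
  moreover have "continuous_on UNIV h" "continuous_on UNIV h'" using f f' by (auto simp: C2_def)
  then have "continuous_on UNIV (\<lambda>x. f x *\<^sub>R h' x + outer (g' x) (g x) + (f' x *\<^sub>R h x + outer (g x) (g' x)))"
    using C2_continuous[OF f] C2_continuous[OF f'] C2_gradient_continuous[OF f] C2_gradient_continuous[OF f']
    by (intro continuous_intros continuous_on_outer)
  ultimately show ?thesis by (simp add: C2_def)
qed

lemma C2_rescale:
  assumes "C2 f g h"
  shows "C2 (\<lambda>x. f (r *\<^sub>R x)) (\<lambda>x. r *\<^sub>R g (r *\<^sub>R x)) (\<lambda>x. r\<^sup>2 *\<^sub>R h (r *\<^sub>R x))"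
proof -
  have d: "\<And>x. (f has_derivative (\<lambda>v. g x \<bullet> v)) (at x)" "\<And>x. (g has_derivative (\<lambda>v. h x *v v)) (at x)"
    using assms by (auto simp: C2_def)
  have s: "((\<lambda>x. r *\<^sub>R x) has_derivative (\<lambda>v. r *\<^sub>R v)) (at x)" for x :: "real^'n"
    by (rule bounded_linear_imp_has_derivative[OF bounded_linear_scaleR_right])
  have "((\<lambda>x. f (r *\<^sub>R x)) has_derivative (\<lambda>v. r *\<^sub>R g (r *\<^sub>R x) \<bullet> v)) (at x)" for x
    using has_derivative_compose[OF s d(1)] by simp
  moreover have "((\<lambda>x. r *\<^sub>R g (r *\<^sub>R x)) has_derivative (\<lambda>v. (r\<^sup>2 *\<^sub>R h (r *\<^sub>R x)) *v v)) (at x)" for x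
    using has_derivative_scaleR_right[OF has_derivative_compose[OF s d(2)], of r]
    by (simp add: power2_eq_square matrix_vector_mult_scaleR scaleR_matrix_vector_assoc[symmetric])
  moreover have "continuous_on UNIV (\<lambda>x. r\<^sup>2 *\<^sub>R h (r *\<^sub>R x))"
  proof (rule continuous_on_scaleR[OF continuous_on_const])
    have "continuous_on UNIV h" using assms by (simp add: C2_def)
    then show "continuous_on UNIV (\<lambda>x. h (r *\<^sub>R x))"
      by (rule continuous_on_compose2[of UNIV h]) (auto intro: continuous_on_scaleR continuous_on_const continuous_on_id)
  qed
  ultimately show ?thesis by (simp add: C2_def)
qed

section \<open>Cutoff functions of class C^2\<close>

lemma DERIV_max0_power:
  "((\<lambda>y. (max 0 y) ^ Suc (Suc n)) has_real_derivative real (Suc (Suc n)) * (max 0 y) ^ Suc n) (at y)"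
proof (cases y "0::real" rule: linorder_cases)
  case less
  have "((\<lambda>y. 0) has_real_derivative 0) (at y)" by simp
  moreover have ev: "eventually (\<lambda>z. (max 0 z) ^ Suc (Suc n) = 0) (nhds y)"
    using less by (intro eventually_mono[OF eventually_nhds_in_open[of "{..<0}"]]) auto
  ultimately have "((\<lambda>y. (max 0 y) ^ Suc (Suc n)) has_real_derivative 0) (at y)"
    using DERIV_cong_ev[OF refl ev refl] by simp
  then show ?thesis using less by simp
next
  case greater
  have "((\<lambda>y. y ^ Suc (Suc n)) has_real_derivative real (Suc (Suc n)) * y ^ Suc n) (at y)"
    using DERIV_pow[of "Suc (Suc n)" y] by simp
  moreover have ev: "eventually (\<lambda>z. (max 0 z) ^ Suc (Suc n) = z ^ Suc (Suc n)) (nhds y)"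
    using greater by (intro eventually_mono[OF eventually_nhds_in_open[of "{0<..}"]]) auto
  ultimately have "((\<lambda>y. (max 0 y) ^ Suc (Suc n)) has_real_derivative real (Suc (Suc n)) * y ^ Suc n) (at y)"
    using DERIV_cong_ev[OF refl ev refl] by simp
  then show ?thesis using greater by simp
next
  case equal
  \<comment> \<open>At the corner the difference quotient is at most
    \<open>\<bar>h\<bar> ^ Suc n\<close>, which tends to 0 because the power is at least 2.\<close>
  have "((\<lambda>h::real. (max 0 (0 + h)) ^ Suc (Suc n) / h) \<longlongrightarrow> 0) (at 0)"
  proof (rule Lim_null_comparison)
    show "\<forall>\<^sub>F h in at 0. norm ((max 0 (0 + h)) ^ Suc (Suc n) / h) \<le> \<bar>h\<bar> ^ Suc n"
    proof (rule always_eventually, rule allI)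
      fix h :: real show "norm ((max 0 (0 + h)) ^ Suc (Suc n) / h) \<le> \<bar>h\<bar> ^ Suc n"
      proof (cases "h \<le> 0")
        case True then show ?thesis by (simp add: max_absorb1 del: power_Suc)
      next
        case False then show ?thesis by (simp add: max_absorb2 abs_mult)
      qed
    qed
    have "((\<lambda>h. \<bar>h\<bar> ^ Suc n) \<longlongrightarrow> \<bar>0\<bar> ^ Suc n) (at (0::real))" by (intro tendsto_intros)
    then show "((\<lambda>h. \<bar>h\<bar> ^ Suc n) \<longlongrightarrow> 0) (at (0::real))" by simp
  qed
  then show ?thesis using equal by (simp add: DERIV_def)
qed

text \<open>The cube makes the second derivatives continuous across the unit sphere while keeping
  all derivatives explicit. The value 1 is attained only at the origin, so the approximation below
  relies on continuity there after rescaling.\<close>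

definition cutoff :: "real^'n \<Rightarrow> real" where
  "cutoff x = (max 0 (1 - x \<bullet> x)) ^ 3"

definition cutoff_grad :: "real^'n \<Rightarrow> real^'n" where
  "cutoff_grad x = (- 6 * (max 0 (1 - x \<bullet> x))\<^sup>2) *\<^sub>R x"

definition cutoff_hess :: "real^'n \<Rightarrow> real^'n^'n" where
  "cutoff_hess x = (24 * max 0 (1 - x \<bullet> x)) *\<^sub>R outer x x - (6 * (max 0 (1 - x \<bullet> x))\<^sup>2) *\<^sub>R mat 1"

lemma C2_cutoff: "C2 (cutoff :: real^'n \<Rightarrow> real) cutoff_grad cutoff_hess"
proof -
  have q: "((\<lambda>x::real^'n. 1 - x \<bullet> x) has_derivative (\<lambda>v. - (2 * (x \<bullet> v)))) (at x)" for x
    by (auto intro!: derivative_eq_intros simp: inner_commute)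
  have p: "((\<lambda>x::real^'n. (max 0 (1 - x \<bullet> x)) ^ Suc (Suc n)) has_derivative
      (\<lambda>v. (real (Suc (Suc n)) * (max 0 (1 - x \<bullet> x)) ^ Suc n) * - (2 * (x \<bullet> v)))) (at x)" for x n
    using has_derivative_compose[OF q DERIV_max0_power[unfolded has_field_derivative_def]] by simp
  have "(cutoff has_derivative (\<lambda>v. cutoff_grad x \<bullet> v)) (at x)" for x :: "real^'n"
    using p[of 1 x] by (simp add: cutoff_def[abs_def] cutoff_grad_def numeral_3_eq_3 numeral_2_eq_2 mult_ac)
  moreover have "(cutoff_grad has_derivative (\<lambda>v. cutoff_hess x *v v)) (at x)" for x :: "real^'n"
  proof -
    have "((\<lambda>x. - 6 * (max 0 (1 - x \<bullet> x)) ^ Suc (Suc 0)) has_derivative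
       (\<lambda>v. - 6 * ((real (Suc (Suc 0)) * (max 0 (1 - x \<bullet> x)) ^ Suc 0) * - (2 * (x \<bullet> v))))) (at x)"
      by (rule has_derivative_mult_right[OF p])
    from has_derivative_scaleR[OF this has_derivative_ident]
    have "(cutoff_grad has_derivative (\<lambda>v. (- 6 * (max 0 (1 - x \<bullet> x))\<^sup>2) *\<^sub>R v
        + (24 * max 0 (1 - x \<bullet> x) * (x \<bullet> v)) *\<^sub>R x)) (at x)"
      unfolding cutoff_grad_def[abs_def] by (simp add: numeral_2_eq_2 mult_ac)
    moreover have "cutoff_hess x *v v = (- 6 * (max 0 (1 - x \<bullet> x))\<^sup>2) *\<^sub>R v
        + (24 * max 0 (1 - x \<bullet> x) * (x \<bullet> v)) *\<^sub>R x" for v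
      by (simp add: cutoff_hess_def matrix_vector_mult_diff_rdistrib outer_mult_vec scaleR_matrix_vector_assoc[symmetric])
    ultimately show ?thesis by simp
  qed
  moreover have "continuous_on UNIV (cutoff_hess :: real^'n \<Rightarrow> _)"
    unfolding cutoff_hess_def[abs_def] by (intro continuous_intros continuous_on_outer)
  ultimately show ?thesis by (simp add: C2_def)
qed

lemma cutoff_outside:
  assumes "norm x \<ge> 1" shows "cutoff x = 0" "cutoff_grad x = 0" "cutoff_hess x = 0"
proof -
  have "1 \<le> x \<bullet> x" using assms by (simp add: power2_norm_eq_inner[symmetric] one_le_power)
  then have m: "max 0 (1 - x \<bullet> x) = 0" by simp
  show "cutoff x = 0" "cutoff_grad x = 0" "cutoff_hess x = 0"
    unfolding cutoff_def cutoff_grad_def cutoff_hess_def m by simp_all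
qed

lemma cutoff_bounds: "0 \<le> cutoff x" "cutoff x \<le> 1"
proof -
  show "0 \<le> cutoff x" by (simp add: cutoff_def)
  have "max 0 (1 - x \<bullet> x) ^ 3 \<le> 1 ^ 3" by (intro power_mono) auto
  then show "cutoff x \<le> 1" by (simp add: cutoff_def)
qed

lemma C2_vanishing_cutoff: "C2_vanishing (cutoff :: real^'n \<Rightarrow> real) cutoff_grad cutoff_hess"
  unfolding C2_vanishing_def
proof (intro conjI C2_cutoff vanishing_compact_support[of _ 1])
  show "continuous_on UNIV (cutoff :: real^'n \<Rightarrow> real)" by (rule C2_continuous[OF C2_cutoff])
  show "continuous_on UNIV (cutoff_grad :: real^'n \<Rightarrow> _)" by (rule C2_gradient_continuous[OF C2_cutoff])
  show "continuous_on UNIV (cutoff_hess :: real^'n \<Rightarrow> _)" using C2_cutoff[where 'n = 'n] by (simp add: C2_def)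
qed (auto intro: cutoff_outside)

text \<open>Leibniz rule for the product of \<open>f\<close> with the rescaled cutoff;
  \<open>cut_hess\<close> is the second derivative of the same product.\<close>

definition cut_grad :: "real \<Rightarrow> (real^'n \<Rightarrow> real) \<Rightarrow> (real^'n \<Rightarrow> real^'n) \<Rightarrow> real^'n \<Rightarrow> real^'n" where
  "cut_grad r f g x = f x *\<^sub>R (r *\<^sub>R cutoff_grad (r *\<^sub>R x)) + cutoff (r *\<^sub>R x) *\<^sub>R g x"

definition cut_hess :: "real \<Rightarrow> (real^'n \<Rightarrow> real) \<Rightarrow> (real^'n \<Rightarrow> real^'n) \<Rightarrow> (real^'n \<Rightarrow> real^'n^'n) \<Rightarrow> real^'n \<Rightarrow> real^'n^'n" where
  "cut_hess r f g h x = f x *\<^sub>R (r\<^sup>2 *\<^sub>R cutoff_hess (r *\<^sub>R x)) + outer (r *\<^sub>R cutoff_grad (r *\<^sub>R x)) (g x)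
     + (cutoff (r *\<^sub>R x) *\<^sub>R h x + outer (g x) (r *\<^sub>R cutoff_grad (r *\<^sub>R x)))"

lemma outer_zero[simp]: "outer 0 v = 0" "outer u 0 = 0"
  by (simp_all add: outer_def vec_eq_iff)

text \<open>The product has compact support, whatever the growth of \<open>f\<close>. Polynomials
  are cut in this way in the density proof below.\<close>

lemma C2_vanishing_cut:
  assumes "C2 f g h" "r > 0"
  shows "C2_vanishing (\<lambda>x. f x * cutoff (r *\<^sub>R x)) (cut_grad r f g) (cut_hess r f g h)"
    and "norm x \<ge> 1 / r \<Longrightarrow> f x * cutoff (r *\<^sub>R x) = 0"
    and "norm x \<ge> 1 / r \<Longrightarrow> cut_grad r f g x = 0"
proof -
  have C: "C2 (\<lambda>x. f x * cutoff (r *\<^sub>R x)) (cut_grad r f g) (cut_hess r f g h)"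
    unfolding cut_grad_def[abs_def] cut_hess_def[abs_def] by (rule C2_mult[OF assms(1) C2_rescale[OF C2_cutoff]])
  have z: "cutoff (r *\<^sub>R x) = 0 \<and> cutoff_grad (r *\<^sub>R x) = 0 \<and> cutoff_hess (r *\<^sub>R x) = 0" if "norm x \<ge> 1 / r" for x :: "real^'n"
    using cutoff_outside[of "r *\<^sub>R x"] that assms(2) by (simp add: field_simps)
  have s: "f x * cutoff (r *\<^sub>R x) = 0" "cut_grad r f g x = 0" "cut_hess r f g h x = 0" if "norm x \<ge> 1 / r" for x
    using z[OF that] by (simp_all add: cut_grad_def cut_hess_def)
  have "continuous_on UNIV (cut_hess r f g h)" using C by (simp add: C2_def)
  then show "C2_vanishing (\<lambda>x. f x * cutoff (r *\<^sub>R x)) (cut_grad r f g) (cut_hess r f g h)"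
    unfolding C2_vanishing_def using C s C2_continuous[OF C] C2_gradient_continuous[OF C]
    by (intro conjI vanishing_compact_support[of _ "1 / r"]) auto
  show "norm x \<ge> 1 / r \<Longrightarrow> f x * cutoff (r *\<^sub>R x) = 0" "norm x \<ge> 1 / r \<Longrightarrow> cut_grad r f g x = 0"
    using s by auto
qed

text \<open>Outside a large ball \<open>u\<close> is already small; inside it the rescaled argument
  is near 0, where the cutoff is near 1.\<close>

lemma vanishing_cutoff_approx:
  fixes u :: "real^'n \<Rightarrow> 'b::real_normed_vector"
  assumes u: "vanishing u" and e: "e > 0"
  obtains R where "R > 0" "\<And>r x. 0 < r \<Longrightarrow> r \<le> R \<Longrightarrow> norm ((1 - cutoff (r *\<^sub>R x)) *\<^sub>R u x) \<le> e"
proof -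
  obtain B where B: "B > 0" "\<And>x. norm (u x) \<le> B" using vanishing_bounded[OF u] by auto
  obtain b where b: "b > 0" "\<And>x. norm x \<ge> b \<Longrightarrow> norm (u x) < e" using vanishing_at_infinityD[OF u e] by auto
  have "isCont cutoff (0::real^'n)" using C2_continuous[OF C2_cutoff[where 'n = 'n]] by (simp add: continuous_on_eq_continuous_at)
  moreover have "cutoff (0::real^'n) = 1" by (simp add: cutoff_def)
  ultimately obtain d where d: "d > 0" "\<And>z::real^'n. norm z < d \<Longrightarrow> \<bar>cutoff z - 1\<bar> < e / B"
    using e B unfolding continuous_at_eps_delta by (metis dist_norm diff_zero divide_pos_pos real_norm_def)
  show thesis
  \<comment> \<open>The 2 gives room for a strict inequality: \<open>r * norm x\<close> is at most
    \<open>d / 2\<close> when \<open>norm x < b\<close>.\<close>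
  proof (rule that[of "d / (2 * b)"])
    fix r and x :: "real^'n" assume r: "0 < r" "r \<le> d / (2 * b)"
    have n: "norm ((1 - cutoff (r *\<^sub>R x)) *\<^sub>R u x) = (1 - cutoff (r *\<^sub>R x)) * norm (u x)"
      using cutoff_bounds[of "r *\<^sub>R x"] by simp
    show "norm ((1 - cutoff (r *\<^sub>R x)) *\<^sub>R u x) \<le> e"
    proof (cases "norm x \<ge> b")
      case True
      have "(1 - cutoff (r *\<^sub>R x)) * norm (u x) \<le> 1 * norm (u x)"
        using cutoff_bounds by (intro mult_right_mono) auto
      then show ?thesis unfolding n using b(2)[OF True] by simp
    next
      case False
      then have "r * norm x \<le> d / (2 * b) * b" using r b by (intro mult_mono) auto
      then have "norm (r *\<^sub>R x) < d" using r b d by simp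
      then have "1 - cutoff (r *\<^sub>R x) \<le> e / B" using d(2)[of "r *\<^sub>R x"] by linarith
      then have "(1 - cutoff (r *\<^sub>R x)) * norm (u x) \<le> e / B * B"
        using B e cutoff_bounds by (intro mult_mono) auto
      then show ?thesis unfolding n using B by simp
    qed
  qed (use d b in auto)
qed

text \<open>Each derivative that falls on the cutoff brings a factor \<open>r\<close>, so the extra
  Leibniz terms are small with \<open>r\<close>; the remaining terms are covered by
  \<open>vanishing_cutoff_approx\<close>.\<close>

lemma C2_cut_approx:
  assumes f: "C2_vanishing f g h" and e: "e > 0"
  obtains r where "r > 0"
    "C2_bounded e (\<lambda>x. f x - f x * cutoff (r *\<^sub>R x)) (\<lambda>x. g x - cut_grad r f g x) (\<lambda>x. h x - cut_hess r f g h x)"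
proof -
  have v: "vanishing f" "vanishing g" "vanishing h" and C: "C2 f g h"
    using f by (auto simp: C2_vanishing_def)
  obtain K where K: "C2_bounded K f g h" using C2_vanishing_bounded[OF f] .
  obtain W where W: "C2_bounded W (cutoff :: real^'a \<Rightarrow> real) cutoff_grad cutoff_hess"
    using C2_vanishing_bounded[OF C2_vanishing_cutoff] .
  have K0: "K \<ge> 0" "W \<ge> 0" using K W C2_bounded_nonneg by blast+
  have e2: "e / 2 > 0" using e by simp
  obtain R1 where R1: "R1 > 0" "\<And>r x. 0 < r \<Longrightarrow> r \<le> R1 \<Longrightarrow> norm ((1 - cutoff (r *\<^sub>R x)) *\<^sub>R f x) \<le> e/2"
    using vanishing_cutoff_approx[OF v(1) e2] by blast
  obtain R2 where R2: "R2 > 0" "\<And>r x. 0 < r \<Longrightarrow> r \<le> R2 \<Longrightarrow> norm ((1 - cutoff (r *\<^sub>R x)) *\<^sub>R g x) \<le> e/2"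
    using vanishing_cutoff_approx[OF v(2) e2] by blast
  obtain R3 where R3: "R3 > 0" "\<And>r x. 0 < r \<Longrightarrow> r \<le> R3 \<Longrightarrow> norm ((1 - cutoff (r *\<^sub>R x)) *\<^sub>R h x) \<le> e/2"
    using vanishing_cutoff_approx[OF v(3) e2] by blast
  \<comment> \<open>The Hessian has three extra Leibniz terms, each at most
    \<open>r * (K * W)\<close> once \<open>r \<le> 1\<close>. They share \<open>e / 2\<close>; the
    summand 1 keeps \<open>L\<close> positive.\<close>
  define L where "L = 3 * (K * W) + 1"
  have L: "L > 0" using K0 by (simp add: L_def add_nonneg_pos)
  define r where "r = Min {R1, R2, R3, 1, e / (2 * L)}"
  have r: "0 < r" "r \<le> R1" "r \<le> R2" "r \<le> R3" "r \<le> 1" "r \<le> e / (2 * L)"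
    unfolding r_def using R1 R2 R3 e L by auto
  have "r * L \<le> e / (2 * L) * L" using r L by (intro mult_right_mono) auto
  then have rL: "r * L \<le> e / 2" using L by simp
  have rKW: "r * (3 * (K * W)) \<le> e / 2" using rL r(1) by (simp add: L_def algebra_simps)
  have KW0: "0 \<le> r * (K * W)" using K0 r(1) by simp
  have fK: "\<And>x. \<bar>f x\<bar> \<le> K" "\<And>x. norm (g x) \<le> K" using K by (auto simp: C2_bounded_def)
  have W': "\<And>z::real^'a. norm (cutoff_grad z) \<le> W" "\<And>z::real^'a. norm (cutoff_hess z) \<le> W" using W by (auto simp: C2_bounded_def)
  show thesis
  proof (rule that[OF r(1)])
    show "C2_bounded e (\<lambda>x. f x - f x * cutoff (r *\<^sub>R x)) (\<lambda>x. g x - cut_grad r f g x) (\<lambda>x. h x - cut_hess r f g h x)"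
      unfolding C2_bounded_def
    proof (intro conjI allI)
      show "C2 (\<lambda>x. f x - f x * cutoff (r *\<^sub>R x)) (\<lambda>x. g x - cut_grad r f g x) (\<lambda>x. h x - cut_hess r f g h x)"
        using C2_diff[OF C] C2_vanishing_cut(1)[OF C r(1)] by (auto simp: C2_vanishing_def)
      fix x
      show "\<bar>f x - f x * cutoff (r *\<^sub>R x)\<bar> \<le> e"
        using R1(2)[OF r(1,2), of x] e by (simp add: algebra_simps)
      have 1: "norm (f x *\<^sub>R (r *\<^sub>R cutoff_grad (r *\<^sub>R x))) \<le> r * (K * W)"
        using mult_mono[OF fK(1)[of x] W'(1)[of "r *\<^sub>R x"]] K0 r(1)
        by (simp add: abs_mult mult_ac)
      have gx: "g x - cut_grad r f g x = (1 - cutoff (r *\<^sub>R x)) *\<^sub>R g x - f x *\<^sub>R (r *\<^sub>R cutoff_grad (r *\<^sub>R x))"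
        by (simp add: cut_grad_def scaleR_diff_left)
      have "norm (g x - cut_grad r f g x) \<le> e/2 + r * (K * W)"
        unfolding gx by (intro order_trans[OF norm_triangle_ineq4] add_mono R2(2)[OF r(1,3)] 1)
      then show "norm (g x - cut_grad r f g x) \<le> e" using rKW KW0 by linarith
      have 2: "norm (f x *\<^sub>R (r\<^sup>2 *\<^sub>R cutoff_hess (r *\<^sub>R x))) \<le> r * (K * W)"
      proof -
        have "norm (f x *\<^sub>R (r\<^sup>2 *\<^sub>R cutoff_hess (r *\<^sub>R x))) = r\<^sup>2 * (\<bar>f x\<bar> * norm (cutoff_hess (r *\<^sub>R x)))"
          by (simp add: abs_mult)
        also have "\<dots> \<le> r * (K * W)"
          using fK W' K0 r by (intro mult_mono) (auto simp: power2_eq_square mult_left_le)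
        finally show ?thesis .
      qed
      have 3: "norm (outer (r *\<^sub>R cutoff_grad (r *\<^sub>R x)) (g x)) \<le> r * (K * W)"
        "norm (outer (g x) (r *\<^sub>R cutoff_grad (r *\<^sub>R x))) \<le> r * (K * W)"
        using mult_mono[OF fK(2)[of x] W'(1)[of "r *\<^sub>R x"]] K0 r(1)
        by (simp_all add: norm_outer mult_ac)
      have "h x - cut_hess r f g h x = (1 - cutoff (r *\<^sub>R x)) *\<^sub>R h x - f x *\<^sub>R (r\<^sup>2 *\<^sub>R cutoff_hess (r *\<^sub>R x))
         - outer (r *\<^sub>R cutoff_grad (r *\<^sub>R x)) (g x) - outer (g x) (r *\<^sub>R cutoff_grad (r *\<^sub>R x))"
        by (simp add: cut_hess_def scaleR_diff_left)
      also have "norm \<dots> \<le> e/2 + r * (K * W) + r * (K * W) + r * (K * W)"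
        by (intro order_trans[OF norm_triangle_ineq4] add_mono R3(2)[OF r(1,4)] 2 3)
      finally show "norm (h x - cut_hess r f g h x) \<le> e" using rKW by linarith
    qed
  qed
qed

section \<open>Gaussian smoothing and mixtures\<close>

lemma vanishing_gauss_approx:
  fixes u :: "real^'n \<Rightarrow> 'b::{banach, second_countable_topology}"
  assumes u: "vanishing u" and e: "e > 0"
  obtains S where "S > 0" "\<And>s x. 0 < s \<Longrightarrow> s \<le> S \<Longrightarrow> norm ((\<integral>w. u (x + s *\<^sub>R w) \<partial>gauss) - u x) \<le> e"
proof -
  interpret G: prob_space "gauss :: (real^'n) measure" by (rule prob_space_gauss)
  obtain B where B: "B > 0" "\<And>x. norm (u x) \<le> B" using vanishing_bounded[OF u] by auto
  obtain d where d: "d > 0" "\<And>x y. norm (x - y) < d \<Longrightarrow> norm (u x - u y) < e / 2"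
    using vanishing_uniformly_continuous[OF u, of "e/2"] e by auto
  define I where "I = (\<integral>w. norm w \<partial>(gauss :: (real^'n) measure))"
  have I: "I \<ge> 0" by (simp add: I_def)
  have n_int: "integrable gauss (\<lambda>w::real^'n. norm w)"
  proof (rule gauss_moment_le[of _ 1])
    fix w :: "real^'n"
    have "norm w \<le> (1 + norm w) ^ 1" by simp
    also have "\<dots> \<le> (1 + norm w) ^ 3" by (rule power_increasing) auto
    finally show "norm (norm w) \<le> 1 * (1 + norm w) ^ 3" by simp
  qed auto
  have pt: "norm (u (x + v) - u x) \<le> e / 2 + 2 * B / d * norm v" for x v
  proof (cases "norm v < d")
    case True
    then have "norm (u (x + v) - u x) < e / 2" using d(2)[of "x + v" x] by simp
    moreover have "0 \<le> 2 * B / d * norm v" using B d by simp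
    ultimately show ?thesis by linarith
  next
    case False
    then have "2 * B / d * d \<le> 2 * B / d * norm v" using B d by (intro mult_left_mono) auto
    moreover have "norm (u (x + v) - u x) \<le> 2 * B"
      using norm_triangle_ineq4[of "u (x + v)" "u x"] B(2)[of x] B(2)[of "x + v"] by linarith
    ultimately show ?thesis using d e by simp
  qed
  show thesis
  \<comment> \<open>This threshold makes the integrated linear term at most \<open>e / 2\<close>,
    with \<open>I + 1\<close> in place of \<open>I\<close> to stay positive.\<close>
  proof (rule that[of "e * d / (4 * B * (I + 1))"])
    show "0 < e * d / (4 * B * (I + 1))" using e d B I by (simp add: add_nonneg_pos)
    fix s and x :: "real^'n" assume s: "0 < s" "s \<le> e * d / (4 * B * (I + 1))"
    have int: "integrable gauss (\<lambda>w. u (x + s *\<^sub>R w))"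
      by (rule G.integrable_vanishing_shift[OF u]) simp
    have "(\<integral>w. u (x + s *\<^sub>R w) \<partial>gauss) - u x = (\<integral>w. u (x + s *\<^sub>R w) - u x \<partial>gauss)"
      using int by (simp add: G.prob_space[unfolded space_gauss])
    also have "norm \<dots> \<le> (\<integral>w. e / 2 + 2 * B / d * s * norm w \<partial>(gauss :: (real^'n) measure))"
      using pt[of x "s *\<^sub>R _"] s(1) n_int int by (intro norm_integral_le) (auto simp: mult.assoc)
    also have "\<dots> = e / 2 + 2 * B / d * s * I"
      using n_int by (simp add: I_def G.prob_space[unfolded space_gauss])
    also have "2 * B / d * s * I \<le> 2 * B / d * (e * d / (4 * B * (I + 1))) * (I + 1)"
      using s B d I e by (intro mult_mono mult_left_mono mult_nonneg_nonneg) auto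
    also have "\<dots> = e / 2"
    proof -
      obtain J where J: "I + 1 = J" "J > 0" using I by auto
      show ?thesis unfolding J(1) using B d J(2) by (simp add: field_simps)
    qed
    finally show "norm ((\<integral>w. u (x + s *\<^sub>R w) \<partial>gauss) - u x) \<le> e" by simp
  qed
qed

lemma lborel_integral_rescale:
  fixes \<phi> :: "'a::euclidean_space \<Rightarrow> real"
  assumes "\<phi> \<in> borel_measurable borel" "s > 0"
  shows "(\<integral>z. \<phi> z \<partial>lborel) = s ^ DIM('a) * (\<integral>w. \<phi> (x + s *\<^sub>R w) \<partial>lborel)"
proof -
  have "(\<integral>z. \<phi> z \<partial>lborel) = (\<integral>z. \<phi> z \<partial>(density (distr lborel borel (\<lambda>w. x + s *\<^sub>R w)) (\<lambda>_. \<bar>s\<bar> ^ DIM('a))))"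
    using lborel_affine[of s x] assms(2) by simp
  also have "\<dots> = (\<integral>z. (s ^ DIM('a)) *\<^sub>R \<phi> z \<partial>(distr lborel borel (\<lambda>w. x + s *\<^sub>R w)))"
    using assms by (subst integral_density) auto
  also have "\<dots> = (\<integral>w. (s ^ DIM('a)) *\<^sub>R \<phi> (x + s *\<^sub>R w) \<partial>lborel)"
    using assms by (subst integral_distr) auto
  finally show ?thesis by simp
qed

text \<open>With the Gaussian density written as an average of cosines, the substitution
  \<open>z = x + s *\<^sub>R w\<close> turns the convolution into a double integral over
  \<open>z\<close> and a Gaussian \<open>k\<close> of \<open>c' * f z\<close> times the cosine of
  \<open>k \<bullet> (x - z)\<close> divided by \<open>s\<close>. Expanding the argument gives
  frequency \<open>k /\<^sub>R s\<close> and phase \<open>- (k \<bullet> z) / s\<close>.\<close>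

lemma gauss_convolution_is_mixture:
  fixes f :: "real^'n \<Rightarrow> real"
  assumes f: "integrable lborel f" and s: "s > 0"
  obtains \<kappa> :: "((real^'n) \<times> (real^'n)) measure" and F H \<Theta> where
    "trig_mixture \<kappa> F H \<Theta>" "(\<lambda>x. \<integral>w. f (x + s *\<^sub>R w) \<partial>gauss) = trig_mixture.mix \<kappa> F H \<Theta>"
proof -
  interpret G: prob_space "gauss :: (real^'n) measure" by (rule prob_space_gauss)
  interpret P: pair_sigma_finite "lborel :: (real^'n) measure" "gauss :: (real^'n) measure" by standard
  have fm[measurable]: "f \<in> borel_measurable borel" using borel_measurable_integrable[OF f] by simp
  obtain c where c: "\<And>f :: real^'n \<Rightarrow> real. f \<in> borel_measurable borel \<Longrightarrow>
    (\<integral>w. f w \<partial>gauss) = (\<integral>w. f w * (c * (\<integral>k. cos (k \<bullet> w) \<partial>gauss)) \<partial>lborel)"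
    using integral_gauss_eq_fourier by blast
  \<comment> \<open>The power of \<open>s\<close> is the Jacobian of the substitution.\<close>
  define c' where "c' = c / s ^ DIM(real^'n)"
  define \<kappa> where "\<kappa> = (lborel :: (real^'n) measure) \<Otimes>\<^sub>M (gauss :: (real^'n) measure)"
  define F where "F = (\<lambda>p :: (real^'n) \<times> (real^'n). c' * f (fst p))"
  define H where "H = (\<lambda>p :: (real^'n) \<times> (real^'n). snd p /\<^sub>R s)"
  define \<Theta> where "\<Theta> = (\<lambda>p :: (real^'n) \<times> (real^'n). - (snd p \<bullet> fst p) / s)"
  have Fm[measurable]: "F \<in> borel_measurable \<kappa>" and Hm[measurable]: "H \<in> borel_measurable \<kappa>"
    and \<Theta>m[measurable]: "\<Theta> \<in> borel_measurable \<kappa>"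
    unfolding F_def H_def \<Theta>_def \<kappa>_def by measurable
  have w_int: "integrable gauss (\<lambda>k::real^'n. (1 + norm (k /\<^sub>R s)) ^ 3)"
  proof (rule gauss_moment_le[of _ "(1 + 1 / s) ^ 3"])
    fix k :: "real^'n"
    have "1 + norm (k /\<^sub>R s) \<le> (1 + 1 / s) * (1 + norm k)" using s by (simp add: algebra_simps divide_inverse)
    then have "(1 + norm (k /\<^sub>R s)) ^ 3 \<le> ((1 + 1 / s) * (1 + norm k)) ^ 3" by (intro power_mono) auto
    then show "norm ((1 + norm (k /\<^sub>R s)) ^ 3) \<le> (1 + 1 / s) ^ 3 * (1 + norm k) ^ 3"
      by (simp add: power_mult_distrib)
  qed auto
  have "integrable \<kappa> (\<lambda>p. \<bar>F p\<bar> * (1 + norm (H p)) ^ 3)"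
    unfolding \<kappa>_def
  proof (rule P.Fubini_integrable)
    have "(\<lambda>z. \<integral>k. norm (\<bar>F (z, k)\<bar> * (1 + norm (H (z, k))) ^ 3) \<partial>gauss)
        = (\<lambda>z. (\<bar>c'\<bar> * (\<integral>k. (1 + norm (k /\<^sub>R s)) ^ 3 \<partial>(gauss :: (real^'n) measure))) * \<bar>f z\<bar>)"
      by (simp add: F_def H_def fun_eq_iff abs_mult mult_ac)
    then show "integrable lborel (\<lambda>z. \<integral>k. norm (\<bar>F (z, k)\<bar> * (1 + norm (H (z, k))) ^ 3) \<partial>gauss)"
      using f by simp
    have "integrable gauss (\<lambda>k. \<bar>F (z, k)\<bar> * (1 + norm (H (z, k))) ^ 3)" for z
      unfolding F_def H_def fst_conv snd_conv by (intro integrable_mult_right w_int)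
    then show "AE z in lborel. integrable gauss (\<lambda>k. \<bar>F (z, k)\<bar> * (1 + norm (H (z, k))) ^ 3)" by simp
    show "(\<lambda>p. \<bar>F p\<bar> * (1 + norm (H p)) ^ 3) \<in> borel_measurable (lborel \<Otimes>\<^sub>M gauss)"
      using Fm Hm unfolding \<kappa>_def by measurable
  qed
  moreover have "sigma_finite_measure \<kappa>" unfolding \<kappa>_def by (rule P.sigma_finite_measure_axioms)
  ultimately have T: "trig_mixture \<kappa> F H \<Theta>"
    by (simp add: trig_mixture_def trig_mixture_axioms_def)
  then interpret T: trig_mixture \<kappa> F H \<Theta> .
  have "(\<integral>w. f (x + s *\<^sub>R w) \<partial>gauss) = T.mix x" for x
  proof -
    let ?\<phi> = "\<lambda>z. f z * (c * (\<integral>k. cos (k \<bullet> ((z - x) /\<^sub>R s)) \<partial>gauss))"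
    have m: "?\<phi> \<in> borel_measurable borel" by measurable
    have "(\<integral>w. f (x + s *\<^sub>R w) \<partial>gauss) = (\<integral>w. ?\<phi> (x + s *\<^sub>R w) \<partial>lborel)"
      using c[of "\<lambda>w. f (x + s *\<^sub>R w)"] s by simp
    also have "\<dots> = (\<integral>z. ?\<phi> z \<partial>lborel) / s ^ DIM(real^'n)"
      using lborel_integral_rescale[OF m s, of x] s by simp
    also have "\<dots> = (\<integral>z. ?\<phi> z / s ^ DIM(real^'n) \<partial>lborel)" by simp
    also have "\<dots> = (\<integral>z. (\<integral>k. F (z, k) * cos (\<Theta> (z, k) + H (z, k) \<bullet> x) \<partial>gauss) \<partial>lborel)"
    proof (rule Bochner_Integration.integral_cong[OF refl])
      fix z
      have "cos (k \<bullet> ((z - x) /\<^sub>R s)) = cos (\<Theta> (z, k) + H (z, k) \<bullet> x)" for k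
      proof -
        have "\<Theta> (z, k) + H (z, k) \<bullet> x = - (k \<bullet> ((z - x) /\<^sub>R s))"
          by (simp add: \<Theta>_def H_def inner_diff_right field_simps)
        then show ?thesis by (simp only: cos_minus)
      qed
      then show "?\<phi> z / s ^ DIM(real^'n) = (\<integral>k. F (z, k) * cos (\<Theta> (z, k) + H (z, k) \<bullet> x) \<partial>gauss)"
        by (simp add: F_def c'_def)
    qed
    also have "\<dots> = (\<integral>p. F p * cos (\<Theta> p + H p \<bullet> x) \<partial>\<kappa>)"
      using P.integral_fst'[OF T.integrable_mix[of x, unfolded \<kappa>_def]] unfolding \<kappa>_def by simp
    finally show ?thesis unfolding T.mix_def .
  qed
  then show thesis using that[OF T] by blast
qed

text \<open>The cut comes first because the passage to a mixture asks for a Lebesgue integrable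
  function, which a member of C_0 need not be. Half of \<open>e\<close> pays for the cut and half
  for the smoothing.\<close>

lemma trig_mixture_approx:
  fixes f :: "real^'n \<Rightarrow> real"
  assumes f: "C2_vanishing f g h" and e: "e > 0"
  obtains \<kappa> :: "((real^'n) \<times> (real^'n)) measure" and F H \<Theta> where
    "trig_mixture \<kappa> F H \<Theta>"
    "C2_vanishing (trig_mixture.mix \<kappa> F H \<Theta>) (trig_mixture.mix_grad \<kappa> F H \<Theta>) (trig_mixture.mix_hess \<kappa> F H \<Theta>)"
    "C2_bounded e (\<lambda>x. f x - trig_mixture.mix \<kappa> F H \<Theta> x) (\<lambda>x. g x - trig_mixture.mix_grad \<kappa> F H \<Theta> x)
      (\<lambda>x. h x - trig_mixture.mix_hess \<kappa> F H \<Theta> x)"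
proof -
  interpret G: prob_space "gauss :: (real^'n) measure" by (rule prob_space_gauss)
  have e2: "e / 2 > 0" using e by simp
  obtain r where r: "r > 0" and B1: "C2_bounded (e/2) (\<lambda>x. f x - f x * cutoff (r *\<^sub>R x)) (\<lambda>x. g x - cut_grad r f g x) (\<lambda>x. h x - cut_hess r f g h x)"
    using C2_cut_approx[OF f e2] by blast
  have C: "C2 f g h" using f by (simp add: C2_vanishing_def)
  define u ug uh where "u = (\<lambda>x. f x * cutoff (r *\<^sub>R x))" and "ug = cut_grad r f g" and "uh = cut_hess r f g h"
  have u: "C2_vanishing u ug uh" and supp: "\<And>x. norm x \<ge> 1 / r \<Longrightarrow> u x = 0"
    using C2_vanishing_cut[OF C r] by (auto simp: u_def ug_def uh_def)
  then have v: "vanishing u" "vanishing ug" "vanishing uh" by (auto simp: C2_vanishing_def)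
  obtain S1 where S1: "S1 > 0" "\<And>s x. 0 < s \<Longrightarrow> s \<le> S1 \<Longrightarrow> norm ((\<integral>w. u (x + s *\<^sub>R w) \<partial>gauss) - u x) \<le> e/2"
    using vanishing_gauss_approx[OF v(1) e2] by blast
  obtain S2 where S2: "S2 > 0" "\<And>s x. 0 < s \<Longrightarrow> s \<le> S2 \<Longrightarrow> norm ((\<integral>w. ug (x + s *\<^sub>R w) \<partial>gauss) - ug x) \<le> e/2"
    using vanishing_gauss_approx[OF v(2) e2] by blast
  obtain S3 where S3: "S3 > 0" "\<And>s x. 0 < s \<Longrightarrow> s \<le> S3 \<Longrightarrow> norm ((\<integral>w. uh (x + s *\<^sub>R w) \<partial>gauss) - uh x) \<le> e/2"
    using vanishing_gauss_approx[OF v(3) e2] by blast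
  define s where "s = min S1 (min S2 S3)"
  have s: "s > 0" "s \<le> S1" "s \<le> S2" "s \<le> S3" using S1 S2 S3 by (auto simp: s_def)
  have "integrable lborel (\<lambda>x. indicator (cball 0 (1 / r)) x *\<^sub>R u x)"
    using v(1) by (intro borel_integrable_compact) (auto simp: vanishing_def intro: continuous_on_subset)
  moreover have "(\<lambda>x. indicator (cball 0 (1 / r)) x *\<^sub>R u x) = u"
    using supp by (auto simp: fun_eq_iff indicator_def)
  ultimately have "integrable lborel u" by simp
  then obtain \<kappa> :: "((real^'n) \<times> (real^'n)) measure" and F H \<Theta> where
    T: "trig_mixture \<kappa> F H \<Theta>" and mix: "(\<lambda>x. \<integral>w. u (x + s *\<^sub>R w) \<partial>gauss) = trig_mixture.mix \<kappa> F H \<Theta>"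
    by (rule gauss_convolution_is_mixture[OF _ s(1)])
  interpret T: trig_mixture \<kappa> F H \<Theta> by (rule T)
  have C': "C2_vanishing T.mix (\<lambda>x. \<integral>w. ug (x + s *\<^sub>R w) \<partial>gauss) (\<lambda>x. \<integral>w. uh (x + s *\<^sub>R w) \<partial>gauss)"
    unfolding mix[symmetric] by (rule G.C2_vanishing_shift_mean[OF u]) simp
  \<comment> \<open>The smoothed function is differentiated in two ways, by shifting and by
    frequencies. Uniqueness of derivatives transfers decay and closeness from the first form to the
    second.\<close>
  have gr: "T.mix_grad = (\<lambda>x. \<integral>w. ug (x + s *\<^sub>R w) \<partial>gauss)" and he: "T.mix_hess = (\<lambda>x. \<integral>w. uh (x + s *\<^sub>R w) \<partial>gauss)"
    using C2_vanishing_imp(2,3)[OF C'] T.grad_mix T.hess_mix by auto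
  have tri: "norm (a - c) \<le> e" if "norm (a - b) \<le> e/2" "norm (c - b) \<le> e/2" for a b c :: "'z::real_normed_vector"
    using norm_triangle_ineq4[of "a - b" "c - b"] that by simp
  show thesis
  proof (rule that[OF T])
    show CV: "C2_vanishing T.mix T.mix_grad T.mix_hess" using C' by (simp only: gr he)
    show "C2_bounded e (\<lambda>x. f x - T.mix x) (\<lambda>x. g x - T.mix_grad x) (\<lambda>x. h x - T.mix_hess x)"
      unfolding C2_bounded_def
    proof (intro conjI allI)
      show "C2 (\<lambda>x. f x - T.mix x) (\<lambda>x. g x - T.mix_grad x) (\<lambda>x. h x - T.mix_hess x)"
        using C2_diff[OF C] CV by (auto simp: C2_vanishing_def)
      fix x
      have b: "norm (f x - u x) \<le> e/2" "norm (g x - ug x) \<le> e/2" "norm (h x - uh x) \<le> e/2"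
        using B1 by (auto simp: C2_bounded_def u_def ug_def uh_def)
      have "norm (f x - T.mix x) \<le> e"
        unfolding mix[symmetric] by (rule tri[OF b(1) S1(2)[OF s(1,2)]])
      then show "\<bar>f x - T.mix x\<bar> \<le> e" by simp
      show "norm (g x - T.mix_grad x) \<le> e" unfolding gr by (rule tri[OF b(2) S2(2)[OF s(1,3)]])
      show "norm (h x - T.mix_hess x) \<le> e" unfolding he by (rule tri[OF b(3) S3(2)[OF s(1,4)]])
    qed
  qed
qed

section \<open>Density of the candidate core in C_0\<close>

lemma C2_real_polynomial_function:
  fixes q :: "real^'n \<Rightarrow> real"
  assumes "real_polynomial_function q" shows "\<exists>g h. C2 q g h"
  using assms
proof induction
  case (linear q)
  then have "linear q" by (rule bounded_linear.linear)
  then have e: "q = (\<lambda>v. adjoint q 1 \<bullet> v)"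
    using adjoint_works[of q _ 1] by (auto simp: fun_eq_iff inner_commute)
  have "(q has_derivative (\<lambda>v. adjoint q 1 \<bullet> v)) (at x)" for x
    using bounded_linear_imp_has_derivative[OF linear, of "at x"] e by simp
  then have "C2 q (\<lambda>_. adjoint q 1) (\<lambda>_. 0)" by (auto simp: C2_def)
  then show ?case by blast
next
  case (const c)
  have "C2 (\<lambda>x::real^'n. c) (\<lambda>_. 0) (\<lambda>_. 0)" by (simp add: C2_def)
  then show ?case by blast
next
  case (add f g) then show ?case using C2_add by blast
next
  case (mult f g) then show ?case using C2_mult by blast
qed

text \<open>A Stone-Weierstrass polynomial on a ball, multiplied by a cutoff supported in that ball.
  Compact support makes the drift term vanish at infinity at once.\<close>

lemma D0_dense:
  fixes f :: "real^'n \<Rightarrow> real"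
  assumes f: "vanishing f" and e: "e > 0"
  obtains p where "p \<in> D0 A" "\<And>x. \<bar>f x - p x\<bar> \<le> e"
proof -
  obtain r where r: "r > 0" "\<And>x. norm ((1 - cutoff (r *\<^sub>R x)) *\<^sub>R f x) \<le> e/2"
    using vanishing_cutoff_approx[OF f, of "e/2"] e by (metis half_gt_zero order_refl)
  have "continuous_on (cball 0 (1/r)) f" using f by (auto simp: vanishing_def intro: continuous_on_subset)
  then obtain q where q: "real_polynomial_function q" "\<And>x. x \<in> cball 0 (1/r) \<Longrightarrow> \<bar>f x - q x\<bar> < e/2"
    using Stone_Weierstrass_real_polynomial_function[of "cball 0 (1/r)" f "e/2"] e by auto
  obtain g h where C: "C2 q g h" using C2_real_polynomial_function[OF q(1)] by blast
  let ?p = "\<lambda>x. q x * cutoff (r *\<^sub>R x)"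
  have p: "C2_vanishing ?p (cut_grad r q g) (cut_hess r q g h)"
    and supp: "\<And>x. norm x \<ge> 1 / r \<Longrightarrow> ?p x = 0" "\<And>x. norm x \<ge> 1 / r \<Longrightarrow> cut_grad r q g x = 0"
    using C2_vanishing_cut[OF C r(1)] by auto
  have "continuous_on UNIV (cut_grad r q g)" using p by (simp add: C2_vanishing_def vanishing_def)
  moreover have "continuous_on UNIV (\<lambda>x. A *v x)" by (rule linear_continuous_on) simp
  ultimately have "vanishing (\<lambda>x. (A *v x) \<bullet> cut_grad r q g x)"
    using supp(2) by (intro vanishing_compact_support[of _ "1/r"] continuous_intros) auto
  then have "?p \<in> D0 A"
    using C2_vanishing_imp[OF p] by (simp add: D0_def C0_iff_vanishing)
  moreover have "\<bar>f x - ?p x\<bar> \<le> e" for x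
  proof -
    have "\<bar>(f x - q x) * cutoff (r *\<^sub>R x)\<bar> \<le> e/2"
    proof (cases "norm x \<le> 1 / r")
      case True
      then have "\<bar>f x - q x\<bar> * cutoff (r *\<^sub>R x) \<le> e/2 * 1"
        using q(2)[of x] cutoff_bounds e by (intro mult_mono) auto
      then show ?thesis by (simp add: abs_mult abs_of_nonneg[OF cutoff_bounds(1)])
    next
      case False
      then have "cutoff (r *\<^sub>R x) = 0" using r(1) by (intro cutoff_outside(1)) (simp add: field_simps)
      then show ?thesis using e by simp
    qed
    moreover have "f x - ?p x = (1 - cutoff (r *\<^sub>R x)) * f x + (f x - q x) * cutoff (r *\<^sub>R x)"
      by (simp add: algebra_simps)
    ultimately show ?thesis using r(2)[of x] by simp
  qed
  ultimately show thesis by (rule that)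
qed


section \<open>The characteristic function of the stochastic integral\<close>

lemma inner_matrix_vector_transpose: "h \<bullet> (G *v x) = (transpose G *v h) \<bullet> (x :: real^'n)"
  by (simp add: dot_lmul_matrix transpose_matrix_vector)

lemma bounded_linear_transpose: "bounded_linear (transpose :: real^'n^'m \<Rightarrow> real^'m^'n)"
  unfolding linear_conv_bounded_linear[symmetric] linear_iff by (simp add: transpose_def vec_eq_iff)

text \<open>The closed left half-plane is convex and the derivative of \<open>exp\<close> has
  modulus at most 1 on it.\<close>

lemma norm_exp_minus_one_le:
  assumes "Re z \<le> 0" shows "cmod (exp z - 1) \<le> cmod z"
proof -
  have "cmod (exp z - exp 0) \<le> 1 * cmod (z - 0)"
  proof (rule field_differentiable_bound[of "{w. Re w \<le> 0}" exp exp])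
    show "convex {w. Re w \<le> 0}" by (rule convex_halfspace_Re_le)
    show "(exp has_field_derivative exp w) (at w within {w. Re w \<le> 0})" for w :: complex
      by (rule DERIV_subset[OF DERIV_exp]) simp
  qed (use assms in auto)
  then show ?thesis by simp
qed

lemma norm_exp_second_order_le:
  assumes "Re z \<le> 0" shows "cmod (exp z - 1 - z) \<le> (cmod z)\<^sup>2"
proof -
  \<comment> \<open>Intersecting with the ball keeps \<open>cmod w \<le> cmod z\<close>, so the
    derivative \<open>exp w - 1\<close> is at most \<open>cmod z\<close> by the previous
    bound.\<close>
  let ?S = "{w. Re w \<le> 0} \<inter> cball 0 (cmod z)"
  have "cmod ((exp z - z) - (exp 0 - 0)) \<le> cmod z * cmod (z - 0)"
  proof (rule field_differentiable_bound[of ?S "\<lambda>w. exp w - w" "\<lambda>w. exp w - 1"])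
    show "convex ?S" by (intro convex_Int convex_halfspace_Re_le convex_cball)
    fix w :: complex assume w: "w \<in> ?S"
    show "((\<lambda>w. exp w - w) has_field_derivative exp w - 1) (at w within ?S)"
      by (auto intro!: derivative_eq_intros)
    show "cmod (exp w - 1) \<le> cmod z" using norm_exp_minus_one_le[of w] w by auto
  qed (use assms in auto)
  then show ?thesis by (simp add: power2_eq_square algebra_simps)
qed

lemma norm_cis_diff_le: "cmod (cis a - cis b) \<le> \<bar>a - b\<bar>"
proof -
  have "cis a - cis b = cis b * (cis (a - b) - 1)"
    by (simp add: cis_mult right_diff_distrib)
  then have "cmod (cis a - cis b) = cmod (cis (a - b) - 1)" by (simp add: norm_mult)
  also have "\<dots> = cmod (exp (\<i> * of_real (a - b)) - 1)" by (simp only: cis_conv_exp)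
  also have "\<dots> \<le> cmod (\<i> * of_real (a - b))" by (rule norm_exp_minus_one_le) simp
  also have "\<dots> = \<bar>a - b\<bar>" by (simp only: norm_mult norm_ii mult_1_left norm_of_real)
  finally show ?thesis .
qed

locale OU_driven = levy_process M Z for M :: "'w measure" and Z :: "real \<Rightarrow> 'w \<Rightarrow> real^'n" +
  fixes A Q :: "real^'n^'n" and a :: "real^'n" and \<nu> :: "(real^'n) measure" and Y :: "real \<Rightarrow> 'w \<Rightarrow> real^'n"
  assumes nu: "levy_measure \<nu>"
    and Z_exponent: "\<And>t u. t \<ge> 0 \<Longrightarrow>
      (\<integral> \<omega>. exp (\<i> * of_real (u \<bullet> Z t \<omega>)) \<partial>M) = exp (- of_real t * levy_exponent Q a \<nu> u)"
    and Y_integral: "\<And>t. t \<ge> 0 \<Longrightarrow>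
      has_stochastic_integral M Z (\<lambda>s. mexp ((t - s) *\<^sub>R A)) t (Y t)"
begin

abbreviation \<psi> where "\<psi> \<equiv> levy_exponent Q a \<nu>"

abbreviation E where "E t \<equiv> mexp (t *\<^sub>R A)"

abbreviation Et where "Et t \<equiv> transpose (mexp (t *\<^sub>R A))"

lemma Y_measurable: "t \<ge> 0 \<Longrightarrow> Y t \<in> borel_measurable M"
  using Y_integral by (simp add: has_stochastic_integral_def)

text \<open>Read off the process: the characteristic function of \<open>Z 1\<close> has modulus at
  most 1.\<close>

lemma Re_psi_nonneg: "0 \<le> Re (\<psi> u)"
proof -
  have "char_fun M (Z 1) u = exp (- \<psi> u)"
    using Z_exponent[of 1 u] by (simp add: char_fun_def cis_conv_exp)
  then have "exp (- Re (\<psi> u)) \<le> 1"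
    using norm_char_fun_le[of "Z 1" u] by simp
  then show ?thesis by simp
qed

lemma char_increment:
  assumes "0 \<le> s" "s \<le> t"
  shows "(\<integral>\<omega>. cis (u \<bullet> (Z t \<omega> - Z s \<omega>)) \<partial>M) = exp (- of_real (t - s) * \<psi> u)"
proof -
  have [measurable]: "Z t \<in> borel_measurable M" "Z s \<in> borel_measurable M" "Z (t - s) \<in> borel_measurable M"
    using assms by (auto intro: levy_measurable)
  have "(\<integral>\<omega>. cis (u \<bullet> (Z t \<omega> - Z s \<omega>)) \<partial>M) = (\<integral>x. cis (u \<bullet> x) \<partial>distr M borel (\<lambda>\<omega>. Z t \<omega> - Z s \<omega>))"
    by (subst integral_distr) auto
  also have "distr M borel (\<lambda>\<omega>. Z t \<omega> - Z s \<omega>) = distr M borel (Z (t - s))"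
    using levy_stationary_increments[of s "t - s"] assms by simp
  also have "(\<integral>x. cis (u \<bullet> x) \<partial>distr M borel (Z (t - s))) = (\<integral>\<omega>. cis (u \<bullet> Z (t - s) \<omega>) \<partial>M)"
    by (subst integral_distr) auto
  also have "\<dots> = exp (- of_real (t - s) * \<psi> u)"
    using Z_exponent[of "t - s" u] assms by (simp add: cis_conv_exp)
  finally show ?thesis .
qed

text \<open>Independence of the increments factorises the expectation; moving each matrix to the
  other side of the inner product evaluates the exponent at
  \<open>transpose (G i) *v h\<close>.\<close>

lemma char_riemann_sum:
  fixes \<tau> :: "nat \<Rightarrow> real" and G :: "nat \<Rightarrow> real^'n^'n"
  assumes "0 \<le> \<tau> 0" and mono: "\<And>i. i < n \<Longrightarrow> \<tau> i \<le> \<tau> (Suc i)"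
  shows "(\<integral>\<omega>. cis (h \<bullet> (\<Sum>i<n. G i *v (Z (\<tau> (Suc i)) \<omega> - Z (\<tau> i) \<omega>))) \<partial>M)
    = exp (- (\<Sum>i<n. of_real (\<tau> (Suc i) - \<tau> i) * \<psi> (transpose (G i) *v h)))"
proof -
  have nonneg: "0 \<le> \<tau> i" if "i \<le> n" for i
    using that by (induction i) (use assms in \<open>auto intro: order_trans\<close>)
  let ?D = "\<lambda>i \<omega>. Z (\<tau> (Suc i)) \<omega> - Z (\<tau> i) \<omega>"
  let ?X = "\<lambda>i \<omega>. cis ((transpose (G i) *v h) \<bullet> ?D i \<omega>)"
  have cis_sum: "cis (\<Sum>b\<in>S. f b) = (\<Prod>b\<in>S. cis (f b))" if "finite S" for f :: "nat \<Rightarrow> real" and S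
    using that by induction (auto simp: cis_mult[symmetric])
  have "indep_vars (\<lambda>_. borel) ?D {..<n}" by (rule levy_indep_increments) (use assms in auto)
  then have ind: "indep_vars (\<lambda>_. borel) ?X {..<n}"
    by (rule indep_vars_compose2) measurable
  have D_m: "?D i \<in> borel_measurable M" if "i < n" for i
    using that nonneg[of i] nonneg[of "Suc i"] by (intro borel_measurable_diff levy_measurable) auto
  have int: "integrable M (?X i)" if "i \<in> {..<n}" for i
  proof (rule integrable_const_bound[of _ 1])
    show "?X i \<in> borel_measurable M"
      using D_m[of i] that by (intro measurable_compose[OF _ measurable_cis] borel_measurable_inner) auto
  qed simp
  have "cis (h \<bullet> (\<Sum>i<n. G i *v ?D i \<omega>)) = (\<Prod>i<n. ?X i \<omega>)" for \<omega>
    by (simp add: inner_sum_right inner_matrix_vector_transpose cis_sum)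
  then have "(\<integral>\<omega>. cis (h \<bullet> (\<Sum>i<n. G i *v ?D i \<omega>)) \<partial>M) = (\<Prod>i<n. \<integral>\<omega>. ?X i \<omega> \<partial>M)"
    using indep_vars_lebesgue_integral[OF _ ind int] by simp
  also have "\<dots> = (\<Prod>i<n. exp (- (of_real (\<tau> (Suc i) - \<tau> i) * \<psi> (transpose (G i) *v h))))"
  proof (intro prod.cong refl)
    fix i assume "i \<in> {..<n}"
    then show "(\<integral>\<omega>. ?X i \<omega> \<partial>M) = exp (- (of_real (\<tau> (Suc i) - \<tau> i) * \<psi> (transpose (G i) *v h)))"
      using char_increment[of "\<tau> i" "\<tau> (Suc i)" "transpose (G i) *v h"] nonneg[of i] mono[of i] by (simp add: left_diff_distrib)
  qed
  finally show ?thesis by (simp only: exp_sum[OF finite_lessThan, symmetric] sum_negf)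
qed

text \<open>Convergence in probability gives convergence of characteristic functions. Stating it for
  all fine partitions allows both uniform partitions and partitions containing a prescribed
  time.\<close>

lemma char_fun_Y_approx:
  assumes t: "t \<ge> 0" and e: "e > 0"
  shows "\<exists>\<delta>>0. \<forall>n (\<tau> :: nat \<Rightarrow> real). \<tau> 0 = 0 \<longrightarrow> \<tau> n = t \<longrightarrow> (\<forall>i<n. \<tau> i \<le> \<tau> (Suc i) \<and> \<tau> (Suc i) - \<tau> i < \<delta>) \<longrightarrow>
     cmod (exp (- (\<Sum>i<n. of_real (\<tau> (Suc i) - \<tau> i) * \<psi> (Et (t - \<tau> i) *v h))) - char_fun M (Y t) h) < e"
proof -
  \<comment> \<open>Where the sum is close to \<open>Y t\<close> the error is at most
    \<open>norm h * \<epsilon>\<close>; the exceptional event adds at most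
    \<open>2 * \<epsilon>\<close>. The 3 makes the total strictly below \<open>e\<close>.\<close>
  define \<epsilon> where "\<epsilon> = e / (norm h + 3)"
  have n3: "norm h + 3 > 0" by (simp add: add_nonneg_pos)
  have \<epsilon>: "\<epsilon> > 0" using e n3 by (simp add: \<epsilon>_def)
  have "(norm h + 2) * \<epsilon> < (norm h + 3) * \<epsilon>" using \<epsilon> by (intro mult_strict_right_mono) auto
  also have "\<dots> = e" using n3 by (simp add: \<epsilon>_def)
  finally have e': "(norm h + 2) * \<epsilon> < e" .
  have [measurable]: "Y t \<in> borel_measurable M" by (rule Y_measurable[OF t])
  obtain \<delta> where \<delta>: "\<delta> > 0" "\<And>n (\<tau> :: nat \<Rightarrow> real). \<tau> 0 = 0 \<Longrightarrow> \<tau> n = t \<Longrightarrow>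
      (\<And>i. i < n \<Longrightarrow> \<tau> i \<le> \<tau> (Suc i) \<and> \<tau> (Suc i) - \<tau> i < \<delta>) \<Longrightarrow>
      prob {\<omega> \<in> space M. norm ((\<Sum>i<n. E (t - \<tau> i) *v (Z (\<tau> (Suc i)) \<omega> - Z (\<tau> i) \<omega>)) - Y t \<omega>) > \<epsilon>} < \<epsilon>"
    using Y_integral[OF t] \<epsilon> unfolding has_stochastic_integral_def by blast
  show ?thesis
  proof (intro exI[of _ \<delta>] conjI allI impI \<delta>(1))
    fix n and \<tau> :: "nat \<Rightarrow> real"
    assume \<tau>0: "\<tau> 0 = 0" "\<tau> n = t" "\<forall>i<n. \<tau> i \<le> \<tau> (Suc i) \<and> \<tau> (Suc i) - \<tau> i < \<delta>"
    then have \<tau>: "\<tau> 0 = 0" "\<tau> n = t" "\<And>i. i < n \<Longrightarrow> \<tau> i \<le> \<tau> (Suc i) \<and> \<tau> (Suc i) - \<tau> i < \<delta>" by blast+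
    have nonneg: "0 \<le> \<tau> i" if "i \<le> n" for i
      using that by (induction i) (use \<tau> in \<open>auto intro: order_trans\<close>)
    define S where "S = (\<lambda>\<omega>. \<Sum>i<n. E (t - \<tau> i) *v (Z (\<tau> (Suc i)) \<omega> - Z (\<tau> i) \<omega>))"
    have mv: "(\<lambda>x. G *v x) \<in> borel_measurable borel" for G :: "real^'n^'n"
      by (intro borel_measurable_continuous_onI linear_continuous_on) simp
    have S_m[measurable]: "S \<in> borel_measurable M"
      unfolding S_def using nonneg
      by (intro borel_measurable_sum measurable_compose[OF _ mv] borel_measurable_diff levy_measurable) auto
    let ?B = "{\<omega> \<in> space M. norm (S \<omega> - Y t \<omega>) > \<epsilon>}"
    have P: "prob ?B < \<epsilon>" unfolding S_def by (rule \<delta>(2)) (use \<tau> in auto)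
    have B_m[measurable]: "?B \<in> sets M" by measurable
    have pt: "cmod (cis (h \<bullet> S \<omega>) - cis (h \<bullet> Y t \<omega>)) \<le> norm h * \<epsilon> + 2 * indicator ?B \<omega>" if "\<omega> \<in> space M" for \<omega>
    proof (cases "\<omega> \<in> ?B")
      case True
      have "cmod (cis (h \<bullet> S \<omega>) - cis (h \<bullet> Y t \<omega>)) \<le> 2"
        using norm_triangle_ineq4[of "cis (h \<bullet> S \<omega>)" "cis (h \<bullet> Y t \<omega>)"] by simp
      moreover have "0 \<le> norm h * \<epsilon>" using \<epsilon> by simp
      ultimately show ?thesis using True by simp
    next
      case False
      have "cmod (cis (h \<bullet> S \<omega>) - cis (h \<bullet> Y t \<omega>)) \<le> \<bar>h \<bullet> (S \<omega> - Y t \<omega>)\<bar>"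
        using norm_cis_diff_le by (simp add: inner_diff_right)
      also have "\<dots> \<le> norm h * norm (S \<omega> - Y t \<omega>)" by (rule Cauchy_Schwarz_ineq2)
      also have "\<dots> \<le> norm h * \<epsilon>" using False that by (intro mult_left_mono) auto
      finally show ?thesis using False by simp
    qed
    have i1: "integrable M (\<lambda>\<omega>. cis (h \<bullet> S \<omega>))" "integrable M (\<lambda>\<omega>. cis (h \<bullet> Y t \<omega>))"
      by (auto intro!: integrable_const_bound[of _ 1])
    have i2: "integrable M (\<lambda>\<omega>. norm h * \<epsilon> + 2 * indicator ?B \<omega> :: real)"
      using B_m by (intro Bochner_Integration.integrable_add integrable_mult_right integrable_const integrable_real_indicator)
        (auto simp: emeasure_eq_measure)
    have "cmod (char_fun M S h - char_fun M (Y t) h) = cmod (\<integral>\<omega>. cis (h \<bullet> S \<omega>) - cis (h \<bullet> Y t \<omega>) \<partial>M)"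
      unfolding char_fun_def using i1 by simp
    also have "\<dots> \<le> (\<integral>\<omega>. norm h * \<epsilon> + 2 * indicator ?B \<omega> \<partial>M)"
      using i1 i2 pt by (intro norm_integral_le) auto
    also have "\<dots> = norm h * \<epsilon> + 2 * prob ?B"
    proof -
      have "integrable M (indicat_real ?B)" using B_m by (simp add: emeasure_eq_measure)
      moreover have "?B \<inter> space M = ?B" by auto
      ultimately show ?thesis by (simp add: prob_space del: integrable_indicator_iff)
    qed
    also have "\<dots> \<le> (norm h + 2) * \<epsilon>" using P by (simp add: algebra_simps)
    also note e'
    finally have "cmod (char_fun M S h - char_fun M (Y t) h) < e" .
    moreover have "char_fun M S h = exp (- (\<Sum>i<n. of_real (\<tau> (Suc i) - \<tau> i) * \<psi> (Et (t - \<tau> i) *v h)))"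
      unfolding char_fun_def S_def by (rule char_riemann_sum) (use \<tau> in auto)
    ultimately show "cmod (exp (- (\<Sum>i<n. of_real (\<tau> (Suc i) - \<tau> i) * \<psi> (Et (t - \<tau> i) *v h))) - char_fun M (Y t) h) < e"
      by simp
  qed
qed

text \<open>Riemann sums of the time integral of \<open>\<psi> (Et r *v h)\<close> over
  \<open>[0, t]\<close>, with \<open>r\<close> running backwards from \<open>t\<close>. The proof
  uses only these sums, not the integral: the bounds needed are uniform in \<open>n\<close> and pass
  to the limit.\<close>

definition riemann :: "real \<Rightarrow> real^'n \<Rightarrow> nat \<Rightarrow> complex" where
  "riemann t h n = (\<Sum>i<n. of_real (t / real n) * \<psi> (Et (t - real i * (t / real n)) *v h))"

lemma riemann_limit:
  assumes t: "t \<ge> 0"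
  shows "(\<lambda>n. exp (- riemann t h n)) \<longlonglongrightarrow> char_fun M (Y t) h"
proof (rule LIMSEQ_I)
  fix e :: real assume "e > 0"
  obtain \<delta> where \<delta>: "\<delta> > 0" "\<And>n (\<tau> :: nat \<Rightarrow> real). \<tau> 0 = 0 \<Longrightarrow> \<tau> n = t \<Longrightarrow> (\<And>i. i < n \<Longrightarrow> \<tau> i \<le> \<tau> (Suc i) \<and> \<tau> (Suc i) - \<tau> i < \<delta>) \<Longrightarrow>
     cmod (exp (- (\<Sum>i<n. of_real (\<tau> (Suc i) - \<tau> i) * \<psi> (Et (t - \<tau> i) *v h))) - char_fun M (Y t) h) < e"
    using char_fun_Y_approx[OF t \<open>e > 0\<close>, of h] by blast
  obtain N where N: "t / \<delta> < real N" using reals_Archimedean2 by blast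
  show "\<exists>N. \<forall>n\<ge>N. norm (exp (- riemann t h n) - char_fun M (Y t) h) < e"
  \<comment> \<open>\<open>Suc N\<close> excludes \<open>n = 0\<close>, where the uniform partition
    is degenerate.\<close>
  proof (intro exI[of _ "Suc N"] allI impI)
    fix n assume n: "n \<ge> Suc N"
    then have n0: "real n > 0" "t / \<delta> < real n" using N by auto
    have step: "real (Suc i) * x - real i * x = x" for i and x :: real by (simp add: algebra_simps)
    have "t / n < \<delta>" using n0 \<delta>(1) by (simp add: field_simps)
    have "cmod (exp (- (\<Sum>i<n. of_real (real (Suc i) * (t / n) - real i * (t / n)) * \<psi> (Et (t - real i * (t / n)) *v h))) - char_fun M (Y t) h) < e"
    proof (rule \<delta>(2)[of "\<lambda>i. real i * (t / n)"])
      fix i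
      have "0 \<le> t / n" using t by simp
      then show "real i * (t / n) \<le> real (Suc i) * (t / n) \<and> real (Suc i) * (t / n) - real i * (t / n) < \<delta>"
        using step[of i "t / n"] \<open>t / n < \<delta>\<close> by linarith
    qed (use n0 in auto)
    then show "norm (exp (- riemann t h n) - char_fun M (Y t) h) < e"
      unfolding step riemann_def .
  qed
qed

text \<open>The partition has a node at \<open>s\<close>. Before it, the flow over the remaining
  time factors through the flow over time \<open>t\<close>, which replaces \<open>h\<close> by
  \<open>Et t *v h\<close>; after it, the sums are those for the interval
  \<open>[0, t]\<close>.\<close>

lemma riemann_split_limit:
  assumes s: "s \<ge> 0" and t: "t \<ge> 0"
  shows "(\<lambda>n. exp (- (riemann s (Et t *v h) n + riemann t h n))) \<longlonglongrightarrow> char_fun M (Y (s + t)) h"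
proof (rule LIMSEQ_I)
  fix e :: real assume "e > 0"
  have st: "s + t \<ge> 0" using s t by simp
  obtain \<delta> where \<delta>: "\<delta> > 0" "\<And>n (\<tau> :: nat \<Rightarrow> real). \<tau> 0 = 0 \<Longrightarrow> \<tau> n = s + t \<Longrightarrow> (\<And>i. i < n \<Longrightarrow> \<tau> i \<le> \<tau> (Suc i) \<and> \<tau> (Suc i) - \<tau> i < \<delta>) \<Longrightarrow>
     cmod (exp (- (\<Sum>i<n. of_real (\<tau> (Suc i) - \<tau> i) * \<psi> (Et (s + t - \<tau> i) *v h))) - char_fun M (Y (s + t)) h) < e"
    using char_fun_Y_approx[OF st \<open>e > 0\<close>, of h] by blast
  obtain N where N: "(s + t) / \<delta> < real N" using reals_Archimedean2 by blast
  show "\<exists>N. \<forall>n\<ge>N. norm (exp (- (riemann s (Et t *v h) n + riemann t h n)) - char_fun M (Y (s + t)) h) < e"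
  proof (intro exI[of _ "Suc N"] allI impI)
    fix n assume n: "n \<ge> Suc N"
    then have n0: "real n > 0" "(s + t) / \<delta> < real n" using N by auto
    \<comment> \<open>\<open>n\<close> equal steps covering \<open>[0, s]\<close>, then
      \<open>n\<close> equal steps of length \<open>t / n\<close>, so the partition has
      \<open>n + n\<close> steps.\<close>
    define \<tau> where "\<tau> = (\<lambda>i. if i \<le> n then real i * (s / n) else s + real (i - n) * (t / n))"
    have lt: "s / n < \<delta>" "t / n < \<delta>" using n0 \<delta>(1) s t by (auto simp: field_simps)
    have ns: "real n * (s / n) = s" using n0 by simp
    have \<tau>1: "\<tau> i = real i * (s / n)" if "i \<le> n" for i using that by (simp add: \<tau>_def)
    have \<tau>2: "\<tau> (n + j) = s + real j * (t / n)" for j using ns by (cases j) (auto simp: \<tau>_def)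
    have step: "real (Suc i) * x - real i * x = x" for i and x :: real by (simp add: algebra_simps)
    have st1: "\<tau> (Suc i) - \<tau> i = s / n" if "i < n" for i
      using that step[of i "s / n"] by (simp add: \<tau>1 del: of_nat_Suc)
    have st2: "\<tau> (Suc (n + j)) - \<tau> (n + j) = t / n" for j
      using \<tau>2[of j] \<tau>2[of "Suc j"] step[of j "t / n"] by (simp del: of_nat_Suc)
    have "cmod (exp (- (\<Sum>i<n + n. of_real (\<tau> (Suc i) - \<tau> i) * \<psi> (Et (s + t - \<tau> i) *v h))) - char_fun M (Y (s + t)) h) < e"
    proof (rule \<delta>(2))
      show "\<tau> 0 = 0" by (simp add: \<tau>_def)
      show "\<tau> (n + n) = s + t" using \<tau>2[of n] n0 by simp
      fix i assume i: "i < n + n"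
      have "\<tau> (Suc i) - \<tau> i = s / n \<or> \<tau> (Suc i) - \<tau> i = t / n"
      proof (cases "i < n")
        case False
        then obtain j where "i = n + j" by (metis le_add_diff_inverse not_less)
        then show ?thesis using st2 by simp
      qed (use st1 in auto)
      moreover have "0 \<le> s / n" "0 \<le> t / n" using s t by auto
      ultimately show "\<tau> i \<le> \<tau> (Suc i) \<and> \<tau> (Suc i) - \<tau> i < \<delta>" using lt by linarith
    qed
    moreover have "(\<Sum>i<n + n. of_real (\<tau> (Suc i) - \<tau> i) * \<psi> (Et (s + t - \<tau> i) *v h))
        = riemann s (Et t *v h) n + riemann t h n"
    proof -
      have split: "(\<Sum>i<n + m. f i) = (\<Sum>i<n. f i) + (\<Sum>j<m. f (n + j))" for f :: "nat \<Rightarrow> complex" and m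
        by (induction m) (auto simp: add.assoc)
      have "Et (s + t - \<tau> i) *v h = Et (s - real i * (s / n)) *v (Et t *v h)" if "i < n" for i
      proof -
        have "s + t - \<tau> i = t + (s - real i * (s / n))" using that by (simp add: \<tau>1)
        then have "E (s + t - \<tau> i) = E t ** E (s - real i * (s / n))" by (simp only: mexp_add)
        then show ?thesis by (simp only: matrix_transpose_mul matrix_vector_mul_assoc)
      qed
      then have "(\<Sum>i<n. of_real (\<tau> (Suc i) - \<tau> i) * \<psi> (Et (s + t - \<tau> i) *v h)) = riemann s (Et t *v h) n"
        unfolding riemann_def by (intro sum.cong) (auto simp: st1)
      moreover have "(\<Sum>j<n. of_real (\<tau> (Suc (n + j)) - \<tau> (n + j)) * \<psi> (Et (s + t - \<tau> (n + j)) *v h)) = riemann t h n"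
        unfolding riemann_def st2 by (simp add: \<tau>2)
      ultimately show ?thesis unfolding split by simp
    qed
    ultimately show "norm (exp (- (riemann s (Et t *v h) n + riemann t h n)) - char_fun M (Y (s + t)) h) < e"
      by simp
  qed
qed

text \<open>This is, in terms of characteristic functions, the statement that
  \<open>Y (s + t)\<close> has the law of \<open>E t *v Y s\<close> plus an independent copy of
  \<open>Y t\<close>.\<close>

lemma char_fun_Y_cocycle:
  assumes "s \<ge> 0" "t \<ge> 0"
  shows "char_fun M (Y (s + t)) h = char_fun M (Y s) (Et t *v h) * char_fun M (Y t) h"
proof -
  have "(\<lambda>n. exp (- riemann s (Et t *v h) n) * exp (- riemann t h n)) \<longlonglongrightarrow> char_fun M (Y s) (Et t *v h) * char_fun M (Y t) h"
    by (intro tendsto_mult riemann_limit assms)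
  then have "(\<lambda>n. exp (- (riemann s (Et t *v h) n + riemann t h n))) \<longlonglongrightarrow> char_fun M (Y s) (Et t *v h) * char_fun M (Y t) h"
    by (simp add: exp_add[symmetric])
  then show ?thesis using riemann_split_limit[OF assms, of h] LIMSEQ_unique by blast
qed

section \<open>Small-time behaviour of the characteristic function\<close>

lemma Re_riemann_nonneg: "t \<ge> 0 \<Longrightarrow> 0 \<le> Re (riemann t h n)"
  unfolding riemann_def by (auto intro!: sum_nonneg divide_nonneg_nonneg mult_nonneg_nonneg Re_psi_nonneg)

text \<open>Used with \<open>c = 0\<close> for the size of the sums and with
  \<open>c = \<psi> h\<close> for their first-order behaviour as \<open>t\<close> tends to
  0.\<close>

lemma norm_riemann_diff_le:
  assumes t: "t \<ge> 0" and b: "\<And>r. 0 \<le> r \<Longrightarrow> r \<le> t \<Longrightarrow> cmod (\<psi> (Et r *v h) - c) \<le> b" and n: "n > 0"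
  shows "cmod (riemann t h n - of_real t * c) \<le> t * b"
proof -
  have "of_real t * c = (\<Sum>i<n. of_real (t / real n) * c)" using n by simp
  then have "riemann t h n - of_real t * c = (\<Sum>i<n. of_real (t / real n) * (\<psi> (Et (t - real i * (t / real n)) *v h) - c))"
    by (simp only: riemann_def right_diff_distrib sum_subtractf)
  also have "cmod \<dots> \<le> (\<Sum>i<n. t / n * b)"
  proof (rule order_trans[OF norm_sum sum_mono])
    fix i assume i: "i \<in> {..<n}"
    have "real i * (t / n) \<le> real n * (t / n)" using i t by (intro mult_right_mono) auto
    then have "cmod (\<psi> (Et (t - real i * (t / real n)) *v h) - c) \<le> b"
      using n t by (intro b) auto
    then have "\<bar>t / real n\<bar> * cmod (\<psi> (Et (t - real i * (t / real n)) *v h) - c) \<le> t / n * b"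
      using t by (intro mult_mono) auto
    then show "cmod (of_real (t / real n) * (\<psi> (Et (t - real i * (t / real n)) *v h) - c)) \<le> t / n * b"
      by (simp only: norm_mult norm_of_real)
  qed
  also have "\<dots> = t * b" using n by simp
  finally show ?thesis .
qed

lemma Et_bounded: obtains B where "B \<ge> 1" "\<And>r. 0 \<le> r \<Longrightarrow> r \<le> 1 \<Longrightarrow> norm (Et r) \<le> B"
proof -
  have "continuous_on {0..1} Et"
    by (intro continuous_at_imp_continuous_on ballI isCont_o2[OF continuous_mexp] bounded_linear.isCont[OF bounded_linear_transpose] continuous_ident)
  then have "bounded (Et ` {0..1})" by (intro compact_imp_bounded compact_continuous_image) auto
  then obtain B where "\<And>r. 0 \<le> r \<Longrightarrow> r \<le> 1 \<Longrightarrow> norm (Et r) \<le> B"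
    unfolding bounded_iff by (metis atLeastAtMost_iff imageI)
  then show thesis by (intro that[of "max 1 B"]) (auto simp: le_max_iff_disj)
qed

lemma psi_Et_bound:
  obtains C where "C > 0" "\<And>r h. 0 \<le> r \<Longrightarrow> r \<le> 1 \<Longrightarrow> cmod (\<psi> (Et r *v h)) \<le> C * (1 + norm h)\<^sup>2"
proof -
  obtain C where C: "C > 0" "\<And>u. cmod (\<psi> u) \<le> C * (1 + norm u)\<^sup>2" using levy_exponent_bound[OF nu] by blast
  obtain B where B: "B \<ge> 1" "\<And>r. 0 \<le> r \<Longrightarrow> r \<le> 1 \<Longrightarrow> norm (Et r) \<le> B" using Et_bounded by blast
  show thesis
  proof (rule that[of "C * B\<^sup>2"])
    show "C * B\<^sup>2 > 0" using C B by simp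
    fix r h assume r: "0 \<le> r" "r \<le> (1::real)"
    have "norm (Et r *v h) \<le> B * norm h"
      using norm_matrix_vector_le[of "Et r" h] mult_right_mono[OF B(2)[OF r], of "norm h"] by simp
    then have "1 + norm (Et r *v h) \<le> B * (1 + norm h)" using B(1) by (simp add: algebra_simps)
    then have "(1 + norm (Et r *v h))\<^sup>2 \<le> (B * (1 + norm h))\<^sup>2" by (intro power_mono) auto
    then have "C * (1 + norm (Et r *v h))\<^sup>2 \<le> C * (B * (1 + norm h))\<^sup>2" using C by (intro mult_left_mono) auto
    then show "cmod (\<psi> (Et r *v h)) \<le> C * B\<^sup>2 * (1 + norm h)\<^sup>2"
      using C(2)[of "Et r *v h"] by (simp add: power_mult_distrib mult.assoc)
  qed
qed

text \<open>For \<open>t \<le> 1\<close> the bound holds for every Riemann sum and passes to the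
  limit. For larger \<open>t\<close> the trivial bound 2 suffices, hence the maximum with 2. This
  linear rate in \<open>t\<close> underlies the moment bounds.\<close>

lemma char_fun_Y_bound:
  obtains C where "C > 0" "\<And>t u. t \<ge> 0 \<Longrightarrow> cmod (char_fun M (Y t) u - 1) \<le> C * t * (1 + norm u)\<^sup>2"
proof -
  obtain C where C: "C > 0" "\<And>r h. 0 \<le> r \<Longrightarrow> r \<le> 1 \<Longrightarrow> cmod (\<psi> (Et r *v h)) \<le> C * (1 + norm h)\<^sup>2"
    using psi_Et_bound by blast
  show thesis
  proof (rule that[of "max C 2"])
    fix t :: real and u :: "real^'n" assume t: "t \<ge> 0"
    let ?w = "(1 + norm u)\<^sup>2"
    have w: "1 \<le> ?w" by (simp add: one_le_power)
    have mono: "c * t * ?w \<le> max C 2 * t * ?w" if "c \<le> max C 2" for c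
      using that t by (intro mult_right_mono) auto
    show "cmod (char_fun M (Y t) u - 1) \<le> max C 2 * t * ?w"
    proof (cases "t \<le> 1")
      case True
      have "cmod (char_fun M (Y t) u - 1) \<le> t * (C * ?w)"
      proof (rule Lim_bounded)
        show "(\<lambda>n. cmod (exp (- riemann t u n) - 1)) \<longlonglongrightarrow> cmod (char_fun M (Y t) u - 1)"
          by (intro tendsto_intros riemann_limit t)
        show "\<forall>n\<ge>1. cmod (exp (- riemann t u n) - 1) \<le> t * (C * ?w)"
        proof (intro allI impI)
          fix n :: nat assume n: "n \<ge> 1"
          have "cmod (exp (- riemann t u n) - 1) \<le> cmod (- riemann t u n)"
            using Re_riemann_nonneg[OF t] by (intro norm_exp_minus_one_le) simp
          also have "\<dots> \<le> t * (C * ?w)"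
            using norm_riemann_diff_le[OF t, of u 0 "C * ?w" n] C(2) True n by simp
          finally show "cmod (exp (- riemann t u n) - 1) \<le> t * (C * ?w)" .
        qed
      qed
      then show ?thesis using mono[of C] by (simp add: mult_ac)
    next
      case False
      have "cmod (char_fun M (Y t) u - 1) \<le> 2"
        using norm_triangle_ineq4[of "char_fun M (Y t) u" 1] norm_char_fun_le[of "Y t" u] by simp
      also have "\<dots> \<le> 2 * t * ?w" using False w mult_mono[of 1 t 1 ?w] by simp
      finally show ?thesis using mono[of 2] by simp
    qed
  qed (use C in auto)
qed

text \<open>Writing \<open>R\<close> for a Riemann sum, \<open>exp (- R)\<close> is
  \<open>1 - R\<close> up to the square of \<open>cmod R\<close>, and \<open>R\<close> is
  \<open>t * \<psi> u\<close> up to a small multiple of \<open>t\<close> by continuity of the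
  exponent along the flow. Both errors are uniform in the number of steps.\<close>

lemma char_fun_Y_derivative:
  "((\<lambda>t. (char_fun M (Y t) u - 1) / of_real t) \<longlongrightarrow> - \<psi> u) (at_right 0)"
proof (rule tendstoI)
  fix e :: real assume e: "e > 0"
  obtain C where C: "C > 0" "\<And>r h. 0 \<le> r \<Longrightarrow> r \<le> 1 \<Longrightarrow> cmod (\<psi> (Et r *v h)) \<le> C * (1 + norm h)\<^sup>2"
    using psi_Et_bound by blast
  define K where "K = C * (1 + norm u)\<^sup>2"
  have "1 + norm u > 0" by (simp add: add_pos_nonneg)
  then have K: "K > 0" using C(1) by (simp add: K_def)
  have "isCont (\<lambda>r. \<psi> (Et r *v u)) 0"
  proof (rule isCont_o2[where f = "\<lambda>r. Et r *v u" and g = \<psi>])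
    show "isCont (\<lambda>r. Et r *v u) 0"
      by (intro isCont_o2[OF continuous_mexp] bounded_linear.isCont[OF bounded_linear_transpose]
         bounded_linear.isCont[OF bounded_linear_matrix_vector_left] continuous_ident)
    show "isCont \<psi> (Et 0 *v u)"
      using levy_exponent_continuous[OF nu] by (simp add: continuous_on_eq_continuous_at)
  qed
  then obtain d where d: "d > 0" "\<And>r. \<bar>r\<bar> < d \<Longrightarrow> cmod (\<psi> (Et r *v u) - \<psi> (Et 0 *v u)) < e / 4"
    using e unfolding continuous_at_eps_delta
    by (metis diff_zero dist_norm real_norm_def zero_less_divide_iff zero_less_numeral)
  have E0: "Et 0 *v u = u" by (simp add: mexp_0)
  show "\<forall>\<^sub>F t in at_right 0. dist ((char_fun M (Y t) u - 1) / of_real t) (- \<psi> u) < e"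
    unfolding eventually_at_right_field
  \<comment> \<open>The bound by \<open>e / (4 * K\<^sup>2)\<close> makes the quadratic error
    \<open>(t * K)\<^sup>2\<close> at most \<open>t * (e / 4)\<close>.\<close>
  proof (intro exI[of _ "min (min d 1) (e / (4 * K\<^sup>2))"] conjI allI impI)
    show "0 < min (min d 1) (e / (4 * K\<^sup>2))" using d e K by simp
    fix t :: real assume t: "0 < t" "t < min (min d 1) (e / (4 * K\<^sup>2))"
    have "cmod (char_fun M (Y t) u - 1 + of_real t * \<psi> u) \<le> t * (e / 2)"
    proof (rule Lim_bounded)
      show "(\<lambda>n. cmod (exp (- riemann t u n) - 1 + of_real t * \<psi> u)) \<longlonglongrightarrow> cmod (char_fun M (Y t) u - 1 + of_real t * \<psi> u)"
        using t by (intro tendsto_intros riemann_limit) auto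
      show "\<forall>n\<ge>1. cmod (exp (- riemann t u n) - 1 + of_real t * \<psi> u) \<le> t * (e / 2)"
      proof (intro allI impI)
        fix n :: nat assume n: "n \<ge> 1"
        let ?R = "riemann t u n"
        have "cmod ?R \<le> t * K"
          using norm_riemann_diff_le[of t u 0 K n] C(2) t n by (simp add: K_def)
        then have "(cmod (- ?R))\<^sup>2 \<le> (t * K)\<^sup>2" by (intro power_mono) auto
        moreover have "cmod (exp (- ?R) - 1 - (- ?R)) \<le> (cmod (- ?R))\<^sup>2"
          using Re_riemann_nonneg[of t u n] t by (intro norm_exp_second_order_le) simp
        moreover have "(t * K)\<^sup>2 \<le> t * (e / 4)"
        proof -
          have "t * K\<^sup>2 \<le> e / (4 * K\<^sup>2) * K\<^sup>2" using t by (intro mult_right_mono) auto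
          also have "\<dots> = e / 4" using K by simp
          finally have "t * (t * K\<^sup>2) \<le> t * (e / 4)" using t by (intro mult_left_mono) auto
          then show ?thesis by (simp add: power2_eq_square mult_ac)
        qed
        moreover have "cmod (?R - of_real t * \<psi> u) \<le> t * (e / 4)"
        proof (rule norm_riemann_diff_le)
          fix r assume "0 \<le> r" "r \<le> t"
          then show "cmod (\<psi> (Et r *v u) - \<psi> u) \<le> e / 4"
            using d(2)[of r] t unfolding E0 by auto
        qed (use t n in auto)
        moreover have "cmod (exp (- ?R) - 1 + of_real t * \<psi> u) \<le> cmod (exp (- ?R) - 1 - (- ?R)) + cmod (?R - of_real t * \<psi> u)"
        proof -
          have "exp (- ?R) - 1 + of_real t * \<psi> u = (exp (- ?R) - 1 - (- ?R)) - (?R - of_real t * \<psi> u)" by simp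
          then show ?thesis by (simp only: norm_triangle_ineq4)
        qed
        ultimately show "cmod (exp (- ?R) - 1 + of_real t * \<psi> u) \<le> t * (e / 2)" by linarith
      qed
    qed
    moreover have "(char_fun M (Y t) u - 1) / of_real t - (- \<psi> u) = (char_fun M (Y t) u - 1 + of_real t * \<psi> u) / of_real t"
      using t by (simp add: field_simps)
    ultimately have "dist ((char_fun M (Y t) u - 1) / of_real t) (- \<psi> u) \<le> e / 2"
      using t by (simp add: dist_norm norm_divide pos_divide_le_eq mult.commute)
    then show "dist ((char_fun M (Y t) u - 1) / of_real t) (- \<psi> u) < e" using e by linarith
  qed
qed

end


section \<open>The Ornstein--Uhlenbeck semigroup\<close>

lemma uniform_limit_at_right_0_iff:
  fixes F :: "real \<Rightarrow> 'a \<Rightarrow> real"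
  shows "uniform_limit UNIV F l (at_right 0) \<longleftrightarrow>
    (\<forall>e>0. \<exists>d>0. \<forall>t. 0 < t \<longrightarrow> t < d \<longrightarrow> (\<forall>x. \<bar>F t x - l x\<bar> < e))"
  unfolding uniform_limit_iff eventually_at_right_field by (auto simp: dist_real_def)

lemma (in prob_space) shift_mean_diff_le:
  fixes f p :: "'c::euclidean_space \<Rightarrow> real"
  assumes "vanishing f" "vanishing p" "Y \<in> borel_measurable M" "\<And>x. \<bar>f x - p x\<bar> \<le> e"
  shows "\<bar>(\<integral>\<omega>. f (x + Y \<omega>) \<partial>M) - (\<integral>\<omega>. p (x + Y \<omega>) \<partial>M)\<bar> \<le> e"
proof -
  have "(\<integral>\<omega>. f (x + Y \<omega>) \<partial>M) - (\<integral>\<omega>. p (x + Y \<omega>) \<partial>M) = (\<integral>\<omega>. f (x + Y \<omega>) - p (x + Y \<omega>) \<partial>M)"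
    using integrable_vanishing_shift assms by (intro Bochner_Integration.integral_diff[symmetric]) auto
  moreover have "norm (\<integral>\<omega>. f (x + Y \<omega>) - p (x + Y \<omega>) \<partial>M) \<le> e"
    by (rule norm_integral_le_const) (use assms in auto)
  ultimately show ?thesis by simp
qed

text \<open>Equality is immediate for mixtures, whose shifted means depend on the characteristic
  function alone; it passes to C_0^2 and then to C_0 by uniform approximation. Two probability
  spaces are allowed because one of them will be a product space.\<close>

lemma shift_mean_cong_char_fun:
  fixes Y1 :: "'a \<Rightarrow> real^'n" and Y2 :: "'b \<Rightarrow> real^'n" and f :: "real^'n \<Rightarrow> real"
  assumes M1: "prob_space M1" "Y1 \<in> borel_measurable M1" and M2: "prob_space M2" "Y2 \<in> borel_measurable M2"
    and char: "\<And>u. char_fun M1 Y1 u = char_fun M2 Y2 u" and f: "vanishing f"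
  shows "(\<integral>\<omega>. f (x + Y1 \<omega>) \<partial>M1) = (\<integral>\<omega>. f (x + Y2 \<omega>) \<partial>M2)"
proof -
  interpret M1: prob_space M1 by (rule M1)
  interpret M2: prob_space M2 by (rule M2)
  have close: "\<bar>(\<integral>\<omega>. f (x + Y1 \<omega>) \<partial>M1) - (\<integral>\<omega>. f (x + Y2 \<omega>) \<partial>M2)\<bar> \<le> 2 * e"
    if "vanishing f" "vanishing p" "\<And>x. \<bar>f x - p x\<bar> \<le> e" and
      eq: "(\<integral>\<omega>. p (x + Y1 \<omega>) \<partial>M1) = (\<integral>\<omega>. p (x + Y2 \<omega>) \<partial>M2)" for f p :: "real^'n \<Rightarrow> real" and e
    using M1.shift_mean_diff_le[OF that(1,2) M1(2) that(3), of x] M2.shift_mean_diff_le[OF that(1,2) M2(2) that(3), of x] eq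
    by linarith
  have zero: "a = b" if "\<And>e. e > 0 \<Longrightarrow> \<bar>a - b\<bar> \<le> 2 * e" for a b :: real
  proof (rule ccontr)
    assume "a \<noteq> b" then show False using that[of "\<bar>a - b\<bar> / 4"] by simp
  qed
  have C2: "(\<integral>\<omega>. p (x + Y1 \<omega>) \<partial>M1) = (\<integral>\<omega>. p (x + Y2 \<omega>) \<partial>M2)" if p: "C2_vanishing p g h" for p g h
  proof (rule zero)
    fix e :: real assume e: "e > 0"
    obtain \<kappa> :: "((real^'n) \<times> (real^'n)) measure" and F H \<Theta> where T: "trig_mixture \<kappa> F H \<Theta>"
      and CV: "C2_vanishing (trig_mixture.mix \<kappa> F H \<Theta>) (trig_mixture.mix_grad \<kappa> F H \<Theta>) (trig_mixture.mix_hess \<kappa> F H \<Theta>)"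
      and B: "C2_bounded e (\<lambda>x. p x - trig_mixture.mix \<kappa> F H \<Theta> x) (\<lambda>x. g x - trig_mixture.mix_grad \<kappa> F H \<Theta> x)
      (\<lambda>x. h x - trig_mixture.mix_hess \<kappa> F H \<Theta> x)"
      by (rule trig_mixture_approx[OF p e])
    interpret T: trig_mixture \<kappa> F H \<Theta> by (rule T)
    show "\<bar>(\<integral>\<omega>. p (x + Y1 \<omega>) \<partial>M1) - (\<integral>\<omega>. p (x + Y2 \<omega>) \<partial>M2)\<bar> \<le> 2 * e"
    proof (rule close[of p T.mix])
      show "(\<integral>\<omega>. T.mix (x + Y1 \<omega>) \<partial>M1) = (\<integral>\<omega>. T.mix (x + Y2 \<omega>) \<partial>M2)"
        unfolding T.shift_mean_mix[OF M1] T.shift_mean_mix[OF M2] char ..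
    qed (use p CV B in \<open>auto simp: C2_vanishing_def C2_bounded_def\<close>)
  qed
  show ?thesis
  proof (rule zero)
    fix e :: real assume e: "e > 0"
    \<comment> \<open>With the zero matrix the drift condition is trivial, so \<open>D0 0\<close> is
      all of \<open>C02\<close>.\<close>
    obtain p where p: "p \<in> D0 0" "\<And>x. \<bar>f x - p x\<bar> \<le> e" using D0_dense[OF f e] by blast
    then obtain g h where C: "C2_vanishing p g h" by (auto simp: D0_def C02_iff)
    show "\<bar>(\<integral>\<omega>. f (x + Y1 \<omega>) \<partial>M1) - (\<integral>\<omega>. f (x + Y2 \<omega>) \<partial>M2)\<bar> \<le> 2 * e"
      using close[OF f _ p(2) C2[OF C]] C by (auto simp: C2_vanishing_def)
  qed
qed

text \<open>A left inverse bounds \<open>norm x\<close> by a multiple of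
  \<open>norm (G *v x)\<close>. The summand 1 in the constant keeps the divisor positive.\<close>

lemma matrix_inverse_at_infinity:
  fixes G G' :: "real^'n^'n"
  assumes "G' ** G = mat 1"
  shows "filterlim (\<lambda>x. G *v x) at_infinity at_infinity"
proof (rule filterlim_norm_at_top_imp_at_infinity, rule filterlim_at_top_mono)
  have c: "1 / (norm G' + 1) > 0" by (simp add: add_nonneg_pos)
  show "filterlim (\<lambda>x::real^'n. 1 / (norm G' + 1) * norm x) at_top at_infinity"
    by (rule filterlim_tendsto_pos_mult_at_top[OF tendsto_const c filterlim_norm_at_top])
  have "1 / (norm G' + 1) * norm x \<le> norm (G *v x)" for x
  proof -
    have "norm x = norm (G' *v (G *v x))" using assms by (simp add: matrix_vector_mul_assoc)
    also have "\<dots> \<le> norm G' * norm (G *v x)" by (rule norm_matrix_vector_le)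
    also have "\<dots> \<le> (norm G' + 1) * norm (G *v x)" by (intro mult_right_mono) auto
    finally show ?thesis using c by (simp add: pos_divide_le_eq mult.commute add_nonneg_pos)
  qed
  then show "\<forall>\<^sub>F x in at_infinity. 1 / (norm G' + 1) * norm x \<le> norm (G *v x)" by simp
qed

lemma C2_compose_matrix:
  fixes G :: "real^'n^'n"
  assumes "C2 f g h"
  shows "C2 (\<lambda>x. f (G *v x)) (\<lambda>x. transpose G *v g (G *v x)) (\<lambda>x. transpose G ** h (G *v x) ** G)"
proof -
  have d: "\<And>x. (f has_derivative (\<lambda>v. g x \<bullet> v)) (at x)" "\<And>x. (g has_derivative (\<lambda>v. h x *v v)) (at x)"
    and c: "continuous_on UNIV h"
    using assms by (auto simp: C2_def)
  have s: "((\<lambda>x. G *v x) has_derivative (\<lambda>v. G *v v)) (at x)" for x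
    by (rule bounded_linear_imp_has_derivative[OF bounded_linear_matrix_vector_right])
  have "((\<lambda>x. f (G *v x)) has_derivative (\<lambda>v. (transpose G *v g (G *v x)) \<bullet> v)) (at x)" for x
    using has_derivative_compose[OF s d(1)] by (simp only: inner_matrix_vector_transpose)
  moreover have "((\<lambda>x. transpose G *v g (G *v x)) has_derivative (\<lambda>v. (transpose G ** h (G *v x) ** G) *v v)) (at x)" for x
    using bounded_linear.has_derivative[OF bounded_linear_matrix_vector_right has_derivative_compose[OF s d(2)], of "transpose G"]
    by (simp only: matrix_vector_mul_assoc[symmetric])
  moreover have "continuous_on UNIV (\<lambda>x. h (G *v x))"
    by (rule continuous_on_compose2[OF c linear_continuous_on]) auto
  then have "continuous_on UNIV (\<lambda>x. transpose G ** h (G *v x) ** G)"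
    unfolding matrix_matrix_mult_def
    by (intro continuous_on_vec_lambda continuous_on_sum continuous_on_mult continuous_on_const continuous_on_component)
       (auto intro!: continuous_intros)
  ultimately show ?thesis by (simp add: C2_def)
qed

lemma bounded_linear_matrix_conj: "bounded_linear (\<lambda>M. G ** M ** (H :: real^'n^'n) :: real^'n^'n)"
proof -
  have "(A + B) ** C = A ** C + B ** C" for A B C :: "real^'n^'n"
    by (simp add: vec_eq_iff matrix_matrix_mult_def sum.distrib distrib_right)
  then show ?thesis
    unfolding linear_conv_bounded_linear[symmetric] linear_iff
    by (simp add: matrix_add_ldistrib scaleR_matrix_mult_left scaleR_matrix_mult_right)
qed

lemma vanishing_compose_matrix:
  assumes "G' ** G = mat 1" "vanishing f"
  shows "vanishing (\<lambda>x. f ((G :: real^'n^'n) *v x))"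
  by (rule vanishing_compose[OF assms(2) linear_continuous_on[OF bounded_linear_matrix_vector_right] matrix_inverse_at_infinity[OF assms(1)]])

lemma C2_vanishing_compose_matrix:
  fixes G :: "real^'n^'n"
  assumes "C2_vanishing f g h" and G: "G' ** G = mat 1"
  shows "C2_vanishing (\<lambda>x. f (G *v x)) (\<lambda>x. transpose G *v g (G *v x)) (\<lambda>x. transpose G ** h (G *v x) ** G)"
proof -
  have C: "C2 f g h" and v: "vanishing f" "vanishing g" "vanishing h"
    using assms(1) by (auto simp: C2_vanishing_def)
  have "vanishing (\<lambda>x. f (G *v x))" by (rule vanishing_compose_matrix[OF G v(1)])
  moreover have "vanishing (\<lambda>x. transpose G *v g (G *v x))"
    by (rule vanishing_bounded_linear[OF bounded_linear_matrix_vector_right vanishing_compose_matrix[OF G v(2)]])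
  moreover have "vanishing (\<lambda>x. transpose G ** h (G *v x) ** G)"
    by (rule vanishing_bounded_linear[OF bounded_linear_matrix_conj vanishing_compose_matrix[OF G v(3)]])
  ultimately show ?thesis unfolding C2_vanishing_def using C2_compose_matrix[OF C] by (intro conjI)
qed

section \<open>Semigroup properties\<close>

context OU_driven
begin

abbreviation P where "P \<equiv> OU_semigroup M A Y"

lemma P_eq: "P t f x = (\<integral>\<omega>. f (E t *v x + Y t \<omega>) \<partial>M)"
  by (simp add: OU_semigroup_def OU_process_def)

lemma E_minus: "E (- t) ** E t = mat 1"
  using mexp_minus_left[of t A] by simp

lemma E_0: "E 0 *v x = x"
  by (simp add: mexp_0)

lemma vanishing_P: "vanishing f \<Longrightarrow> t \<ge> 0 \<Longrightarrow> vanishing (P t f)"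
  unfolding P_eq[abs_def]
  by (rule vanishing_compose_matrix[OF E_minus vanishing_shift_mean[OF _ Y_measurable]])

lemma P_contraction: "(\<And>x. \<bar>f x\<bar> \<le> e) \<Longrightarrow> \<bar>P t f x\<bar> \<le> e"
  unfolding P_eq using norm_integral_le_const[of "\<lambda>\<omega>. f (E t *v x + Y t \<omega>)" e] by simp

lemma P_add: "vanishing f \<Longrightarrow> vanishing g \<Longrightarrow> t \<ge> 0 \<Longrightarrow> P t (\<lambda>x. f x + g x) x = P t f x + P t g x"
  unfolding P_eq by (intro Bochner_Integration.integral_add integrable_vanishing_shift Y_measurable)

lemma P_diff: "vanishing f \<Longrightarrow> vanishing g \<Longrightarrow> t \<ge> 0 \<Longrightarrow> P t (\<lambda>x. f x - g x) x = P t f x - P t g x"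
  unfolding P_eq by (intro Bochner_Integration.integral_diff integrable_vanishing_shift Y_measurable)

lemma P_cmult: "P t (\<lambda>x. c * f x) x = c * P t f x"
  unfolding P_eq by simp

lemma P_diff_le:
  assumes "vanishing f" "vanishing g" "t \<ge> 0" "\<And>x. \<bar>f x - g x\<bar> \<le> e"
  shows "\<bar>P t f x - P t g x\<bar> \<le> e"
  using P_contraction[of "\<lambda>x. f x - g x" e t x] P_diff[OF assms(1-3), of x] assms(4) by simp

text \<open>On the product space \<open>W\<close> combines two independent copies. The cocycle
  identity says that it has the characteristic function of \<open>Y (s + t)\<close>, so it gives the
  same mean to every shifted C_0 function.\<close>

lemma P_semigroup:
  assumes f: "vanishing f" and s: "s \<ge> 0" and t: "t \<ge> 0"
  shows "P s (P t f) x = P (s + t) f x"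
proof -
  interpret N: pair_prob_space M M by standard
  have [measurable]: "Y s \<in> borel_measurable M" "Y t \<in> borel_measurable M" using s t Y_measurable by auto
  have [measurable]: "f \<in> borel_measurable borel"
    using f by (auto simp: vanishing_def intro: borel_measurable_continuous_onI)
  have [measurable]: "(\<lambda>x. E t *v x) \<in> borel_measurable borel"
    by (intro borel_measurable_continuous_onI linear_continuous_on) simp
  define W where "W = (\<lambda>p. E t *v Y s (fst p) + Y t (snd p))"
  have W_m[measurable]: "W \<in> borel_measurable (M \<Otimes>\<^sub>M M)" unfolding W_def by measurable
  have "char_fun (M \<Otimes>\<^sub>M M) W u = char_fun M (Y (s + t)) u" for u
  proof -
    have "integrable (M \<Otimes>\<^sub>M M) (\<lambda>p. cis (u \<bullet> W p))" by (rule N.integrable_const_bound[of _ 1]) auto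
    then have "char_fun (M \<Otimes>\<^sub>M M) W u = (\<integral>\<omega>. \<integral>\<omega>'. cis (u \<bullet> W (\<omega>, \<omega>')) \<partial>M \<partial>M)"
      unfolding char_fun_def by (rule N.integral_fst'[symmetric])
    also have "\<dots> = (\<integral>\<omega>. \<integral>\<omega>'. cis ((Et t *v u) \<bullet> Y s \<omega>) * cis (u \<bullet> Y t \<omega>') \<partial>M \<partial>M)"
      unfolding W_def fst_conv snd_conv inner_add_right inner_matrix_vector_transpose cis_mult ..
    also have "\<dots> = char_fun M (Y s) (Et t *v u) * char_fun M (Y t) u"
      unfolding char_fun_def by simp
    finally show ?thesis using char_fun_Y_cocycle[OF s t] by simp
  qed
  then have law: "(\<integral>p. f (z + W p) \<partial>(M \<Otimes>\<^sub>M M)) = (\<integral>\<omega>. f (z + Y (s + t) \<omega>) \<partial>M)" for z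
    using s t by (intro shift_mean_cong_char_fun[OF N.prob_space_axioms W_m prob_space_axioms Y_measurable _ f]) auto
  have Ets: "E t *v (E s *v x + y) = E (s + t) *v x + E t *v y" for y
  proof -
    have "E (s + t) = E t ** E s" using mexp_add[of t s A] by (simp add: add.commute)
    then show ?thesis by (simp only: matrix_vector_right_distrib matrix_vector_mul_assoc)
  qed
  have "P s (P t f) x = (\<integral>\<omega>. \<integral>\<omega>'. f (E (s + t) *v x + W (\<omega>, \<omega>')) \<partial>M \<partial>M)"
    unfolding P_eq W_def by (simp add: Ets add.assoc)
  also have "\<dots> = (\<integral>p. f (E (s + t) *v x + W p) \<partial>(M \<Otimes>\<^sub>M M))"
    by (rule N.integral_fst'[OF N.integrable_vanishing_shift[OF f W_m]])
  finally show ?thesis unfolding law P_eq .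
qed

text \<open>At time 0 the bound on the characteristic function forces it to be constantly 1, that of
  the zero variable.\<close>

lemma P_0:
  assumes f: "vanishing f" shows "P 0 f x = f x"
proof -
  have "char_fun M (Y 0) u = 1" for u
    using char_fun_Y_bound by (metis diff_0_right eq_iff_diff_eq_0 mult_zero_left mult_zero_right norm_le_zero_iff order_refl)
  moreover have "char_fun M (\<lambda>_. 0) u = 1" for u :: "real^'n"
    by (simp add: char_fun_def prob_space)
  ultimately have "(\<integral>\<omega>. f (x + Y 0 \<omega>) \<partial>M) = (\<integral>\<omega>. f (x + 0) \<partial>M)"
    by (intro shift_mean_cong_char_fun[OF prob_space_axioms Y_measurable prob_space_axioms _ _ f]) auto
  then show ?thesis unfolding P_eq E_0 by (simp add: prob_space)
qed

section \<open>Difference quotients at time zero\<close>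

lemma difference_quotient_bound:
  obtains C where "C > 0" "\<And>t K f g h x. t > 0 \<Longrightarrow> C2_bounded K f g h \<Longrightarrow>
     \<bar>((\<integral>\<omega>. f (x + Y t \<omega>) \<partial>M) - f x) / t\<bar> \<le> C * K"
proof -
  obtain C where C: "C > 0" "\<And>t u. t \<ge> 0 \<Longrightarrow> cmod (char_fun M (Y t) u - 1) \<le> C * t * (1 + norm u)\<^sup>2"
    using char_fun_Y_bound by blast
  obtain C0 :: real where C0: "C0 > 0"
    "\<And>(M :: 'w measure) (Y :: 'w \<Rightarrow> real^'n) c K f g h x. prob_space M \<Longrightarrow> Y \<in> borel_measurable M \<Longrightarrow>
       (\<And>u. cmod (char_fun M Y u - 1) \<le> c * (1 + norm u)\<^sup>2) \<Longrightarrow> C2_bounded K f g h \<Longrightarrow>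
       \<bar>(\<integral>\<omega>. f (x + Y \<omega>) \<partial>M) - f x\<bar> \<le> C0 * K * c"
    using shift_mean_le_char_fun by blast
  show thesis
  proof (rule that[of "C0 * C"])
    fix t K :: real and f x and g :: "real^'n \<Rightarrow> real^'n" and h assume t: "t > 0" and B: "C2_bounded K f g h"
    have "\<bar>(\<integral>\<omega>. f (x + Y t \<omega>) \<partial>M) - f x\<bar> \<le> C0 * K * (C * t)"
      using t C(2)[of t] by (intro C0(2)[OF prob_space_axioms Y_measurable _ B]) auto
    then show "\<bar>((\<integral>\<omega>. f (x + Y t \<omega>) \<partial>M) - f x) / t\<bar> \<le> C0 * C * K"
      using t by (simp add: pos_divide_le_eq mult_ac)
  qed (use C C0 in auto)
qed

text \<open>Supplies a majorant, uniform in \<open>t\<close>, for dominated convergence over the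
  frequencies.\<close>

lemma char_fun_quotient_bound:
  obtains C where "C > 0" "\<And>t u. t > 0 \<Longrightarrow> cmod ((char_fun M (Y t) u - 1) / of_real t + \<psi> u) \<le> C * (1 + norm u)\<^sup>2"
proof -
  obtain C where C: "C > 0" "\<And>t u. t \<ge> 0 \<Longrightarrow> cmod (char_fun M (Y t) u - 1) \<le> C * t * (1 + norm u)\<^sup>2"
    using char_fun_Y_bound by blast
  obtain C' where C': "C' > 0" "\<And>u. cmod (\<psi> u) \<le> C' * (1 + norm u)\<^sup>2" using levy_exponent_bound[OF nu] by blast
  show thesis
  proof (rule that[of "C + C'"])
    fix t :: real and u assume t: "t > 0"
    have "cmod ((char_fun M (Y t) u - 1) / of_real t) \<le> C * (1 + norm u)\<^sup>2"
      using C(2)[of t u] t by (simp add: norm_divide pos_divide_le_eq mult_ac)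
    then show "cmod ((char_fun M (Y t) u - 1) / of_real t + \<psi> u) \<le> (C + C') * (1 + norm u)\<^sup>2"
      using C'(2)[of u] norm_triangle_ineq[of "(char_fun M (Y t) u - 1) / of_real t" "\<psi> u"]
      by (simp add: distrib_right)
  qed (use C C' in auto)
qed

lemma char_fun_Y_measurable: "t \<ge> 0 \<Longrightarrow> char_fun M (Y t) \<in> borel_measurable borel"
proof -
  assume "t \<ge> 0"
  then have [measurable]: "Y t \<in> borel_measurable M" by (rule Y_measurable)
  show ?thesis unfolding char_fun_def[abs_def] by measurable
qed

lemma psi_measurable: "\<psi> \<in> borel_measurable borel"
  by (rule borel_measurable_continuous_onI[OF levy_exponent_continuous[OF nu]])

text \<open>\<open>q t p\<close> is the error of the multiplier at frequency \<open>H p\<close>, and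
  \<open>D t\<close> integrates its modulus against the amplitude. The phase carrying
  \<open>x\<close> has modulus 1, so \<open>D t\<close> bounds the error for every \<open>x\<close>;
  it tends to 0 by dominated convergence.\<close>

lemma mixture_difference_quotient:
  assumes T: "trig_mixture (\<kappa> :: 'p measure) F H \<Theta>"
  shows "uniform_limit UNIV
    (\<lambda>t x. ((\<integral>\<omega>. trig_mixture.mix \<kappa> F H \<Theta> (x + Y t \<omega>) \<partial>M) - trig_mixture.mix \<kappa> F H \<Theta> x) / t)
    (levy_op Q a \<nu> (trig_mixture.mix \<kappa> F H \<Theta>) (trig_mixture.mix_grad \<kappa> F H \<Theta>) (trig_mixture.mix_hess \<kappa> F H \<Theta>))
    (at_right 0)"
proof -
  interpret T: trig_mixture \<kappa> F H \<Theta> by (rule T)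
  define q where "q = (\<lambda>t p. (char_fun M (Y t) (H p) - 1) / of_real t + \<psi> (H p))"
  define D where "D = (\<lambda>t. \<integral>p. \<bar>F p\<bar> * cmod (q t p) \<partial>\<kappa>)"
  obtain C where C: "C > 0" "\<And>t u. t > 0 \<Longrightarrow> cmod ((char_fun M (Y t) u - 1) / of_real t + \<psi> u) \<le> C * (1 + norm u)\<^sup>2"
    using char_fun_quotient_bound by blast
  have q_m: "q t \<in> borel_measurable \<kappa>" if "t > 0" for t
    unfolding q_def using char_fun_Y_measurable[of t] psi_measurable that
    by (intro borel_measurable_add borel_measurable_divide borel_measurable_diff borel_measurable_const
       measurable_compose[OF T.H_measurable]) auto
  have q_b: "\<bar>F p\<bar> * cmod (q t p) \<le> C * (\<bar>F p\<bar> * (1 + norm (H p))\<^sup>2)" if "t > 0" for t p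
    using mult_left_mono[OF C(2)[OF that, of "H p"], of "\<bar>F p\<bar>"] by (simp add: q_def mult_ac)
  have w_int: "integrable \<kappa> (\<lambda>p. C * (\<bar>F p\<bar> * (1 + norm (H p))\<^sup>2))"
    by (rule T.integrable_le_weight[of _ C 2]) (use C in \<open>auto simp: abs_mult\<close>)
  have q_int: "integrable \<kappa> (\<lambda>p. \<bar>F p\<bar> * cmod (q t p))" if "t > 0" for t
    by (rule T.integrable_le_weight[of _ C 2]) (use C q_m[OF that] q_b[OF that] in \<open>auto simp: abs_mult\<close>)
  have D_lim: "(D \<longlongrightarrow> 0) (at_right 0)"
    unfolding tendsto_at_iff_sequentially comp_def
  proof (intro allI impI)
    fix X :: "nat \<Rightarrow> real" assume X: "\<forall>i. X i \<in> {0<..} - {0}" "X \<longlonglongrightarrow> 0"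
    then have pos: "\<And>i. X i > 0" by auto
    have "X i \<noteq> 0" for i using pos[of i] by simp
    then have X': "filterlim X (at_right 0) sequentially" using X(2) pos by (simp add: filterlim_at)
    have "(\<lambda>i. \<integral>p. \<bar>F p\<bar> * cmod (q (X i) p) \<partial>\<kappa>) \<longlonglongrightarrow> (\<integral>p. 0 \<partial>\<kappa>)"
    proof (rule integral_dominated_convergence[OF _ _ w_int])
      show "AE p in \<kappa>. (\<lambda>i. \<bar>F p\<bar> * cmod (q (X i) p)) \<longlonglongrightarrow> 0"
      proof (rule AE_I2)
        fix p
        have "((\<lambda>t. \<bar>F p\<bar> * cmod ((char_fun M (Y t) (H p) - 1) / of_real t + \<psi> (H p))) \<longlongrightarrow> \<bar>F p\<bar> * cmod (- \<psi> (H p) + \<psi> (H p))) (at_right 0)"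
          by (intro tendsto_intros char_fun_Y_derivative)
        then show "(\<lambda>i. \<bar>F p\<bar> * cmod (q (X i) p)) \<longlonglongrightarrow> 0"
          unfolding q_def using filterlim_compose[OF _ X'] by fastforce
      qed
      show "(\<lambda>p. \<bar>F p\<bar> * cmod (q (X i) p)) \<in> borel_measurable \<kappa>" for i
        using q_int[OF pos] by (rule borel_measurable_integrable)
      show "AE p in \<kappa>. norm (\<bar>F p\<bar> * cmod (q (X i) p)) \<le> C * (\<bar>F p\<bar> * (1 + norm (H p))\<^sup>2)" for i
        using q_b[OF pos] by (simp add: abs_mult)
    qed simp
    then show "(\<lambda>i. D (X i)) \<longlonglongrightarrow> 0" by (simp add: D_def)
  qed
  have key: "\<bar>((\<integral>\<omega>. T.mix (x + Y t \<omega>) \<partial>M) - T.mix x) / t - levy_op Q a \<nu> T.mix T.mix_grad T.mix_hess x\<bar> \<le> D t"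
    if t: "t > 0" for t x
  proof -
    let ?c = "\<lambda>p. cis (\<Theta> p + H p \<bullet> x)"
    have c_m: "(\<lambda>p. char_fun M (Y t) (H p)) \<in> borel_measurable \<kappa>"
      using char_fun_Y_measurable[of t] t by (intro measurable_compose[OF T.H_measurable]) auto
    have i1: "integrable \<kappa> (\<lambda>p. F p * Re (?c p * char_fun M (Y t) (H p)))"
    proof (rule T.integrable_le_weight[of _ 1 0])
      fix p
      have "\<bar>Re (?c p * char_fun M (Y t) (H p))\<bar> \<le> 1"
        using abs_Re_le_cmod[of "?c p * char_fun M (Y t) (H p)"] norm_char_fun_le[of "Y t" "H p"] by (simp add: norm_mult)
      then have "\<bar>F p\<bar> * \<bar>Re (?c p * char_fun M (Y t) (H p))\<bar> \<le> \<bar>F p\<bar> * 1" by (intro mult_left_mono) auto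
      then show "norm (F p * Re (?c p * char_fun M (Y t) (H p))) \<le> 1 * (\<bar>F p\<bar> * (1 + norm (H p)) ^ 0)"
        by (simp only: real_norm_def abs_mult power_0 mult_1_left)
      note [measurable] = c_m
      show "(\<lambda>p. F p * Re (?c p * char_fun M (Y t) (H p))) \<in> borel_measurable \<kappa>" by measurable
    qed auto
    have i2: "integrable \<kappa> (\<lambda>p. F p * Re (?c p))" using T.integrable_mix[of x] by simp
    have mix: "T.mix x = (\<integral>p. F p * Re (?c p) \<partial>\<kappa>)" by (simp add: T.mix_def)
    have "((\<integral>\<omega>. T.mix (x + Y t \<omega>) \<partial>M) - T.mix x) / t - levy_op Q a \<nu> T.mix T.mix_grad T.mix_hess x
       = (\<integral>p. (F p * Re (?c p * char_fun M (Y t) (H p)) - F p * Re (?c p)) / t - F p * Re (?c p * - \<psi> (H p)) \<partial>\<kappa>)"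
      unfolding T.shift_mean_mix[OF prob_space_axioms Y_measurable[OF less_imp_le[OF t]]] mix T.levy_op_mix(1)[OF nu]
      using i1 i2 T.levy_op_mix(2)[OF nu, of x Q a] by simp
    also have "\<dots> = (\<integral>p. F p * Re (?c p * q t p) \<partial>\<kappa>)"
    proof (rule Bochner_Integration.integral_cong[OF refl])
      fix p
      have "Re (?c p * q t p) = (Re (?c p * char_fun M (Y t) (H p)) - Re (?c p)) / t + Re (?c p * \<psi> (H p))"
        by (simp add: q_def distrib_left right_diff_distrib diff_divide_distrib Re_divide_of_real Im_divide_of_real)
      then show "(F p * Re (?c p * char_fun M (Y t) (H p)) - F p * Re (?c p)) / t - F p * Re (?c p * - \<psi> (H p)) = F p * Re (?c p * q t p)"
        by (simp only:) (simp add: algebra_simps diff_divide_distrib)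
    qed
    also have "\<bar>\<dots>\<bar> \<le> D t"
    proof -
      have "norm (\<integral>p. F p * Re (?c p * q t p) \<partial>\<kappa>) \<le> D t"
        unfolding D_def
      proof (rule norm_integral_le)
        have b: "norm (F p * Re (?c p * q t p)) \<le> \<bar>F p\<bar> * cmod (q t p)" for p
        proof -
          have "\<bar>Re (?c p * q t p)\<bar> \<le> cmod (q t p)" using abs_Re_le_cmod[of "?c p * q t p"] by (simp add: norm_mult)
          then show ?thesis unfolding real_norm_def abs_mult by (intro mult_left_mono) auto
        qed
        show "norm (F p * Re (?c p * q t p)) \<le> \<bar>F p\<bar> * cmod (q t p)" for p by (rule b)
        note [measurable] = q_m[OF t]
        have "(\<lambda>p. F p * Re (?c p * q t p)) \<in> borel_measurable \<kappa>" by measurable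
        then show "integrable \<kappa> (\<lambda>p. F p * Re (?c p * q t p))"
          by (rule Bochner_Integration.integrable_bound[OF q_int[OF t]])
             (rule AE_I2, rule order_trans[OF b], simp)
      qed (rule q_int[OF t])
      then show ?thesis by simp
    qed
    finally show ?thesis .
  qed
  show ?thesis
    unfolding uniform_limit_iff
  proof (intro allI impI)
    fix e :: real assume "e > 0"
    then have "\<forall>\<^sub>F t in at_right 0. D t < e" using order_tendstoD(2)[OF D_lim] by blast
    moreover have "\<forall>\<^sub>F t::real in at_right 0. t > 0" by (simp add: eventually_at_filter)
    ultimately show "\<forall>\<^sub>F t in at_right 0. \<forall>x\<in>UNIV. dist (((\<integral>\<omega>. T.mix (x + Y t \<omega>) \<partial>M) - T.mix x) / t) (levy_op Q a \<nu> T.mix T.mix_grad T.mix_hess x) < e"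
    proof eventually_elim
      case (elim t)
      then show ?case using key[of t] le_less_trans by (auto simp: dist_real_def)
    qed
  qed
qed

text \<open>Both the quotient and the operator are bounded by constants times the C^2 norm, the
  former uniformly in \<open>t\<close>. The limit therefore passes from mixtures to their C^2
  closure.\<close>

lemma shift_difference_quotient:
  assumes f: "C2_vanishing f g h"
  shows "uniform_limit UNIV (\<lambda>t x. ((\<integral>\<omega>. f (x + Y t \<omega>) \<partial>M) - f x) / t) (levy_op Q a \<nu> f g h) (at_right 0)"
  unfolding uniform_limit_at_right_0_iff
proof (intro allI impI)
  fix e :: real assume e: "e > 0"
  obtain C1 where C1: "C1 > 0" "\<And>t K f g h x. t > 0 \<Longrightarrow> C2_bounded K f g h \<Longrightarrow>
     \<bar>((\<integral>\<omega>. f (x + Y t \<omega>) \<partial>M) - f x) / t\<bar> \<le> C1 * K"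
    using difference_quotient_bound by blast
  obtain C2' where C2': "C2' > 0" "\<And>K f g h x. C2_bounded K f g h \<Longrightarrow> \<bar>levy_op Q a \<nu> f g h x\<bar> \<le> C2' * K"
    using levy_op_bound[OF nu, of Q a] by blast
  \<comment> \<open>Chosen so that the two replacement errors \<open>C1 * \<eta>\<close> and
    \<open>C2' * \<eta>\<close> add up to \<open>e / 2\<close>.\<close>
  define \<eta> where "\<eta> = (e / 2) / (C1 + C2')"
  have c: "C1 + C2' > 0" using C1(1) C2'(1) by simp
  have "\<eta> > 0" unfolding \<eta>_def by (rule divide_pos_pos[OF half_gt_zero[OF e] c])
  moreover have "(C1 + C2') * \<eta> = e / 2"
    unfolding \<eta>_def using c by (metis less_irrefl nonzero_mult_div_cancel_left times_divide_eq_right)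
  ultimately have \<eta>: "\<eta> > 0" "(C1 + C2') * \<eta> = e / 2" .
  obtain \<kappa> :: "((real^'n) \<times> (real^'n)) measure" and F H \<Theta> where T: "trig_mixture \<kappa> F H \<Theta>"
    and CV: "C2_vanishing (trig_mixture.mix \<kappa> F H \<Theta>) (trig_mixture.mix_grad \<kappa> F H \<Theta>) (trig_mixture.mix_hess \<kappa> F H \<Theta>)"
    and B: "C2_bounded \<eta> (\<lambda>x. f x - trig_mixture.mix \<kappa> F H \<Theta> x) (\<lambda>x. g x - trig_mixture.mix_grad \<kappa> F H \<Theta> x)
      (\<lambda>x. h x - trig_mixture.mix_hess \<kappa> F H \<Theta> x)"
    by (rule trig_mixture_approx[OF f \<eta>(1)])
  interpret T: trig_mixture \<kappa> F H \<Theta> by (rule T)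
  let ?L = "levy_op Q a \<nu> f g h" and ?LT = "levy_op Q a \<nu> T.mix T.mix_grad T.mix_hess"
  let ?S = "\<lambda>f t x. ((\<integral>\<omega>. f (x + Y t \<omega>) \<partial>M) - f x) / t"
  obtain d where d: "d > 0" "\<And>t x. 0 < t \<Longrightarrow> t < d \<Longrightarrow> \<bar>?S T.mix t x - ?LT x\<bar> < e / 2"
    using mixture_difference_quotient[OF T] e unfolding uniform_limit_at_right_0_iff by (metis half_gt_zero)
  have v: "vanishing f" "vanishing T.mix" using f CV by (auto simp: C2_vanishing_def)
  obtain K where K: "C2_bounded K f g h" using C2_vanishing_bounded[OF f] .
  obtain K' where K': "C2_bounded K' T.mix T.mix_grad T.mix_hess" using C2_vanishing_bounded[OF CV] .
  show "\<exists>d>0. \<forall>t. 0 < t \<longrightarrow> t < d \<longrightarrow> (\<forall>x. \<bar>?S f t x - ?L x\<bar> < e)"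
  proof (intro exI[of _ d] conjI allI impI d(1))
    fix t x assume t: "0 < t" "t < d"
    have "(\<integral>\<omega>. f (x + Y t \<omega>) - T.mix (x + Y t \<omega>) \<partial>M) = (\<integral>\<omega>. f (x + Y t \<omega>) \<partial>M) - (\<integral>\<omega>. T.mix (x + Y t \<omega>) \<partial>M)"
      using t by (intro Bochner_Integration.integral_diff integrable_vanishing_shift v Y_measurable) auto
    then have "?S (\<lambda>x. f x - T.mix x) t x = ?S f t x - ?S T.mix t x"
      by (simp add: diff_divide_distrib)
    then have 1: "\<bar>?S f t x - ?S T.mix t x\<bar> \<le> C1 * \<eta>" using C1(2)[OF t(1) B, of x] by simp
    have 2: "\<bar>?L x - ?LT x\<bar> \<le> C2' * \<eta>"
      using C2'(2)[OF B, of x] unfolding levy_op_diff[OF K K' nu] .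
    show "\<bar>?S f t x - ?L x\<bar> < e"
      using 1 2 d(2)[OF t, of x] \<eta>(2) by (simp only: distrib_right)
  qed
qed

text \<open>The decay of the jump integral is not estimated directly: it is inherited, since the
  operator is a uniform limit of difference quotients in C_0.\<close>

lemma levy_op_vanishing:
  assumes f: "C2_vanishing f g h" shows "vanishing (levy_op Q a \<nu> f g h)"
proof (rule vanishing_uniform_limit[OF shift_difference_quotient[OF f]])
  have v: "vanishing f" using f by (simp add: C2_vanishing_def)
  have "vanishing (\<lambda>x. ((\<integral>\<omega>. f (x + Y t \<omega>) \<partial>M) - f x) / t)" if "t > 0" for t
    using vanishing_cmult[OF vanishing_diff[OF vanishing_shift_mean[OF v Y_measurable[of t]] v], of "1 / t"] that by simp
  moreover have "\<forall>\<^sub>F t::real in at_right 0. t > 0" by (simp add: eventually_at_filter)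
  ultimately show "\<forall>\<^sub>F t in at_right 0. vanishing (\<lambda>x. ((\<integral>\<omega>. f (x + Y t \<omega>) \<partial>M) - f x) / t)"
    by (auto elim: eventually_mono)
qed simp

text \<open>The displacement \<open>E r *v x - x\<close> is only small relative to
  \<open>norm x\<close>. On a bounded set that suffices with uniform continuity; far out, the moved
  point is still far out and both values of \<open>v\<close> are small.\<close>

lemma flow_uniformly_continuous:
  assumes v: "vanishing (v :: real^'n \<Rightarrow> real)" and e: "e > 0"
  obtains d where "d > 0" "\<And>r x. 0 \<le> r \<Longrightarrow> r < d \<Longrightarrow> \<bar>v (E r *v x) - v x\<bar> < e"
proof -
  obtain b where b: "b > 0" "\<And>x. norm x \<ge> b \<Longrightarrow> norm (v x) < e/2" using vanishing_at_infinityD[OF v, of "e/2"] e by auto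
  obtain c where c: "c > 0" "\<And>x y. norm (x - y) < c \<Longrightarrow> norm (v x - v y) < e"
    using vanishing_uniformly_continuous[OF v e] by auto
  \<comment> \<open>The bound 1/2 leaves a point of norm at least \<open>2 * b\<close> outside
    radius \<open>b\<close>; the other bound keeps displacements below \<open>c\<close> on the ball
    of radius \<open>2 * b\<close>.\<close>
  define m where "m = min (1/2) (c / (2 * b))"
  have m: "m > 0" "m \<le> 1/2" "m \<le> c / (2 * b)" using b c by (auto simp: m_def)
  have "isCont E 0" by (rule continuous_mexp)
  then obtain d where d: "d > 0" "\<And>r. \<bar>r\<bar> < d \<Longrightarrow> norm (E r - mat 1) < m"
    using m(1) unfolding continuous_at_eps_delta by (auto simp: dist_norm mexp_0)
  show thesis
  proof (rule that[OF d(1)])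
    fix r x assume r: "0 \<le> r" "r < d"
    have "E r *v x - x = (E r - mat 1) *v x" by (simp add: matrix_vector_mult_diff_rdistrib)
    then have "norm (E r *v x - x) \<le> norm (E r - mat 1) * norm x" by (simp add: norm_matrix_vector_le)
    also have "\<dots> \<le> m * norm x" using d(2)[of r] r by (intro mult_right_mono) auto
    finally have n: "norm (E r *v x - x) \<le> m * norm x" .
    show "\<bar>v (E r *v x) - v x\<bar> < e"
    proof (cases "norm x < 2 * b")
      case True
      have "m * norm x \<le> c / (2 * b) * norm x" using m by (intro mult_right_mono) auto
      also have "\<dots> < c / (2 * b) * (2 * b)" using True b c by (intro mult_strict_left_mono) auto
      finally show ?thesis using c(2)[of "E r *v x" x] n b by simp
    next
      case False
      have "norm x \<le> norm (E r *v x) + norm (E r *v x - x)"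
        using norm_triangle_ineq2[of x "E r *v x"] by (simp add: norm_minus_commute)
      moreover have "m * norm x \<le> 1/2 * norm x" using m by (intro mult_right_mono) auto
      ultimately have "norm (E r *v x) \<ge> b" using n False by linarith
      then show ?thesis using b(2)[of x] b(2)[of "E r *v x"] False b(1) by (auto simp: abs_less_iff)
    qed
  qed
qed

text \<open>This is the shift quotient evaluated at the moved point \<open>E t *v x\<close>; its
  limit lies in C_0, so the evaluation point may be brought back to \<open>x\<close>
  uniformly.\<close>

lemma levy_part_limit:
  assumes f: "C2_vanishing f g h"
  shows "uniform_limit UNIV (\<lambda>t x. (P t f x - f (E t *v x)) / t) (levy_op Q a \<nu> f g h) (at_right 0)"
  unfolding uniform_limit_at_right_0_iff
proof (intro allI impI)
  fix e :: real assume "e > 0"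
  then have e: "e / 2 > 0" by simp
  let ?L = "levy_op Q a \<nu> f g h"
  obtain d1 where d1: "d1 > 0" "\<And>t x. 0 < t \<Longrightarrow> t < d1 \<Longrightarrow> \<bar>((\<integral>\<omega>. f (x + Y t \<omega>) \<partial>M) - f x) / t - ?L x\<bar> < e / 2"
    using shift_difference_quotient[OF f] e unfolding uniform_limit_at_right_0_iff by meson
  obtain d2 where d2: "d2 > 0" "\<And>r x. 0 \<le> r \<Longrightarrow> r < d2 \<Longrightarrow> \<bar>?L (E r *v x) - ?L x\<bar> < e / 2"
    using flow_uniformly_continuous[OF levy_op_vanishing[OF f] e] by blast
  show "\<exists>d>0. \<forall>t. 0 < t \<longrightarrow> t < d \<longrightarrow> (\<forall>x. \<bar>(P t f x - f (E t *v x)) / t - ?L x\<bar> < e)"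
  proof (intro exI[of _ "min d1 d2"] conjI allI impI)
    fix t x assume t: "0 < t" "t < min d1 d2"
    show "\<bar>(P t f x - f (E t *v x)) / t - ?L x\<bar> < e"
    proof -
      have "t < d1" "t < d2" "0 \<le> t" using t by auto
      then show ?thesis unfolding P_eq using d1(2)[of t "E t *v x"] d2(2)[of t x] t(1) by linarith
    qed
  qed (use d1 d2 in auto)
qed

lemma flow_derivative:
  assumes "C2 f g h"
  shows "((\<lambda>r. f (E r *v x)) has_real_derivative (A *v (E r *v x)) \<bullet> g (E r *v x)) (at r)"
proof -
  have "(f has_derivative (\<lambda>v. g (E r *v x) \<bullet> v)) (at (E r *v x))" using assms by (simp add: C2_def)
  from has_derivative_compose[OF mexp_vector_derivative[unfolded has_vector_derivative_def] this]
  show ?thesis by (simp add: has_field_derivative_def inner_commute mult_commute_abs)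
qed

section \<open>The generator on the candidate core, and invariance\<close>

lemma D0_iff: "f \<in> D0 A \<longleftrightarrow> (\<exists>g h. C2_vanishing f g h \<and> vanishing (\<lambda>x. (A *v x) \<bullet> g x))"
  unfolding D0_def C02_iff using C2_vanishing_imp(2) by (auto simp: C02_iff C0_iff_vanishing)

text \<open>The quotient splits into the Levy part and the variation of \<open>f\<close> along the
  flow. Decay of the drift term makes the latter converge uniformly.\<close>

lemma generates_at_D0:
  assumes f: "f \<in> D0 A" shows "generates_at P f (OU_operator A Q a \<nu> f)"
proof -
  obtain g h where C: "C2_vanishing f g h" and v: "vanishing (\<lambda>x. (A *v x) \<bullet> g x)" using f D0_iff by blast
  have OU: "OU_operator A Q a \<nu> f x = levy_op Q a \<nu> f g h x + (A *v x) \<bullet> g x" for x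
    using OU_operator_eq_levy_op[of A Q a \<nu> f x] C2_vanishing_imp[OF C] by simp
  have "vanishing (OU_operator A Q a \<nu> f)"
    unfolding OU[abs_def] by (rule vanishing_add[OF levy_op_vanishing[OF C] v])
  moreover have "uniform_limit UNIV (\<lambda>t x. (P t f x - f x) / t) (OU_operator A Q a \<nu> f) (at_right 0)"
    unfolding uniform_limit_at_right_0_iff
  proof (intro allI impI)
    fix e :: real assume "e > 0"
    then have e: "e / 2 > 0" by simp
    obtain d1 where d1: "d1 > 0" "\<And>t x. 0 < t \<Longrightarrow> t < d1 \<Longrightarrow> \<bar>(P t f x - f (E t *v x)) / t - levy_op Q a \<nu> f g h x\<bar> < e / 2"
      using levy_part_limit[OF C] e unfolding uniform_limit_at_right_0_iff by meson
    obtain d2 where d2: "d2 > 0" "\<And>r x. 0 \<le> r \<Longrightarrow> r < d2 \<Longrightarrow> \<bar>(A *v (E r *v x)) \<bullet> g (E r *v x) - (A *v x) \<bullet> g x\<bar> < e / 2"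
      using flow_uniformly_continuous[OF v e] by blast
    show "\<exists>d>0. \<forall>t. 0 < t \<longrightarrow> t < d \<longrightarrow> (\<forall>x. \<bar>(P t f x - f x) / t - OU_operator A Q a \<nu> f x\<bar> < e)"
    proof (intro exI[of _ "min d1 d2"] conjI allI impI)
      fix t x assume t: "0 < t" "t < min d1 d2"
      have C': "C2 f g h" using C by (simp add: C2_vanishing_def)
      \<comment> \<open>The flow quotient equals the drift term at an intermediate time
        \<open>z < t\<close>, to which \<open>flow_uniformly_continuous\<close> applies.\<close>
      obtain z where z: "0 < z" "z < t" "f (E t *v x) - f (E 0 *v x) = (t - 0) * ((A *v (E z *v x)) \<bullet> g (E z *v x))"
        using MVT2[of 0 t "\<lambda>r. f (E r *v x)" "\<lambda>r. (A *v (E r *v x)) \<bullet> g (E r *v x)"] flow_derivative[OF C'] t(1) by blast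
      have "(f (E t *v x) - f x) / t = (A *v (E z *v x)) \<bullet> g (E z *v x)"
        using z(3) t(1) unfolding E_0 by simp
      moreover have "(P t f x - f x) / t = (P t f x - f (E t *v x)) / t + (f (E t *v x) - f x) / t"
        by (simp add: diff_divide_distrib)
      moreover have "\<bar>(P t f x - f (E t *v x)) / t - levy_op Q a \<nu> f g h x\<bar> < e / 2" using d1(2) t by simp
      moreover have "\<bar>(A *v (E z *v x)) \<bullet> g (E z *v x) - (A *v x) \<bullet> g x\<bar> < e / 2" using d2(2)[of z x] z t by simp
      ultimately show "\<bar>(P t f x - f x) / t - OU_operator A Q a \<nu> f x\<bar> < e" unfolding OU by linarith
    qed (use d1 d2 in auto)
  qed
  moreover have "vanishing f" using C by (simp add: C2_vanishing_def)
  ultimately show ?thesis by (simp add: generates_at_def C0_iff_vanishing)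
qed

lemma generates_at_unique:
  assumes "generates_at P f g" "generates_at P f g'" shows "g = g'"
proof
  fix x
  have "((\<lambda>t. (P t f x - f x) / t) \<longlongrightarrow> g x) (at_right 0)" "((\<lambda>t. (P t f x - f x) / t) \<longlongrightarrow> g' x) (at_right 0)"
    using assms tendsto_uniform_limitI unfolding generates_at_def by fastforce+
  then show "g x = g' x" by (rule tendsto_unique[OF trivial_limit_at_right_real])
qed

lemma generator_eq: "generates_at P f g \<Longrightarrow> generator P f = g"
  unfolding generator_def using generates_at_unique by blast

text \<open>\<open>P t\<close> commutes with \<open>P s\<close> by the semigroup law and is a
  contraction, so it carries the uniformly convergent quotients of \<open>f\<close> to those of
  \<open>P t f\<close>.\<close>

lemma generates_at_P:
  assumes f: "generates_at P f g" and t: "t \<ge> 0"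
  shows "generates_at P (P t f) (P t g)"
proof -
  have v: "vanishing f" "vanishing g" using f by (auto simp: generates_at_def C0_iff_vanishing)
  have "uniform_limit UNIV (\<lambda>s x. (P s (P t f) x - P t f x) / s) (P t g) (at_right 0)"
    unfolding uniform_limit_at_right_0_iff
  proof (intro allI impI)
    fix e :: real assume e: "e > 0"
    obtain d where d: "d > 0" "\<And>s x. 0 < s \<Longrightarrow> s < d \<Longrightarrow> \<bar>(P s f x - f x) / s - g x\<bar> < e / 2"
      using f e unfolding generates_at_def uniform_limit_at_right_0_iff by (meson half_gt_zero)
    show "\<exists>d>0. \<forall>s. 0 < s \<longrightarrow> s < d \<longrightarrow> (\<forall>x. \<bar>(P s (P t f) x - P t f x) / s - P t g x\<bar> < e)"
    proof (intro exI[of _ d] conjI allI impI d(1))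
      fix s x assume s: "0 < s" "s < d"
      have vs: "vanishing (P s f)" using vanishing_P[OF v(1)] s by simp
      have "P s (P t f) x = P t (P s f) x"
        using P_semigroup[OF v(1), of s t x] P_semigroup[OF v(1), of t s x] s t by (simp add: add.commute)
      then have "(P s (P t f) x - P t f x) / s = P t (\<lambda>x. (1 / s) * (P s f x - f x)) x"
        unfolding P_cmult P_diff[OF vs v(1) t] by simp
      moreover have "\<bar>P t (\<lambda>x. (1 / s) * (P s f x - f x)) x - P t g x\<bar> \<le> e / 2"
        using d(2)[OF s] by (intro P_diff_le vanishing_cmult vanishing_diff vs v t) (auto intro: less_imp_le)
      ultimately show "\<bar>(P s (P t f) x - P t f x) / s - P t g x\<bar> < e" using e by simp
    qed
  qed
  then show ?thesis using vanishing_P[OF v(1) t] vanishing_P[OF v(2) t] by (simp add: generates_at_def C0_iff_vanishing)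
qed

text \<open>\<open>levy_part_limit\<close> and \<open>flow_derivative\<close> apply to
  \<open>P t f\<close> knowing only its regularity, because neither assumes the drift condition.
  Comparing limits at each point is enough, since the resulting identity expresses the drift as a
  difference of two C_0 functions.\<close>

lemma D0_invariant:
  assumes f: "f \<in> D0 A" and t: "t \<ge> 0" shows "P t f \<in> D0 A"
proof -
  obtain g h where C: "C2_vanishing f g h" using f D0_iff by blast
  obtain g' h' where C': "C2_vanishing (P t f) g' h'"
    using C2_vanishing_compose_matrix[OF C2_vanishing_shift_mean[OF C Y_measurable[OF t]] E_minus]
    unfolding P_eq[abs_def] by blast
  let ?G = "P t (OU_operator A Q a \<nu> f)" and ?L = "levy_op Q a \<nu> (P t f) g' h'"
  have gen: "generates_at P (P t f) ?G" by (rule generates_at_P[OF generates_at_D0[OF f] t])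
  have "?G x - ?L x = (A *v x) \<bullet> g' x" for x
  proof -
    have "((\<lambda>s. (P s (P t f) x - P t f x) / s) \<longlongrightarrow> ?G x) (at_right 0)"
      using gen tendsto_uniform_limitI unfolding generates_at_def by fastforce
    moreover have "((\<lambda>s. (P s (P t f) x - P t f (E s *v x)) / s + (P t f (E s *v x) - P t f x) / s) \<longlongrightarrow> ?L x + (A *v x) \<bullet> g' x) (at_right 0)"
    proof (intro tendsto_add)
      show "((\<lambda>s. (P s (P t f) x - P t f (E s *v x)) / s) \<longlongrightarrow> ?L x) (at_right 0)"
        using tendsto_uniform_limitI[OF levy_part_limit[OF C']] by simp
      have "C2 (P t f) g' h'" using C' by (simp add: C2_vanishing_def)
      from flow_derivative[OF this, of x 0]
      have "((\<lambda>s. (P t f (E s *v x) - P t f x) / s) \<longlongrightarrow> (A *v x) \<bullet> g' x) (at 0)"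
        by (simp add: DERIV_def mexp_0)
      then show "((\<lambda>s. (P t f (E s *v x) - P t f x) / s) \<longlongrightarrow> (A *v x) \<bullet> g' x) (at_right 0)"
        by (rule tendsto_within_subset) simp
    qed
    then have "((\<lambda>s. (P s (P t f) x - P t f x) / s) \<longlongrightarrow> ?L x + (A *v x) \<bullet> g' x) (at_right 0)"
      by (simp add: add_divide_distrib[symmetric])
    ultimately have "?G x = ?L x + (A *v x) \<bullet> g' x" by (rule tendsto_unique[OF trivial_limit_at_right_real])
    then show ?thesis by simp
  qed
  then have "vanishing (\<lambda>x. (A *v x) \<bullet> g' x)"
    using vanishing_diff[OF _ levy_op_vanishing[OF C'], of ?G] gen by (simp add: generates_at_def C0_iff_vanishing)
  then show ?thesis using C' D0_iff by blast
qed

section \<open>The core property\<close>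

lemma D0_subspace: "linear_subspace (D0 A)"
  unfolding linear_subspace_def
proof (intro conjI ballI allI)
  have "C2_vanishing (\<lambda>x::real^'n. 0) (\<lambda>_. 0) (\<lambda>_. 0)" by (simp add: C2_vanishing_def C2_def vanishing_zero)
  then show "(\<lambda>x. 0) \<in> D0 A" unfolding D0_iff using vanishing_zero by (intro exI conjI) auto
  fix f assume "f \<in> D0 A"
  then obtain g h where f: "C2_vanishing f g h" "vanishing (\<lambda>x. (A *v x) \<bullet> g x)" using D0_iff by blast
  show "(\<lambda>x. c * f x) \<in> D0 A" for c
    unfolding D0_iff using C2_vanishing_cmult[OF f(1), of c] vanishing_cmult[OF f(2), of c]
    by (intro exI conjI) auto
  fix f' assume "f' \<in> D0 A"
  then obtain g' h' where f': "C2_vanishing f' g' h'" "vanishing (\<lambda>x. (A *v x) \<bullet> g' x)" using D0_iff by blast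
  show "(\<lambda>x. f x + f' x) \<in> D0 A"
    unfolding D0_iff using C2_vanishing_add[OF f(1) f'(1)] vanishing_add[OF f(2) f'(2)]
    by (intro exI conjI) (auto simp: inner_add_right)
qed

lemma generates_at_add:
  assumes "generates_at P f g" "generates_at P f' g'"
  shows "generates_at P (\<lambda>x. f x + f' x) (\<lambda>x. g x + g' x)"
proof -
  have v: "vanishing f" "vanishing g" "vanishing f'" "vanishing g'"
    using assms by (auto simp: generates_at_def C0_iff_vanishing)
  have "uniform_limit UNIV (\<lambda>t x. (P t f x - f x) / t + (P t f' x - f' x) / t) (\<lambda>x. g x + g' x) (at_right 0)"
    using assms by (intro uniform_limit_add) (auto simp: generates_at_def)
  moreover have "\<forall>\<^sub>F t in at_right 0. \<forall>x\<in>UNIV. (P t f x - f x) / t + (P t f' x - f' x) / t = (P t (\<lambda>x. f x + f' x) x - (f x + f' x)) / t"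
  proof -
    have "\<forall>\<^sub>F t::real in at_right 0. t > 0" by (simp add: eventually_at_filter)
    then show ?thesis by eventually_elim (auto simp: P_add v add_divide_distrib diff_divide_distrib)
  qed
  ultimately have "uniform_limit UNIV (\<lambda>t x. (P t (\<lambda>x. f x + f' x) x - (f x + f' x)) / t) (\<lambda>x. g x + g' x) (at_right 0)"
    by (rule uniform_limit_cong[THEN iffD1, rotated 2]) auto
  then show ?thesis using v by (simp add: generates_at_def C0_iff_vanishing vanishing_add)
qed

lemma generates_at_cmult:
  assumes "generates_at P f g" shows "generates_at P (\<lambda>x. c * f x) (\<lambda>x. c * g x)"
proof -
  have "uniform_limit UNIV (\<lambda>t x. c * ((P t f x - f x) / t)) (\<lambda>x. c * g x) (at_right 0)"
    using assms by (intro bounded_linear.uniform_limit[OF bounded_linear_mult_right]) (auto simp: generates_at_def)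
  moreover have "c * ((P t f x - f x) / t) = (P t (\<lambda>x. c * f x) x - c * f x) / t" for t x
    by (simp add: P_cmult right_diff_distrib)
  ultimately have "uniform_limit UNIV (\<lambda>t x. (P t (\<lambda>x. c * f x) x - c * f x) / t) (\<lambda>x. c * g x) (at_right 0)"
    by (simp only:)
  then show ?thesis using assms by (simp add: generates_at_def C0_iff_vanishing vanishing_cmult)
qed

lemma generates_at_sum:
  fixes n :: nat
  assumes "\<And>k. k < n \<Longrightarrow> generates_at P (f k) (g k)"
  shows "generates_at P (\<lambda>x. \<Sum>k<n. f k x) (\<lambda>x. \<Sum>k<n. g k x)"
  using assms
proof (induction n)
  case 0
  have "P t (\<lambda>x. 0) x = 0" for t x by (simp add: P_eq)
  then show ?case by (simp add: generates_at_def C0_iff_vanishing vanishing_zero uniform_limit_iff)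
next
  case (Suc n)
  then show ?case using generates_at_add[of "\<lambda>x. \<Sum>k<n. f k x" "\<lambda>x. \<Sum>k<n. g k x" "f n" "g n"] by simp
qed

lemma D0_cmult: "f \<in> D0 A \<Longrightarrow> (\<lambda>x. c * f x) \<in> D0 A"
  using D0_subspace by (simp add: linear_subspace_def)

lemma D0_sum: "(\<And>k. k < (n::nat) \<Longrightarrow> f k \<in> D0 A) \<Longrightarrow> (\<lambda>x. \<Sum>k<n. f k x) \<in> D0 A"
proof (induction n)
  case 0 then show ?case using D0_subspace by (simp add: linear_subspace_def)
next
  case (Suc n)
  then show ?case using D0_subspace unfolding linear_subspace_def by simp
qed

lemma average_le:
  fixes f :: "nat \<Rightarrow> real"
  assumes "\<And>k. k < n \<Longrightarrow> \<bar>f k - c\<bar> \<le> e" "n > 0"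
  shows "\<bar>1 / real n * (\<Sum>k<n. f k) - c\<bar> \<le> e"
proof -
  have "1 / real n * (\<Sum>k<n. f k) - c = 1 / real n * (\<Sum>k<n. f k - c)"
    using assms(2) by (simp add: sum_subtractf right_diff_distrib)
  also have "\<bar>\<dots>\<bar> \<le> 1 / real n * (\<Sum>k<n. e)"
    unfolding abs_mult using assms by (intro mult_mono order_trans[OF sum_abs sum_mono]) auto
  finally show ?thesis using assms(2) by simp
qed

lemma P_telescope:
  assumes p: "vanishing p" and t: "t \<ge> 0"
  shows "(\<Sum>k<n. P (real k * t) (P t p) x - P (real k * t) p x) = P (real n * t) p x - p x"
proof -
  have "P (real k * t) (P t p) x = P (real (Suc k) * t) p x" for k
    using P_semigroup[OF p, of "real k * t" t x] t by (simp add: algebra_simps)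
  then have "(\<Sum>k<n. P (real k * t) (P t p) x - P (real k * t) p x) = (\<Sum>k<n. P (real (Suc k) * t) p x - P (real k * t) p x)"
    by simp
  also have "\<dots> = P (real n * t) p x - P (real 0 * t) p x" by (rule sum_lessThan_telescope)
  finally show ?thesis using P_0[OF p] by simp
qed

text \<open>An element of the domain is approximated in the graph norm by the averages over \<open>k < N\<close> of
  \<open>P\<^bsub>kt/N\<^esub> p\<close> for a nearby \<open>p\<close>; a telescoping sum compares their image under the generator with
  \<open>(P\<^sub>t p - p) / t\<close>, so no integral over time is needed.\<close>

lemma core_approx:
  assumes f: "generates_at P f G" and e: "e > 0"
  obtains R where "R \<in> D0 A" "\<And>x. \<bar>R x - f x\<bar> \<le> e" "\<And>x. \<bar>generator P R x - G x\<bar> \<le> e"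
proof -
  \<comment> \<open>The four quarters: one for averaging the generator, two for replacing
    \<open>f\<close> by \<open>p\<close> in the quotient at time \<open>t\<close>, one for the
    quotient of \<open>f\<close> against \<open>G\<close>.\<close>
  define e' where "e' = e / 4"
  have e': "e' > 0" using e by (simp add: e'_def)
  have v: "vanishing f" "vanishing G" using f by (auto simp: generates_at_def C0_iff_vanishing)
  obtain B where B: "B > 0" "\<And>x. norm (G x) \<le> B" using vanishing_bounded[OF v(2)] by auto
  obtain d where d: "d > 0" "\<And>s x. 0 < s \<Longrightarrow> s < d \<Longrightarrow> \<bar>(P s f x - f x) / s - G x\<bar> < e'"
    using f e' unfolding generates_at_def uniform_limit_at_right_0_iff by meson
  \<comment> \<open>\<open>t < d\<close> controls the quotient of \<open>f\<close>,
    \<open>t \<le> 1\<close> turns \<open>e' * t\<close> into at most \<open>e'\<close>, and the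
    last bound keeps \<open>P s f\<close> within \<open>e'\<close> of \<open>f\<close> for all
    \<open>s \<le> t\<close>, as the quotients are at most \<open>B + e'\<close>.\<close>
  define t where "t = min (min (d / 2) 1) (e' / (B + e'))"
  have Be: "B + e' > 0" using B e' by simp
  have t: "0 < t" "t < d" "t \<le> 1" "t \<le> e' / (B + e')" using d(1) e' Be by (auto simp: t_def)
  have Pf: "\<bar>P s f x - f x\<bar> \<le> e'" if s: "0 \<le> s" "s \<le> t" for s x
  proof (cases "s = 0")
    case True then show ?thesis using P_0[OF v(1)] e' by simp
  next
    case False
    then have s0: "0 < s" using s by simp
    have "\<bar>(P s f x - f x) / s\<bar> \<le> B + e'" using d(2)[of s x] s t B(2)[of x] s0 by simp
    then have "\<bar>P s f x - f x\<bar> \<le> (B + e') * s" using s0 by (simp add: pos_divide_le_eq)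
    also have "\<dots> \<le> (B + e') * (e' / (B + e'))" using s t Be by (intro mult_left_mono) auto
    finally show ?thesis using Be by simp
  qed
  have "e' * t > 0" using e' t by simp
  \<comment> \<open>The precision is proportional to \<open>t\<close> because this error is divided
    by \<open>t\<close> in the difference quotient.\<close>
  then obtain p where p: "p \<in> D0 A" "\<And>x. \<bar>f x - p x\<bar> \<le> e' * t" using D0_dense[OF v(1)] by blast
  let ?L = "OU_operator A Q a \<nu> p"
  have gp: "generates_at P p ?L" by (rule generates_at_D0[OF p(1)])
  then have vp: "vanishing p" "vanishing ?L" by (auto simp: generates_at_def C0_iff_vanishing)
  obtain d' where d': "d' > 0" "\<And>s x. 0 < s \<Longrightarrow> s < d' \<Longrightarrow> \<bar>(P s p x - p x) / s - ?L x\<bar> < e'"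
    using gp e' unfolding generates_at_def uniform_limit_at_right_0_iff by meson
  \<comment> \<open>\<open>N\<close> is chosen after \<open>p\<close>: the step \<open>t / N\<close>
    must be short on the scale \<open>d'\<close> on which the quotients of \<open>p\<close> approach
    its image under the generator.\<close>
  obtain N where N: "t / d' < real N" using reals_Archimedean2 by blast
  moreover have "t / d' > 0" using t d'(1) by simp
  ultimately have N0: "N > 0" using gr0I by fastforce
  define s where "s = t / N"
  have s: "0 < s" "s < d'" "real N * s = t" using N N0 t d'(1) by (auto simp: s_def field_simps)
  have ks: "0 \<le> real k * s" "real k * s \<le> t" if "k < N" for k
    using s that mult_right_mono[of "real k" "real N" s] by auto
  define R where "R = (\<lambda>x. 1 / real N * (\<Sum>k<N. P (real k * s) p x))"
  define S where "S = (\<lambda>x. 1 / real N * (\<Sum>k<N. P (real k * s) ?L x))"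
  have gR: "generates_at P R S"
    unfolding R_def S_def using s(1) by (intro generates_at_cmult generates_at_sum generates_at_P gp) simp
  show thesis
  proof (rule that[of R])
    show "R \<in> D0 A"
    proof -
      have "(\<lambda>x. \<Sum>k<N. P (real k * s) p x) \<in> D0 A"
        using s(1) by (intro D0_sum D0_invariant[OF p(1)]) simp
      then show ?thesis unfolding R_def by (rule D0_cmult)
    qed
    fix x
    have "\<bar>P (real k * s) p x - f x\<bar> \<le> 2 * e'" if k: "k < N" for k
    proof -
      have "\<bar>P (real k * s) f x - P (real k * s) p x\<bar> \<le> e' * t"
        by (rule P_diff_le[OF v(1) vp(1) ks(1)[OF k] p(2)])
      moreover have "e' * t \<le> e' * 1" using t e' by (intro mult_left_mono) auto
      ultimately show ?thesis using Pf[OF ks[OF k], of x] by linarith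
    qed
    then have "\<bar>R x - f x\<bar> \<le> 2 * e'" unfolding R_def by (intro average_le N0)
    then show "\<bar>R x - f x\<bar> \<le> e" using e by (simp add: e'_def)
    have vs: "vanishing (P s p)" using vanishing_P[OF vp(1)] s(1) by simp
    \<comment> \<open>The quotient at time \<open>t\<close> is the average of the quotients at step
      \<open>s\<close> moved by the semigroup, so it can be compared with \<open>S\<close> term by
      term.\<close>
    have "(P t p x - p x) / t = 1 / real N * (\<Sum>k<N. (P (real k * s) (P s p) x - P (real k * s) p x) / s)"
      using P_telescope[OF vp(1), where t = s and n = N and x = x] s N0 t by (simp add: sum_divide_distrib[symmetric] field_simps)
    then have "S x - (P t p x - p x) / t = 1 / real N * (\<Sum>k<N. P (real k * s) ?L x - (P (real k * s) (P s p) x - P (real k * s) p x) / s) - 0"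
      unfolding S_def by (simp add: sum_subtractf right_diff_distrib)
    also have "\<bar>\<dots>\<bar> \<le> e'"
    proof (rule average_le[OF _ N0])
      fix k assume k: "k < N"
      have "(P (real k * s) (P s p) x - P (real k * s) p x) / s = P (real k * s) (\<lambda>x. (1 / s) * (P s p x - p x)) x"
        unfolding P_cmult P_diff[OF vs vp(1) ks(1)[OF k]] by simp
      moreover have "\<bar>P (real k * s) (\<lambda>x. (1 / s) * (P s p x - p x)) x - P (real k * s) ?L x\<bar> \<le> e'"
        using d'(2)[OF s(1,2)]
        by (intro P_diff_le vanishing_cmult vanishing_diff vs vp ks(1) k) (auto intro: less_imp_le)
      ultimately show "\<bar>P (real k * s) ?L x - (P (real k * s) (P s p) x - P (real k * s) p x) / s - 0\<bar> \<le> e'"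
        by linarith
    qed
    finally have 1: "\<bar>S x - (P t p x - p x) / t\<bar> \<le> e'" .
    \<comment> \<open>\<open>f\<close> and \<open>p\<close> differ by \<open>e' * t\<close> both
      before and after applying \<open>P t\<close>; division by \<open>t\<close> leaves
      \<open>2 * e'\<close>.\<close>
    have "\<bar>(P t f x - P t p x) - (f x - p x)\<bar> \<le> 2 * e' * t"
      using P_diff_le[OF v(1) vp(1) less_imp_le[OF t(1)] p(2), of x] p(2)[of x] by linarith
    then have "\<bar>((P t f x - P t p x) - (f x - p x)) / t\<bar> \<le> 2 * e'" using t(1) by (simp add: pos_divide_le_eq)
    moreover have "((P t f x - P t p x) - (f x - p x)) / t = (P t f x - f x) / t - (P t p x - p x) / t"
      by (simp add: diff_divide_distrib)
    ultimately have 2: "\<bar>(P t f x - f x) / t - (P t p x - p x) / t\<bar> \<le> 2 * e'" by simp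
    have "\<bar>S x - G x\<bar> \<le> 4 * e'" using 1 2 d(2)[OF t(1,2), of x] by linarith
    then show "\<bar>generator P R x - G x\<bar> \<le> e" unfolding generator_eq[OF gR] by (simp add: e'_def)
  qed
qed

lemma D0_core: "is_core (D0 A) P"
  unfolding is_core_def
proof (intro conjI ballI D0_subspace subsetI)
  show "f \<in> gen_domain P" if "f \<in> D0 A" for f
    using generates_at_D0[OF that] by (auto simp: gen_domain_def)
  fix f assume "f \<in> gen_domain P"
  then obtain G where G: "generates_at P f G" by (auto simp: gen_domain_def)
  have "\<forall>n::nat. \<exists>R. R \<in> D0 A \<and> (\<forall>x. \<bar>R x - f x\<bar> \<le> 1 / real (Suc n)) \<and> (\<forall>x. \<bar>generator P R x - G x\<bar> \<le> 1 / real (Suc n))"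
    using core_approx[OF G] by (metis of_nat_0_less_iff zero_less_Suc zero_less_divide_1_iff)
  then obtain fs where fs: "\<And>n. fs n \<in> D0 A" "\<And>n x. \<bar>fs n x - f x\<bar> \<le> 1 / real (Suc n)"
    "\<And>n x. \<bar>generator P (fs n) x - G x\<bar> \<le> 1 / real (Suc n)" by metis
  have lim: "uniform_limit UNIV u l sequentially" if "\<And>n x. \<bar>u n x - l x\<bar> \<le> 1 / real (Suc n)" for u and l :: "real^'n \<Rightarrow> real"
    unfolding uniform_limit_iff
  proof (intro allI impI)
    fix e :: real assume "e > 0"
    then have "\<forall>\<^sub>F n in sequentially. 1 / real (Suc n) < e"
      using order_tendstoD(2)[OF LIMSEQ_inverse_real_of_nat] by (simp add: inverse_eq_divide)
    then show "\<forall>\<^sub>F n in sequentially. \<forall>x\<in>UNIV. dist (u n x) (l x) < e"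
    proof eventually_elim
      case (elim n)
      show ?case using order.strict_trans1[OF that elim] by (simp add: dist_real_def)
    qed
  qed
  show "\<exists>fs. (\<forall>n. fs n \<in> D0 A) \<and> uniform_limit UNIV fs f sequentially \<and>
        uniform_limit UNIV (\<lambda>n. generator P (fs n)) (generator P f) sequentially"
    using fs lim unfolding generator_eq[OF G] by (intro exI[of _ fs]) auto
qed

end

theorem theorem3p4:
  fixes A Q :: "real^'n^'n" and a :: "real^'n" and \<nu> :: "(real^'n) measure"
    and M :: "'w measure" and Z Y :: "real \<Rightarrow> 'w \<Rightarrow> real^'n"
  assumes Q_symmetric: "transpose Q = Q"
    and Q_nonneg: "\<And>u. 0 \<le> (Q *v u) \<bullet> u"
    and nu: "levy_measure \<nu>"
    and Z_levy: "levy_process M Z"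
    and Z_exponent: "\<And>t u. t \<ge> 0 \<Longrightarrow>
      (\<integral> \<omega>. exp (\<i> * of_real (u \<bullet> Z t \<omega>)) \<partial>M) = exp (- of_real t * levy_exponent Q a \<nu> u)"
    and Y_integral: "\<And>t. t \<ge> 0 \<Longrightarrow>
      has_stochastic_integral M Z (\<lambda>s. mexp ((t - s) *\<^sub>R A)) t (Y t)"
  shows "(D0 A \<subseteq> gen_domain (OU_semigroup M A Y) \<and>
          (\<forall>f\<in>D0 A. generator (OU_semigroup M A Y) f = OU_operator A Q a \<nu> f)) \<and>
         (\<forall>t\<ge>0. OU_semigroup M A Y t ` D0 A \<subseteq> D0 A) \<and>
         is_core (D0 A) (OU_semigroup M A Y)"
proof -
  interpret OU_driven M Z A Q a \<nu> Y
    using Z_levy nu Z_exponent Y_integral by (simp add: OU_driven_def OU_driven_axioms_def)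
  have "D0 A \<subseteq> gen_domain P" using D0_core by (simp add: is_core_def)
  moreover have "\<forall>f\<in>D0 A. generator P f = OU_operator A Q a \<nu> f"
    using generates_at_D0 generator_eq by blast
  moreover have "\<forall>t\<ge>0. P t ` D0 A \<subseteq> D0 A" using D0_invariant by blast
  ultimately show ?thesis using D0_core by blast
qed

end
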